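(* Let $c$ be an arbitrary constant with $0<c\le 1/2$. Let $[a,b]\subset[x,2x]$ be an interval with $b-a\le x^{1/2+c}$. Then the parity of $\#\{p\in[a,b] : p \text{ prime}\}$ can be determined in time $O\bigl(x^{\max(c,\,7/15)+\varepsilon}\bigr)$ for every $\varepsilon>0$.
   Context: Time means the number of operations performed by a deterministic algorithm that receives the interval $[a,b]$ (and $x$) as input. An estimate containing $\varepsilon$ is understood to hold for every real $\varepsilon>0$, with implied constant possibly depending on $\varepsilon$ (and on the constant $c$). *)

theory Defs
  imports Complex_Main "HOL-Library.Discrete_Functions" "HOL-Computational_Algebra.Primes"
begin

text \<open>
  Deterministic algorithms are programs of a random access machine over the natural numbers, and
  their running time is the number of bit operations (logarithmic cost criterion).
  Charging one unit per instruction irrespective of operand size would be unsound here, since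
  iterated multiplication builds huge numbers in few instructions; on numbers with
  \<open>O(log x)\<close> bits the two ways of counting differ only by a factor
  polynomial in \<open>log x\<close>.
\<close>

type_synonym memory = "nat \<Rightarrow> nat"

datatype location = Cell nat | Indirect nat

datatype operand = Const nat | Loc location

datatype arith = Add | Sub | Mul | Div | Mod

datatype test = Less | Equal

datatype instr =
    Assign location arith operand operand
  | Branch test operand operand nat  \<comment> \<open>the last argument is the jump target\<close>

type_synonym program = "instr list"

fun addr :: "memory \<Rightarrow> location \<Rightarrow> nat" where
  "addr M (Cell i) = i"
| "addr M (Indirect i) = M i"

fun val :: "memory \<Rightarrow> operand \<Rightarrow> nat" where
  "val M (Const n) = n"
| "val M (Loc l) = M (addr M l)"

text \<open>Subtraction is truncated at zero, and \<open>n div 0 = 0\<close>, \<open>n mod 0 = n\<close>.\<close>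

fun arith_op :: "arith \<Rightarrow> nat \<Rightarrow> nat \<Rightarrow> nat" where
  "arith_op Add m n = m + n"
| "arith_op Sub m n = m - n"
| "arith_op Mul m n = m * n"
| "arith_op Div m n = m div n"
| "arith_op Mod m n = m mod n"

fun test_op :: "test \<Rightarrow> nat \<Rightarrow> nat \<Rightarrow> bool" where
  "test_op Less m n \<longleftrightarrow> m < n"
| "test_op Equal m n \<longleftrightarrow> m = n"

text \<open>The number of binary digits, with \<open>bits 0 = 1\<close>.\<close>

definition bits :: "nat \<Rightarrow> nat" where
  "bits n = Suc (floor_log n)"

fun location_cost :: "memory \<Rightarrow> location \<Rightarrow> nat" where
  "location_cost M (Cell i) = bits i"
| "location_cost M (Indirect i) = bits i + bits (M i)"

fun operand_cost :: "memory \<Rightarrow> operand \<Rightarrow> nat" where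
  "operand_cost M (Const n) = bits n"
| "operand_cost M (Loc l) = location_cost M l + bits (M (addr M l))"

text \<open>Multiplication and division are charged at the cost of the schoolbook methods.\<close>

fun arith_cost :: "arith \<Rightarrow> nat \<Rightarrow> nat \<Rightarrow> nat" where
  "arith_cost Add m n = bits m + bits n"
| "arith_cost Sub m n = bits m + bits n"
| "arith_cost Mul m n = bits m * bits n"
| "arith_cost Div m n = bits m * bits n"
| "arith_cost Mod m n = bits m * bits n"

fun instr_cost :: "memory \<Rightarrow> instr \<Rightarrow> nat" where
  "instr_cost M (Assign l f u v) =
     1 + location_cost M l + operand_cost M u + operand_cost M v + arith_cost f (val M u) (val M v)"
| "instr_cost M (Branch r u v k) =
     1 + operand_cost M u + operand_cost M v + bits (val M u) + bits (val M v)"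

fun step :: "instr \<Rightarrow> nat \<times> memory \<Rightarrow> nat \<times> memory" where
  "step (Assign l f u v) (pc, M) = (Suc pc, M(addr M l := arith_op f (val M u) (val M v)))"
| "step (Branch r u v k) (pc, M) = (if test_op r (val M u) (val M v) then k else Suc pc, M)"

text \<open>
  \<open>run P (pc, M) t M'\<close>: started in program line \<open>pc\<close> with memory \<open>M\<close>, the program \<open>P\<close> halts with
  memory \<open>M'\<close> after instructions of total cost \<open>t\<close>. Leaving the program text is halting.
\<close>

inductive run :: "program \<Rightarrow> nat \<times> memory \<Rightarrow> nat \<Rightarrow> memory \<Rightarrow> bool" for P where
  halt: "length P \<le> pc \<Longrightarrow> run P (pc, M) 0 M"
| exec: "pc < length P \<Longrightarrow> run P (step (P ! pc) (pc, M)) t M' \<Longrightarrow>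
           run P (pc, M) (instr_cost M (P ! pc) + t) M'"

lemma run_deterministic:
  assumes "run P s t M" "run P s t' M'"
  shows "t = t' \<and> M = M'"
  using assms
proof (induction arbitrary: t' M' rule: run.induct)
  case (halt pc M)
  from halt.prems show ?case
    by (rule run.cases) (use halt.hyps in auto)
next
  case (exec pc M t M'')
  from exec.prems obtain u where "t' = instr_cost M (P ! pc) + u"
    and "run P (step (P ! pc) (pc, M)) u M'"
    by (rule run.cases) (use exec.hyps(1) in auto)
  with exec.IH[of u M'] show ?case by simp
qed

definition initial_memory :: "nat list \<Rightarrow> memory" where
  "initial_memory ns i = (if i < length ns then ns ! i else 0)"

text \<open>The output is read off cell \<open>0\<close>.\<close>

definition computes_in_time :: "program \<Rightarrow> nat list \<Rightarrow> nat \<Rightarrow> nat \<Rightarrow> bool" where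
  "computes_in_time P ns r t \<longleftrightarrow> (\<exists>M. run P (0, initial_memory ns) t M \<and> M 0 = r)"

text \<open>
  For real \<open>a\<close>, \<open>b\<close>, \<open>x\<close>, what the machine is given is the interval of integers contained in
  \<open>[a, b]\<close>, represented by its end points, and the integer part of \<open>x\<close>.
  For integers \<open>a\<close>, \<open>b\<close>, \<open>x\<close> the rounding does nothing.
\<close>

definition interval_input :: "real \<Rightarrow> real \<Rightarrow> real \<Rightarrow> nat list" where
  "interval_input a b x = [nat \<lceil>a\<rceil>, nat \<lfloor>b\<rfloor>, nat \<lfloor>x\<rfloor>]"

end

theory Submission
  imports Defs "HOL-Number_Theory.Prime_Powers" "HOL-Computational_Algebra.Squarefree"
    "HOL-Computational_Algebra.Nth_Powers" "HOL-Analysis.Summation_Tests"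
begin

text \<open>
  For \<open>n > 1\<close> the number \<open>c(n)\<close> of factorizations \<open>n = u v\<close> with \<open>u < v\<close> coprime is
  \<open>2 ^ (\<omega>(n) - 1)\<close>, which is odd exactly for prime powers. If \<open>r(n)\<close> counts all factorizations with
  \<open>u < v\<close>, then \<open>r(n)\<close> is the sum of \<open>c(n / d\<^sup>2)\<close>. Modulo two the Moebius function is the indicator of
  the squarefree numbers, and that indicator is in turn the number of \<open>(f, g)\<close> with \<open>d = f g\<^sup>2\<close> and \<open>g\<close>
  squarefree. So \<open>c(n)\<close> is congruent to the number of \<open>(f, g, u, v)\<close> with \<open>f\<^sup>2 g\<^sup>4 u v = n\<close>, \<open>u < v\<close>, \<open>g\<close>
  squarefree. The same inversion over roots passes from prime powers to primes, so it suffices to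
  count these quadruples up to a bound.

  The triples \<open>f\<^sup>2 u v \<le> z\<close> are counted by summing over \<open>f\<close> when \<open>f \<le> F\<close>, with \<open>F\<close> about \<open>z ^ (3/10)\<close>, and by
  summing over \<open>(u, v)\<close> and extracting a square root otherwise. The first part needs the number of
  pairs \<open>u v \<le> w\<close> in time \<open>w ^ (5/12 + \<epsilon>)\<close>. For \<open>u\<close> beyond \<open>h ^ 5\<close>, with \<open>h\<close> about \<open>w ^ (1/12)\<close>, the
  hyperbola is replaced on blocks of length \<open>h\<close> by a tangent and by a parallel line above it. The two
  floor sums along these lines take logarithmic time by a Euclidean recursion. If they agree, they are
  the sum wanted; if not, the block is summed naively. A bad block yields some \<open>n\<close> close to \<open>w\<close> with a
  divisor in the block, so the divisor bound shows that there are few of them.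
\<close>

subsection \<open>While programs and their compilation\<close>

text \<open>Writing the squarefree indicator as a count of pairs leaves \<open>f\<close> free of
  conditions, so one square root counts all large \<open>f\<close> at once; squarefreeness is tested
  only for \<open>g\<close>, which stays below the fourth root of the bound. The exponent 5/12 is a
  balance. A bad block at \<open>u\<close> yields a product within about w h^2 / u^2 of
  \<open>w\<close>. With \<open>w\<close> about h^12 and \<open>u\<close> beyond h^5 this is h^4, so
  up to divisor counts there are h^4 bad blocks of cost \<open>h\<close> each. The naive beginning
  costs h^5, and up to logarithms so do the (sqrt w) / h = h^5 blocks. All numbers that occur are
  polynomial in the bound. It is therefore enough to count instructions and to keep every number
  below \<open>2 ^ L\<close> with \<open>L\<close> logarithmic; an instruction then costs at most a
  constant times L^2 bit operations. The interval enters through two counts of primes, one up to its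
  end and one up to just before its start, which are added modulo two.\<close>

datatype com =
    Asg nat arith operand operand
  | Seq com com
  | Cond test operand operand com com
  | While test operand operand com

primrec len :: "com \<Rightarrow> nat" where
  "len (Asg r f u v) = 1"
| "len (Seq c d) = len c + len d"
| "len (Cond r u v c d) = len c + len d + 2"
| "len (While r u v c) = len c + 3"

abbreviation jump :: "nat \<Rightarrow> instr" where
  "jump k \<equiv> Branch Equal (Const 0) (Const 0) k"

text \<open>The first argument is the line at which the code will stand, since jump targets are
  absolute. \<open>Branch\<close> jumps on success, so the failing branch \<open>d\<close> comes
  first, and a loop test hops over its own exit jump. A test thus costs at most two control
  instructions: itself and one jump.\<close>

primrec compile :: "nat \<Rightarrow> com \<Rightarrow> program" where
  "compile p (Asg r f u v) = [Assign (Cell r) f u v]"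
| "compile p (Seq c d) = compile p c @ compile (p + len c) d"
| "compile p (Cond r u v c d) =
     Branch r u v (p + len d + 2) # compile (p + 1) d @ jump (p + len c + len d + 2) # compile (p + len d + 2) c"
| "compile p (While r u v c) =
     Branch r u v (p + 2) # jump (p + len c + 3) # compile (p + 2) c @ [jump p]"

lemma length_compile [simp]: "length (compile p c) = len c"
  by (induction c arbitrary: p) auto

text \<open>Constants and addresses are charged by their bit length too, so they have to be bounded
  just like the contents of memory.\<close>

fun operand_below :: "nat \<Rightarrow> operand \<Rightarrow> bool" where
  "operand_below B (Const n) \<longleftrightarrow> n < B"
| "operand_below B (Loc (Cell i)) \<longleftrightarrow> i < B"
| "operand_below B (Loc (Indirect i)) \<longleftrightarrow> i < B"

primrec com_below :: "nat \<Rightarrow> com \<Rightarrow> bool" where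
  "com_below B (Asg r f u v) \<longleftrightarrow> r < B \<and> operand_below B u \<and> operand_below B v"
| "com_below B (Seq c d) \<longleftrightarrow> com_below B c \<and> com_below B d"
| "com_below B (Cond r u v c d) \<longleftrightarrow> operand_below B u \<and> operand_below B v \<and> com_below B c \<and> com_below B d"
| "com_below B (While r u v c) \<longleftrightarrow> operand_below B u \<and> operand_below B v \<and> com_below B c"

lemma operand_below_mono: "operand_below B u \<Longrightarrow> B \<le> B' \<Longrightarrow> operand_below B' u"
  by (induction B u rule: operand_below.induct) auto

lemma com_below_mono: "com_below B c \<Longrightarrow> B \<le> B' \<Longrightarrow> com_below B' c"
  by (induction c) (auto intro: operand_below_mono)

text \<open>
  \<open>exec B c M n M'\<close> counts instructions instead of bit operations, and keeps all results below \<open>B\<close>.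
  Truncated subtraction, division and remainder cannot exceed their first argument.
\<close>

definition result_ok :: "nat \<Rightarrow> arith \<Rightarrow> nat \<Rightarrow> nat \<Rightarrow> bool" where
  "result_ok B f m n \<longleftrightarrow> (f = Add \<or> f = Mul \<longrightarrow> arith_op f m n < B)"

lemma result_ok_simps [simp]:
  "result_ok B Add m n \<longleftrightarrow> m + n < B" "result_ok B Mul m n \<longleftrightarrow> m * n < B"
  "result_ok B Sub m n" "result_ok B Div m n" "result_ok B Mod m n"
  by (auto simp: result_ok_def)

inductive exec :: "nat \<Rightarrow> com \<Rightarrow> memory \<Rightarrow> nat \<Rightarrow> memory \<Rightarrow> bool" for B where
  Asg: "result_ok B f (val M u) (val M v) \<Longrightarrow>
          exec B (Asg r f u v) M 1 (M(r := arith_op f (val M u) (val M v)))"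
| Seq: "exec B c M m M' \<Longrightarrow> exec B d M' n M'' \<Longrightarrow> exec B (Seq c d) M (m + n) M''"
| CondT: "test_op r (val M u) (val M v) \<Longrightarrow> exec B c M n M' \<Longrightarrow> exec B (Cond r u v c d) M (n + 2) M'"
| CondF: "\<not> test_op r (val M u) (val M v) \<Longrightarrow> exec B d M n M' \<Longrightarrow> exec B (Cond r u v c d) M (n + 2) M'"
| WhileF: "\<not> test_op r (val M u) (val M v) \<Longrightarrow> exec B (While r u v c) M 2 M"
| WhileT: "test_op r (val M u) (val M v) \<Longrightarrow> exec B c M m M' \<Longrightarrow> exec B (While r u v c) M' n M'' \<Longrightarrow>
             exec B (While r u v c) M (m + 2 + n) M''"

lemma bits_le: "n < 2 ^ L \<Longrightarrow> 1 \<le> L \<Longrightarrow> bits n \<le> L"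
proof (cases "n = 0")
  case False
  assume "n < 2 ^ L"
  have "2 ^ floor_log n \<le> n" using False by (simp add: floor_log_exp2_le)
  with \<open>n < 2 ^ L\<close> have "(2::nat) ^ floor_log n < 2 ^ L" by linarith
  then show ?thesis by (simp add: bits_def Suc_le_eq)
qed (simp add: bits_def)

lemma val_less: "operand_below B u \<Longrightarrow> \<forall>i. M i < B \<Longrightarrow> val M u < B"
  by (cases u) auto

lemma operand_cost_le:
  assumes "operand_below (2 ^ L) u" "\<forall>i. M i < 2 ^ L" "1 \<le> L"
  shows "operand_cost M u \<le> 3 * L"
proof -
  have b: "n < 2 ^ L \<Longrightarrow> bits n \<le> L" for n using bits_le assms(3) by blast
  have m: "bits (M i) \<le> L" for i using b assms(2) by blast
  show ?thesis
  proof (cases u)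
    case (Const n)
    then show ?thesis using assms(1) b[of n] by simp
  next
    case (Loc l)
    then show ?thesis
    proof (cases l)
      case (Cell i)
      with Loc show ?thesis using assms(1) b[of i] m[of i] by simp
    next
      case (Indirect i)
      with Loc show ?thesis using assms(1) b[of i] m[of i] m[of "M i"] by simp
    qed
  qed
qed

text \<open>Each operand contributes at most \<open>3 * L\<close>, the target address
  \<open>L\<close>, the operation \<open>2 * L\<^sup>2\<close>; with the unit charge and
  \<open>L \<le> L\<^sup>2\<close> the sum is within \<open>10 * L\<^sup>2\<close>.\<close>

lemma instr_cost_Assign_le:
  assumes "r < 2 ^ L" "operand_below (2 ^ L) u" "operand_below (2 ^ L) v" "\<forall>i. M i < 2 ^ L" "1 \<le> L"
  shows "instr_cost M (Assign (Cell r) f u v) \<le> 10 * L\<^sup>2"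
proof -
  have u: "bits (val M u) \<le> L" and v: "bits (val M v) \<le> L" and r: "bits r \<le> L"
    using assms by (auto intro!: bits_le val_less)
  have LL: "L \<le> L * L" using assms(5) by simp
  have "arith_cost f (val M u) (val M v) \<le> 2 * (L * L)"
  proof (cases f)
    case Add
    have "bits (val M u) + bits (val M v) \<le> 2 * (L * L)" using u v LL by linarith
    with Add show ?thesis by simp
  next
    case Sub
    have "bits (val M u) + bits (val M v) \<le> 2 * (L * L)" using u v LL by linarith
    with Sub show ?thesis by simp
  qed (use mult_mono[OF u v] in auto)
  then show ?thesis
    using operand_cost_le[OF assms(2,4,5)] operand_cost_le[OF assms(3,4,5)] r LL assms(5)
    unfolding instr_cost.simps location_cost.simps power2_eq_square by linarith
qed

lemma instr_cost_Branch_le: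
  assumes "operand_below (2 ^ L) u" "operand_below (2 ^ L) v" "\<forall>i. M i < 2 ^ L" "1 \<le> L"
  shows "instr_cost M (Branch r u v k) \<le> 10 * L\<^sup>2"
proof -
  have u: "bits (val M u) \<le> L" and v: "bits (val M v) \<le> L"
    using assms by (auto intro!: bits_le val_less)
  have LL: "L \<le> L * L" using assms(4) by simp
  then show ?thesis
    using operand_cost_le[OF assms(1,3,4)] operand_cost_le[OF assms(2,3,4)] u v assms(4)
    unfolding instr_cost.simps power2_eq_square by linarith
qed

lemma run_instr:
  assumes "P = pre @ i # post" "p = length pre" "run P (step i (p, M)) t M'" "instr_cost M i \<le> K"
  shows "\<exists>t'. run P (p, M) t' M' \<and> t' \<le> t + K"
  using run.exec[of p P M t M'] assms by auto

lemma arith_op_less: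
  assumes "result_ok B f m n" "m < B"
  shows "arith_op f m n < B"
proof -
  have "arith_op f m n \<le> m" if "f \<noteq> Add" "f \<noteq> Mul"
    using that by (cases f) (auto intro: div_le_dividend mod_less_eq_dividend)
  with assms show ?thesis
    by (cases "f = Add \<or> f = Mul") (auto simp: result_ok_def)
qed

lemma exec_bounded:
  assumes "exec B c M n M'" "com_below B c" "\<forall>i. M i < B"
  shows "\<forall>i. M' i < B"
  using assms by (induction rule: exec.induct) (auto intro!: arith_op_less val_less)

text \<open>\<open>run\<close> describes complete runs only, so the claim is in continuation style:
  a run from the end of the code of \<open>c\<close> is extended backwards to one from its start.
  Every instruction counted by \<open>exec\<close> is paid with \<open>10 * L\<^sup>2\<close>, which
  suffices because all contents stay below \<open>2 ^ L\<close>.\<close>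

lemma run_compile:
  assumes "exec (2 ^ L) c M n M'" "com_below (2 ^ L) c" "\<forall>i. M i < 2 ^ L" "1 \<le> L"
    and "P = pre @ compile (length pre) c @ post" "run P (length pre + len c, M') t M''"
  shows "\<exists>t'. run P (length pre, M) t' M'' \<and> t' \<le> t + n * (10 * L\<^sup>2)"
  using assms
proof (induction arbitrary: pre post t M'' rule: exec.induct)
  case (Asg f M u v r)
  have "instr_cost M (Assign (Cell r) f u v) \<le> 10 * L\<^sup>2"
    using Asg.prems by (intro instr_cost_Assign_le) auto
  moreover have "run P (step (Assign (Cell r) f u v) (length pre, M)) t M''"
    using Asg.prems by (simp add: fun_upd_def)
  ultimately show ?case
    using run_instr[OF _ refl, of P pre "Assign (Cell r) f u v" post M t M'' "10 * L\<^sup>2"] Asg.prems(4)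
    by simp
next
  case (Seq c M m M' d n Ma)
  have M': "\<forall>i. M' i < 2 ^ L"
    using exec_bounded[OF Seq.hyps(1)] Seq.prems by simp
  obtain t' where t': "run P (length (pre @ compile (length pre) c), M') t' M''"
      "t' \<le> t + n * (10 * L\<^sup>2)"
    using Seq.IH(2)[of "pre @ compile (length pre) c" post t M''] Seq.prems M' by (auto simp: add.assoc)
  then obtain t'' where "run P (length pre, M) t'' M''" "t'' \<le> t' + m * (10 * L\<^sup>2)"
    using Seq.IH(1)[of pre "compile (length pre + len c) d @ post" t' M''] Seq.prems by auto
  with t'(2) show ?case by (intro exI[of _ t'']) (auto simp: algebra_simps)
next
  case (CondT r M u v c n M' d)
  let ?p = "length pre"
  let ?pre = "pre @ Branch r u v (?p + len d + 2) # compile (?p + 1) d @ [jump (?p + len c + len d + 2)]"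
  have "\<exists>t'. run P (length ?pre, M) t' M'' \<and> t' \<le> t + n * (10 * L\<^sup>2)"
    using CondT.prems by (intro CondT.IH[of ?pre post]) (auto simp: ac_simps)
  then obtain t' where t': "run P (length ?pre, M) t' M''" "t' \<le> t + n * (10 * L\<^sup>2)" by blast
  have "\<exists>t''. run P (?p, M) t'' M'' \<and> t'' \<le> t' + 10 * L\<^sup>2"
    using CondT.prems CondT.hyps t'(1)
    by (intro run_instr[where i = "Branch r u v (?p + len d + 2)"] instr_cost_Branch_le)
       (auto simp: ac_simps)
  with t'(2) show ?case by (fastforce simp: algebra_simps)
next
  case (CondF r M u v d n M' c)
  let ?p = "length pre"
  let ?e = "?p + len c + len d + 2"
  let ?pre = "pre @ [Branch r u v (?p + len d + 2)]"
  have M': "\<forall>i. M' i < 2 ^ L"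
    using exec_bounded[OF CondF.hyps(2)] CondF.prems by simp
  have "\<exists>t'. run P (?p + 1 + len d, M') t' M'' \<and> t' \<le> t + 10 * L\<^sup>2"
    using CondF.prems M'
    by (intro run_instr[where i = "jump ?e" and pre = "pre @ Branch r u v (?p + len d + 2) # compile (?p + 1) d"]
        instr_cost_Branch_le) (auto simp: ac_simps)
  then obtain t' where t': "run P (?p + 1 + len d, M') t' M''" "t' \<le> t + 10 * L\<^sup>2" by blast
  have "\<exists>t''. run P (length ?pre, M) t'' M'' \<and> t'' \<le> t' + n * (10 * L\<^sup>2)"
    using CondF.prems t'
    by (intro CondF.IH[of ?pre "jump ?e # compile (?p + len d + 2) c @ post"]) (auto simp: ac_simps)
  then obtain t'' where t'': "run P (length ?pre, M) t'' M''" "t'' \<le> t' + n * (10 * L\<^sup>2)" by blast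
  have "\<exists>t1. run P (?p, M) t1 M'' \<and> t1 \<le> t'' + 10 * L\<^sup>2"
    using CondF.prems CondF.hyps t''(1)
    by (intro run_instr[where i = "Branch r u v (?p + len d + 2)"] instr_cost_Branch_le) auto
  with t'(2) t''(2) show ?case by (fastforce simp: algebra_simps)
next
  case (WhileF r M u v c)
  let ?p = "length pre"
  have "\<exists>t'. run P (?p + 1, M) t' M'' \<and> t' \<le> t + 10 * L\<^sup>2"
    using WhileF.prems
    by (intro run_instr[where i = "jump (?p + len c + 3)" and pre = "pre @ [Branch r u v (?p + 2)]"]
        instr_cost_Branch_le) (auto simp: ac_simps)
  then obtain t' where t': "run P (?p + 1, M) t' M''" "t' \<le> t + 10 * L\<^sup>2" by blast
  have "\<exists>t''. run P (?p, M) t'' M'' \<and> t'' \<le> t' + 10 * L\<^sup>2"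
    using WhileF.prems WhileF.hyps t'(1)
    by (intro run_instr[where i = "Branch r u v (?p + 2)"] instr_cost_Branch_le) auto
  with t'(2) show ?case by fastforce
next
  case (WhileT r M u v c m M' n Ma)
  let ?p = "length pre"
  let ?pre = "pre @ [Branch r u v (?p + 2), jump (?p + len c + 3)]"
  have M': "\<forall>i. M' i < 2 ^ L"
    using exec_bounded[OF WhileT.hyps(2)] WhileT.prems by simp
  obtain t1 where t1: "run P (?p, M') t1 M''" "t1 \<le> t + n * (10 * L\<^sup>2)"
    using WhileT.IH(2)[OF _ _ _ WhileT.prems(4,5)] WhileT.prems M' by auto
  have "\<exists>t'. run P (?p + 2 + len c, M') t' M'' \<and> t' \<le> t1 + 10 * L\<^sup>2"
    using WhileT.prems M' t1(1)
    by (intro run_instr[where i = "jump ?p" and post = post and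
          pre = "pre @ Branch r u v (?p + 2) # jump (?p + len c + 3) # compile (?p + 2) c"]
        instr_cost_Branch_le) (auto simp: ac_simps)
  then obtain t2 where t2: "run P (?p + 2 + len c, M') t2 M''" "t2 \<le> t1 + 10 * L\<^sup>2" by blast
  have "\<exists>t'. run P (length ?pre, M) t' M'' \<and> t' \<le> t2 + m * (10 * L\<^sup>2)"
    using WhileT.prems t2
    by (intro WhileT.IH(1)[of ?pre "jump ?p # post"]) (auto simp: ac_simps)
  then obtain t3 where t3: "run P (length ?pre, M) t3 M''" "t3 \<le> t2 + m * (10 * L\<^sup>2)" by blast
  have "\<exists>t'. run P (?p, M) t' M'' \<and> t' \<le> t3 + 10 * L\<^sup>2"
    using WhileT.prems WhileT.hyps t3(1)
    by (intro run_instr[where i = "Branch r u v (?p + 2)"] instr_cost_Branch_le) auto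
  with t1(2) t2(2) t3(2) show ?case by (fastforce simp: algebra_simps)
qed

section \<open>Weakest preconditions with a step counter\<close>

definition wp :: "nat \<Rightarrow> com \<Rightarrow> (memory \<Rightarrow> nat \<Rightarrow> bool) \<Rightarrow> memory \<Rightarrow> nat \<Rightarrow> bool" where
  "wp B c Q M t \<longleftrightarrow> (\<exists>M' n. exec B c M n M' \<and> Q M' (t + n))"

text \<open>With this and the two rules after it, the simplifier runs loop-free code symbolically,
  memory and counter together, and leaves only the bounds on sums and products to prove.\<close>

lemma wp_Asg [simp]:
  "wp B (Asg r f u v) Q M t \<longleftrightarrow> result_ok B f (val M u) (val M v) \<and>
     Q (M(r := arith_op f (val M u) (val M v))) (Suc t)"
proof
  assume "wp B (Asg r f u v) Q M t"
  then obtain M' n where "exec B (Asg r f u v) M n M'" "Q M' (t + n)" by (auto simp: wp_def)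
  then show "result_ok B f (val M u) (val M v) \<and>
     Q (M(r := arith_op f (val M u) (val M v))) (Suc t)"
    by (auto elim: exec.cases)
next
  assume r: "result_ok B f (val M u) (val M v) \<and>
     Q (M(r := arith_op f (val M u) (val M v))) (Suc t)"
  then show "wp B (Asg r f u v) Q M t"
    using exec.Asg[of B f M u v r]
    unfolding wp_def by (metis One_nat_def add_Suc_right add.right_neutral)
qed

lemma wp_Seq [simp]: "wp B (Seq c d) Q M t \<longleftrightarrow> wp B c (wp B d Q) M t"
proof
  assume "wp B (Seq c d) Q M t"
  then obtain M' n where "exec B (Seq c d) M n M'" "Q M' (t + n)" by (auto simp: wp_def)
  then show "wp B c (wp B d Q) M t"
    by (auto elim!: exec.cases[of _ "Seq c d"] simp: wp_def add.assoc)
next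
  assume "wp B c (wp B d Q) M t"
  then show "wp B (Seq c d) Q M t"
    unfolding wp_def by (metis exec.Seq add.assoc)
qed

lemma wp_Cond [simp]:
  "wp B (Cond r u v c d) Q M t \<longleftrightarrow>
     (if test_op r (val M u) (val M v) then wp B c Q M (t + 2) else wp B d Q M (t + 2))"
proof
  assume "wp B (Cond r u v c d) Q M t"
  then obtain M' n where *: "exec B (Cond r u v c d) M n M'" "Q M' (t + n)" by (auto simp: wp_def)
  from *(1) show "if test_op r (val M u) (val M v) then wp B c Q M (t + 2) else wp B d Q M (t + 2)"
  proof cases
    case (CondT n')
    with *(2) show ?thesis unfolding wp_def by (auto simp: ac_simps)
  next
    case (CondF n')
    with *(2) show ?thesis unfolding wp_def by (auto simp: ac_simps)
  qed
next
  assume *: "if test_op r (val M u) (val M v) then wp B c Q M (t + 2) else wp B d Q M (t + 2)"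
  show "wp B (Cond r u v c d) Q M t"
  proof (cases "test_op r (val M u) (val M v)")
    case True
    with * obtain M' n where "exec B c M n M'" "Q M' (t + 2 + n)" by (auto simp: wp_def)
    moreover from this(1) have "exec B (Cond r u v c d) M (n + 2) M'"
      using True by (intro exec.CondT)
    ultimately show ?thesis unfolding wp_def by (metis add.assoc add.commute)
  next
    case False
    with * obtain M' n where "exec B d M n M'" "Q M' (t + 2 + n)" by (auto simp: wp_def)
    moreover from this(1) have "exec B (Cond r u v c d) M (n + 2) M'"
      using False by (intro exec.CondF)
    ultimately show ?thesis unfolding wp_def by (metis add.assoc add.commute)
  qed
qed

text \<open>The natural number \<open>k\<close> in the invariant bounds the number of remaining iterations.\<close>

lemma wp_While:
  fixes k :: nat
  assumes "I k M t"
    and step: "\<And>k M t. I k M t \<Longrightarrow> test_op r (val M u) (val M v) \<Longrightarrow>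
       0 < k \<and> wp B c (I (k - 1)) M (t + 2)"
    and exit: "\<And>k M t. I k M t \<Longrightarrow> \<not> test_op r (val M u) (val M v) \<Longrightarrow> Q M (t + 2)"
  shows "wp B (While r u v c) Q M t"
  using assms(1)
proof (induction k arbitrary: M t)
  case 0
  then have "\<not> test_op r (val M u) (val M v)" using step by blast
  with exit[OF 0] show ?case unfolding wp_def by (blast intro: exec.WhileF)
next
  case (Suc k)
  show ?case
  proof (cases "test_op r (val M u) (val M v)")
    case True
    with step[OF Suc.prems] obtain M' n where n: "exec B c M n M'" "I k M' (t + 2 + n)"
      by (auto simp: wp_def)
    from Suc.IH[OF n(2)] obtain M'' n' where
      n': "exec B (While r u v c) M' n' M''" "Q M'' (t + 2 + n + n')" by (auto simp: wp_def)
    have "exec B (While r u v c) M (n + 2 + n') M''"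
      using exec.WhileT True n(1) n'(1) by blast
    moreover have "Q M'' (t + (n + 2 + n'))" using n'(2) by (simp add: ac_simps)
    ultimately show ?thesis unfolding wp_def by blast
  next
    case False
    with exit[OF Suc.prems] show ?thesis unfolding wp_def by (blast intro: exec.WhileF)
  qed
qed

lemma computes_in_time_compile:
  assumes "wp (2 ^ L) c (\<lambda>M' n. M' 0 = r \<and> n \<le> N) (initial_memory ns) 0"
    and "com_below (2 ^ L) c" "\<forall>n\<in>set ns. n < 2 ^ L" "1 \<le> L"
  shows "\<exists>t. computes_in_time (compile 0 c) ns r t \<and> t \<le> N * (10 * L\<^sup>2)"
proof -
  from assms(1) obtain M' n where *: "exec (2 ^ L) c (initial_memory ns) n M'" "M' 0 = r" "n \<le> N"
    by (auto simp: wp_def)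
  have "\<forall>i. initial_memory ns i < 2 ^ L"
    using assms(3) by (auto simp: initial_memory_def)
  then obtain t where "run (compile 0 c) (0, initial_memory ns) t M'" "t \<le> n * (10 * L\<^sup>2)"
    using run_compile[OF *(1) assms(2) _ assms(4), of "compile 0 c" "[]" "[]" 0 M']
      run.halt[of "compile 0 c" "len c" M']
    by auto
  moreover have "n * (10 * L\<^sup>2) \<le> N * (10 * L\<^sup>2)"
    using *(3) by (rule mult_le_mono1)
  ultimately show ?thesis
    using *(2) unfolding computes_in_time_def by (blast intro: order.trans)
qed

subsection \<open>Prime powers modulo two\<close>

text \<open>The points moved by \<open>h\<close> fall into orbits \<open>{x, h x}\<close> of size
  two, the classes of \<open>R\<close>.\<close>

lemma odd_card_involution:
  assumes fin: "finite X"
    and h: "\<And>x. x \<in> X \<Longrightarrow> h x \<in> X" "\<And>x. x \<in> X \<Longrightarrow> h (h x) = x"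
  shows "odd (card X) \<longleftrightarrow> odd (card {x \<in> X. h x = x})"
proof -
  define Y where "Y = {x \<in> X. h x \<noteq> x}"
  have ev: "even (card Y)"
  proof -
    define R where "R = {(x,y). x \<in> Y \<and> y \<in> Y \<and> (x = y \<or> h x = y)}"
    have hY: "h x \<in> Y" "h (h x) = x" "h x \<noteq> x" if "x \<in> Y" for x
      using that h by (auto simp: Y_def)
    have R: "equiv Y R"
      unfolding equiv_def R_def using hY(2) by (auto simp: refl_on_def sym_def trans_def)
    have "2 dvd card (\<Union> (Y // R))"
    proof (rule dvd_partition)
      show "finite (\<Union> (Y // R))" unfolding Union_quotient[OF R] using fin by (simp add: Y_def)
      show "\<forall>c\<in>Y // R. 2 dvd card c"
      proof
        fix c assume "c \<in> Y // R"
        then obtain x where x: "x \<in> Y" "c = R `` {x}" by (rule quotientE)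
        then have "c = {x, h x}" using hY by (auto simp: R_def)
        then show "2 dvd card c" using hY(3)[OF x(1)] by simp
      qed
      show "\<forall>c1\<in>Y // R. \<forall>c2\<in>Y // R. c1 \<noteq> c2 \<longrightarrow> c1 \<inter> c2 = {}"
        using quotient_disj[OF R] by blast
    qed
    then show ?thesis unfolding Union_quotient[OF R] .
  qed
  have "card X = card {x \<in> X. h x = x} + card Y"
    unfolding Y_def using fin by (subst card_Un_disjoint[symmetric]) (auto intro: arg_cong[of _ _ card])
  with ev show ?thesis by simp
qed

text \<open>Fix a prime \<open>p\<close> dividing \<open>n\<close>. Removing \<open>p\<close> from a
  divisor or adding it is an involution without fixed points.\<close>

lemma even_card_squarefree_divisors:
  fixes n :: nat
  assumes "n > 1"
  shows "even (card {d. d dvd n \<and> squarefree d})"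
proof -
  obtain p where p: "prime p" "p dvd n" using prime_factor_nat[of n] assms by auto
  define h where "h d = (if p dvd d then d div p else d * p)" for d :: nat
  let ?X = "{d. d dvd n \<and> squarefree d}"
  have pp: "p > 1" using p(1) by (rule prime_gt_1_nat)
  have sq: "\<not> p dvd d div p" if "squarefree d" "p dvd d" for d
  proof
    assume "p dvd d div p"
    with that(2) have "p\<^sup>2 dvd d" by (metis dvd_div_iff_mult dvd_mult_div_cancel mult_dvd_mono power2_eq_square dvd_refl)
    with that(1) have "p dvd 1" by (rule squarefreeD)
    with pp show False by simp
  qed
  have "h d \<in> ?X" if d: "d \<in> ?X" for d
  proof (cases "p dvd d")
    case True
    then have "d div p dvd d" by (auto elim: dvdE)
    then show ?thesis using d True unfolding h_def by (auto intro: dvd_trans squarefree_mono)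
  next
    case False
    then have "coprime d p" using p(1) by (metis prime_imp_coprime coprime_commute)
    then show ?thesis using d False p unfolding h_def
      by (auto intro: divides_mult squarefree_mult_coprime squarefree_prime)
  qed
  moreover have "h (h d) = d" if d: "d \<in> ?X" for d
    using sq[of d] d pp by (auto simp: h_def)
  moreover have "h d \<noteq> d" if "d \<in> ?X" for d
  proof -
    have "d > 0" using that by (auto intro!: Nat.gr0I)
    then show ?thesis using pp by (auto simp: h_def)
  qed
  moreover have "finite ?X" using assms by (auto intro: finite_subset[of _ "{d. d dvd n}"])
  ultimately show ?thesis using odd_card_involution[of ?X h] by (metis (mono_tags, lifting) Collect_empty_eq card.empty even_zero mem_Collect_eq)
qed

text \<open>This is Moebius inversion modulo two: the pairs \<open>(f, g)\<close> stand for the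
  squarefree indicator of \<open>f * g\<^sup>2\<close>, and summing it over the divisors of
  \<open>e\<close> must leave only \<open>e = 1\<close>. Swapping \<open>f\<close> and
  \<open>d\<close> leaves the triples in which \<open>f * g\<close> is the root of \<open>e\<close>,
  and these correspond to the squarefree divisors of that root.\<close>

lemma odd_card_squarefree_square_triples:
  fixes e :: nat
  assumes "e > 0"
  shows "odd (card {(f, g, d). f * g\<^sup>2 * d = e \<and> squarefree g}) \<longleftrightarrow> e = 1" (is "odd (card ?X) \<longleftrightarrow> _")
proof -
  define h where "h = (\<lambda>(f, g, d). (d, g, f) :: nat \<times> nat \<times> nat)"
  have le: "f \<le> e \<and> g \<le> e \<and> d \<le> e" if "f * g\<^sup>2 * d = e" for f g d
  proof -
    have "f dvd e" "d dvd e" "g dvd e" using that by (auto simp: power2_eq_square)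
    with assms show ?thesis by (auto intro: dvd_imp_le)
  qed
  have fin: "finite ?X"
    by (rule finite_subset[of _ "{..e} \<times> {..e} \<times> {..e}"]) (use le in auto)
  have "odd (card ?X) \<longleftrightarrow> odd (card {x \<in> ?X. h x = x})"
    by (rule odd_card_involution[OF fin]) (auto simp: h_def ac_simps)
  also have "{x \<in> ?X. h x = x} = {(f, g, d). (f * g)\<^sup>2 = e \<and> squarefree g \<and> d = f}"
    by (auto simp: h_def power2_eq_square ac_simps)
  also have "odd (card \<dots>) \<longleftrightarrow> e = 1"
  proof (cases "\<exists>m. e = m\<^sup>2")
    case False
    then have "{(f, g, d). (f * g)\<^sup>2 = e \<and> squarefree g \<and> d = f} = {}" by auto
    moreover have "e \<noteq> 1" using False by (metis power_one)
    ultimately show ?thesis by (metis card.empty even_zero)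
  next
    case True
    then obtain m where m: "e = m\<^sup>2" by blast
    with assms have m0: "m > 0" by (auto intro!: Nat.gr0I)
    have "bij_betw (\<lambda>g. (m div g, g, m div g)) {g. g dvd m \<and> squarefree g}
        {(f, g, d). (f * g)\<^sup>2 = e \<and> squarefree g \<and> d = f}"
    proof (rule bij_betwI[where g = "\<lambda>(f, g, d). g"])
      show "(\<lambda>(f, g, d). g) \<in> {(f, g, d). (f * g)\<^sup>2 = e \<and> squarefree g \<and> d = f} \<rightarrow> {g. g dvd m \<and> squarefree g}"
        using m by (auto simp: power2_eq_iff_nonneg)
      show "(m div (case y of (f, g, d) \<Rightarrow> g), case y of (f, g, d) \<Rightarrow> g, m div (case y of (f, g, d) \<Rightarrow> g)) = y"
        if "y \<in> {(f, g, d). (f * g)\<^sup>2 = e \<and> squarefree g \<and> d = f}" for y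
        using that m m0 by (auto simp: power2_eq_iff_nonneg)
    qed (use m in auto)
    then have "card {(f, g, d). (f * g)\<^sup>2 = e \<and> squarefree g \<and> d = f} = card {g. g dvd m \<and> squarefree g}"
      by (simp add: bij_betw_same_card)
    moreover have "odd (card {g. g dvd m \<and> squarefree g}) \<longleftrightarrow> m = 1"
    proof (cases "m = 1")
      case True
      then have "{g. g dvd m \<and> squarefree g} = {1}" by auto
      with True show ?thesis by simp
    next
      case False
      with m0 even_card_squarefree_divisors[of m] show ?thesis by simp
    qed
    ultimately show ?thesis using m by (metis power_one power2_eq_1_iff nat_int int_one_le_iff_zero_less power2_eq_iff_nonneg zero_le)
  qed
  finally show ?thesis .
qed

text \<open>The full power \<open>q\<close> of one prime lies in exactly one of the two factors, so
  a factorization is fixed by the part \<open>s\<close> of \<open>m = n div q\<close> that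
  accompanies \<open>q\<close>; \<open>\<phi>\<close> sorts the two factors. The map from
  \<open>s\<close> to \<open>m div s\<close> then fixes nothing unless \<open>m = 1\<close>, because
  a fixed \<open>s\<close> is coprime to itself.\<close>

lemma odd_card_coprime_factorizations:
  fixes n :: nat
  assumes "n > 0"
  shows "odd (card {(u, v). u < v \<and> u * v = n \<and> coprime u v}) \<longleftrightarrow> primepow n"
    (is "odd (card ?X) \<longleftrightarrow> _")
proof (cases "n = 1")
  case True
  then have "?X = {}" by auto
  with True show ?thesis by (metis card.empty even_zero one_not_primepow)
next
  case False
  with assms obtain p where p: "prime p" "p dvd n" using prime_factor_nat[of n] by auto
  define q where "q = p ^ multiplicity p n"
  define m where "m = n div q"
  have n: "n = q * m" unfolding q_def m_def by (simp add: multiplicity_dvd)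
  have mp: "\<not> p dvd m"
    unfolding m_def q_def using assms p by (intro multiplicity_decompose) auto
  have m0: "m > 0" using n assms by (auto intro!: Nat.gr0I)
  have k0: "multiplicity p n > 0" using p assms by (simp add: prime_multiplicity_gt_zero_iff)
  have q0: "q > 0" and pq: "p dvd q" using p(1) k0 by (auto simp: q_def prime_gt_0_nat)
  let ?Y = "{s. s dvd m \<and> coprime s (m div s)}"
  have qs: "coprime q s" if "s dvd m" for s
    using mp that p(1) dvd_trans[of p s m]
    unfolding q_def by (auto simp: coprime_power_left_iff intro!: prime_imp_coprime)
  define \<phi> where "\<phi> s = (min (q * s) (m div s), max (q * s) (m div s))" for s
  have "bij_betw \<phi> ?Y ?X"
  proof (rule bij_betw_imageI)
    have key: "s = t" if "s dvd m" "t dvd m" "q * s = m div t" for s t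
    proof -
      have "p dvd m div t" using that(3) pq by (metis dvd_mult2)
      with that(2) mp show ?thesis by (metis dvd_div_mult_self dvd_mult2)
    qed
    show "inj_on \<phi> ?Y"
    proof (rule inj_onI)
      fix s t assume s: "s \<in> ?Y" and t: "t \<in> ?Y" and eq: "\<phi> s = \<phi> t"
      have "q * s = q * t \<or> q * s = m div t"
        using eq unfolding \<phi>_def by (auto simp: min_def max_def split: if_splits)
      with key[of s t] s t q0 show "s = t" by auto
    qed
    show "\<phi> ` ?Y = ?X"
    proof (intro equalityI subsetI)
      fix x assume "x \<in> \<phi> ` ?Y"
      then obtain s where s: "s dvd m" "coprime s (m div s)" "x = \<phi> s" by auto
      have ne: "q * s \<noteq> m div s"
      proof
        assume *: "q * s = m div s"
        then have "p dvd m" using s(1) pq by (metis dvd_div_mult_self dvd_mult2)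
        with mp show False by simp
      qed
      have "q * s * (m div s) = n" using s(1) n by simp
      moreover have "coprime (q * s) (m div s)"
      proof -
        have "m div s dvd m" using s(1) by (metis dvd_div_mult_self dvd_triv_left)
        with qs s(2) show ?thesis by simp
      qed
      ultimately show "x \<in> ?X" using ne s(3)
        by (auto simp: \<phi>_def min_def max_def coprime_commute mult.commute)
    next
      fix x assume "x \<in> ?X"
      then obtain u v where x: "x = (u, v)" "u < v" "u * v = n" "coprime u v" by auto
      have main: "\<exists>s\<in>?Y. a = q * s \<and> b = m div s" if ab: "a * b = n" "coprime a b" "p dvd a" for a b
      proof -
        have "\<not> p dvd b" using ab(2,3) p(1) by (metis coprime_common_divisor not_prime_unit)
        then have "coprime q b" unfolding q_def using p(1) by (auto simp: coprime_power_left_iff intro!: prime_imp_coprime)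
        moreover have "q dvd a * b" using ab(1) n by simp
        ultimately have "q dvd a" by (simp add: coprime_dvd_mult_left_iff)
        then obtain s where s: "a = q * s" by auto
        with ab(1) n q0 have sb: "s * b = m" by (metis mult.assoc mult_left_cancel less_not_refl)
        have "s > 0" using sb m0 by (auto intro!: Nat.gr0I)
        with sb have "b = m div s" "s dvd m" by auto
        moreover have "coprime s b" using ab(2) s by simp
        ultimately show ?thesis using s by auto
      qed
      have "p dvd u * v" using x(3) p(2) by simp
      then consider "p dvd u" | "p dvd v" using p(1) by (auto simp: prime_dvd_mult_iff)
      then show "x \<in> \<phi> ` ?Y"
      proof cases
        case 1
        then obtain s where "s \<in> ?Y" "u = q * s" "v = m div s" using main[of u v] x by auto
        moreover from this have "x = \<phi> s" using x(1,2) by (auto simp: \<phi>_def min_def max_def)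
        ultimately show ?thesis by blast
      next
        case 2
        then obtain s where "s \<in> ?Y" "v = q * s" "u = m div s"
          using main[of v u] x by (auto simp: mult.commute coprime_commute)
        moreover from this have "x = \<phi> s" using x(1,2) by (auto simp: \<phi>_def min_def max_def)
        ultimately show ?thesis by blast
      qed
    qed
  qed
  then have "card ?X = card ?Y" by (simp add: bij_betw_same_card)
  also have "odd (card ?Y) \<longleftrightarrow> m = 1"
  proof -
    have fin: "finite ?Y" using m0 by (auto intro: finite_subset[of _ "{d. d dvd m}"])
    have "odd (card ?Y) \<longleftrightarrow> odd (card {s \<in> ?Y. m div s = s})"
    proof (rule odd_card_involution[OF fin])
      fix s assume s: "s \<in> ?Y"
      then obtain k where "m = s * k" by auto
      with m0 s show "m div s \<in> ?Y" "m div (m div s) = s" by (auto simp: coprime_commute)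
    qed
    also have "{s \<in> ?Y. m div s = s} = (if m = 1 then {1} else {})"
    proof -
      have "s = 1 \<and> m = 1" if "s dvd m" "coprime s (m div s)" "m div s = s" for s
        using that by (metis coprime_self dvd_div_mult_self is_unit_mult_iff nat_dvd_1_iff_1)
      then show ?thesis by auto
    qed
    finally show ?thesis by simp
  qed
  also have "m = 1 \<longleftrightarrow> primepow n"
  proof
    assume "m = 1"
    then have "n = p ^ multiplicity p n" using n by (simp add: q_def)
    then show "primepow n" using p(1) k0 by (metis primepow_prime_power)
  next
    assume "primepow n"
    then obtain r k where r: "prime r" "k > 0" "n = r ^ k" by (auto simp: primepow_def)
    with p have "p = r" by (metis prime_dvd_power primes_dvd_imp_eq)
    with r p(1) have "n = q" by (simp add: q_def)
    with n q0 show "m = 1" by simp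
  qed
  finally show ?thesis .
qed

lemma card_sum_fibres:
  assumes "finite A" "finite S" "\<And>x. x \<in> A \<Longrightarrow> h x \<in> S"
  shows "card A = (\<Sum>n\<in>S. card {x \<in> A. h x = n})"
proof -
  have "A = (\<Union>n\<in>S. {x \<in> A. h x = n})" using assms(3) by auto
  then have "card A = card (\<Union>n\<in>S. {x \<in> A. h x = n})" by simp
  also have "\<dots> = (\<Sum>n\<in>S. card {x \<in> A. h x = n})"
    using assms by (intro card_UN_disjoint) auto
  finally show ?thesis .
qed

text \<open>Fibres of even size drop out, so parities known for each single value of
  \<open>h\<close> give the parity over a whole range of values.\<close>

lemma odd_card_fibres:
  assumes "finite A" "finite S" "\<And>x. x \<in> A \<Longrightarrow> h x \<in> S"
    and "\<And>n. n \<in> S \<Longrightarrow> odd (card {x \<in> A. h x = n}) \<longleftrightarrow> P n"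
  shows "odd (card A) \<longleftrightarrow> odd (card {n \<in> S. P n})"
proof -
  have "{n \<in> S. odd (card {x \<in> A. h x = n})} = {n \<in> S. P n}" using assms(4) by auto
  then show ?thesis
    using card_sum_fibres[OF assms(1-3)] even_sum_iff[OF assms(2), of "\<lambda>n. card {x \<in> A. h x = n}"]
    by simp
qed

text \<open>Group the quadruples by the reduced pair \<open>(u div gcd u v, v div gcd u v)\<close>.
  If \<open>n\<close> is \<open>e\<^sup>2\<close> times the product of that pair, the fibre
  corresponds to the triples with \<open>f * g\<^sup>2 * d = e\<close>, where \<open>d\<close> is
  the gcd, and is odd only for \<open>e = 1\<close>. What survives are the coprime factorizations of
  \<open>n\<close> itself.\<close>

lemma odd_card_quadruples:
  fixes n :: nat
  assumes "n > 0"
  shows "odd (card {(f, g, u, v). squarefree g \<and> u < v \<and> f\<^sup>2 * g ^ 4 * (u * v) = n}) \<longleftrightarrow> primepow n"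
    (is "odd (card ?A) \<longleftrightarrow> _")
proof -
  define X where "X = {(u, v). u < v \<and> coprime u v \<and> u * v dvd n}"
  define h where "h = (\<lambda>(f::nat, g::nat, u::nat, v::nat). (u div gcd u v, v div gcd u v))"
  have le: "f \<le> n \<and> g \<le> n \<and> u \<le> n \<and> v \<le> n" if "f\<^sup>2 * g ^ 4 * (u * v) = n" for f g u v
  proof -
    have "f dvd n" "g dvd n" "u dvd n" "v dvd n"
      using that by (auto simp: power2_eq_square eval_nat_numeral)
    with assms show ?thesis by (auto intro: dvd_imp_le)
  qed
  have finA: "finite ?A"
    by (rule finite_subset[of _ "{..n} \<times> {..n} \<times> {..n} \<times> {..n}"]) (use le in auto)
  have leX: "u \<le> n \<and> v \<le> n" if "u * v dvd n" for u v
    using that assms by (meson dvd_imp_le dvd_mult_left dvd_mult_right)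
  have finX: "finite X"
    by (rule finite_subset[of _ "{..n} \<times> {..n}"]) (use leX in \<open>auto simp: X_def\<close>)
  have hX: "h x \<in> X" if xA: "x \<in> ?A" for x
  proof -
    obtain f g u v where x: "x = (f, g, u, v)" "u < v" "f\<^sup>2 * g ^ 4 * (u * v) = n" using xA by auto
    let ?d = "gcd u v"
    have d0: "?d > 0" using x(2) by (auto intro!: Nat.gr0I)
    have "u div ?d < v div ?d" using x(2) d0
      by (metis dvd_div_mult_self gcd_dvd1 gcd_dvd2 mult_less_cancel2)
    moreover have "coprime (u div ?d) (v div ?d)" using d0 x(2) by (intro div_gcd_coprime) auto
    moreover have "(u div ?d) * (v div ?d) dvd u * v"
      by (metis dvd_triv_left dvd_div_mult_self gcd_dvd1 gcd_dvd2 mult_dvd_mono)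
    ultimately show ?thesis using x by (auto simp: X_def h_def intro: dvd_trans)
  qed
  have "odd (card ?A) \<longleftrightarrow> odd (card {x \<in> X. case x of (u, v) \<Rightarrow> u * v = n})"
  proof (rule odd_card_fibres[OF finA finX hX])
    fix x assume "x \<in> X"
    then obtain u v where uv: "x = (u, v)" "u < v" "coprime u v" "u * v dvd n"
      by (auto simp: X_def)
    define T where "T = {(f, g, d). squarefree g \<and> (f * g\<^sup>2 * d)\<^sup>2 * (u * v) = n}"
    have "bij_betw (\<lambda>(f, g, d). (f, g, d * u, d * v)) T {y \<in> ?A. h y = x}"
    proof (rule bij_betwI[where g = "\<lambda>(f, g, u', v'). (f, g, gcd u' v')"])
      have g: "gcd (d * u) (d * v) = d" for d
        using uv(3) by (simp add: gcd_mult_distrib_nat[symmetric])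
      show "(\<lambda>(f, g, d). (f, g, d * u, d * v)) \<in> T \<rightarrow> {y \<in> ?A. h y = x}"
      proof
        fix z assume "z \<in> T"
        then obtain f gg d where z: "z = (f, gg, d)" "squarefree gg" "(f * gg\<^sup>2 * d)\<^sup>2 * (u * v) = n"
          by (auto simp: T_def)
        have "d > 0" using z(3) assms by (auto intro!: Nat.gr0I)
        moreover have "f\<^sup>2 * gg ^ 4 * (d * u * (d * v)) = n"
          using z(3) by (simp add: power2_eq_square eval_nat_numeral ac_simps)
        ultimately show "(case z of (f, g, d) \<Rightarrow> (f, g, d * u, d * v)) \<in> {y \<in> ?A. h y = x}"
          using z uv by (simp add: h_def g)
      qed
      show "(\<lambda>(f, g, u', v'). (f, g, gcd u' v')) \<in> {y \<in> ?A. h y = x} \<rightarrow> T"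
      proof
        fix z assume "z \<in> {y \<in> ?A. h y = x}"
        then obtain f gg u' v' where z: "z = (f, gg, u', v')" "squarefree gg"
          "f\<^sup>2 * gg ^ 4 * (u' * v') = n" "u = u' div gcd u' v'" "v = v' div gcd u' v'"
          using uv(1) by (auto simp: h_def)
        have "u' = gcd u' v' * u" "v' = gcd u' v' * v" using z(4,5) by auto
        then have "u' * v' = (gcd u' v')\<^sup>2 * (u * v)"
          by (metis (no_types, lifting) mult.assoc mult.left_commute power2_eq_square)
        then have "(f * gg\<^sup>2 * gcd u' v')\<^sup>2 * (u * v) = n"
          using z(3) by (simp add: power_mult_distrib power_mult[symmetric] ac_simps)
        then show "(case z of (f, g, u', v') \<Rightarrow> (f, g, gcd u' v')) \<in> T"
          using z(1,2) by (simp add: T_def)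
      qed
      show "(case case z of (f, g, d) \<Rightarrow> (f, g, d * u, d * v) of
            (f, g, u', v') \<Rightarrow> (f, g, gcd u' v')) = z" for z
        using g by (auto split: prod.splits)
      show "(case case z of (f, g, u', v') \<Rightarrow> (f, g, gcd u' v') of
            (f, g, d) \<Rightarrow> (f, g, d * u, d * v)) = z" if "z \<in> {y \<in> ?A. h y = x}" for z
        using that uv(1) by (auto simp: h_def)
    qed
    then have "card {y \<in> ?A. h y = x} = card T" by (simp add: bij_betw_same_card)
    moreover have "odd (card T) \<longleftrightarrow> u * v = n"
    proof (cases "\<exists>e. e\<^sup>2 * (u * v) = n")
      case True
      then obtain e where e: "e\<^sup>2 * (u * v) = n" by blast
      have e0: "e > 0" and uv0: "u * v > 0" using e assms by (auto intro!: Nat.gr0I)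
      have "T = {(f, g, d). f * g\<^sup>2 * d = e \<and> squarefree g}"
        unfolding T_def using uv0 e by (auto simp: power2_eq_iff_nonneg)
      moreover have "e = 1 \<longleftrightarrow> u * v = n"
        using e uv0 by (metis mult_cancel2 nat_mult_1 not_gr0 power2_eq_iff_nonneg power_one zero_le)
      ultimately show ?thesis using odd_card_squarefree_square_triples[OF e0] by simp
    next
      case False
      then have "T = {}" by (auto simp: T_def)
      moreover have "u * v \<noteq> n" using False by (metis nat_mult_1 power_one)
      ultimately show ?thesis by simp
    qed
    ultimately show "odd (card {y \<in> ?A. h y = x}) \<longleftrightarrow> (case x of (u, v) \<Rightarrow> u * v = n)"
      using uv(1) by simp
  qed
  also have "{x \<in> X. case x of (u, v) \<Rightarrow> u * v = n} = {(u, v). u < v \<and> u * v = n \<and> coprime u v}"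
    by (auto simp: X_def)
  finally show ?thesis using odd_card_coprime_factorizations[OF assms] by simp
qed

section \<open>Prime powers up to a bound\<close>

definition triples :: "nat \<Rightarrow> nat" where
  "triples z = card {(f, u, v). 0 < f \<and> 0 < u \<and> u < v \<and> f\<^sup>2 * (u * v) \<le> z}"

lemma finite_triples: "finite {(f, u, v). 0 < f \<and> 0 < u \<and> u < v \<and> f\<^sup>2 * (u * v) \<le> (z::nat)}"
proof (rule finite_subset[of _ "{..z} \<times> {..z} \<times> {..z}"])
  have "f \<le> z \<and> u \<le> z \<and> v \<le> z" if "0 < f" "0 < u" "u < v" "f\<^sup>2 * (u * v) \<le> z" for f u v
  proof -
    have "f dvd f\<^sup>2 * (u * v)" "u dvd f\<^sup>2 * (u * v)" "v dvd f\<^sup>2 * (u * v)" "f\<^sup>2 * (u * v) > 0"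
      using that by (auto simp: power2_eq_square)
    then show ?thesis using that(4) by (meson dvd_imp_le le_trans)
  qed
  then show "{(f, u, v). 0 < f \<and> 0 < u \<and> u < v \<and> f\<^sup>2 * (u * v) \<le> z} \<subseteq> {..z} \<times> {..z} \<times> {..z}"
    by auto
qed simp

lemma squarefree_pos: "squarefree (n::nat) \<Longrightarrow> 0 < n"
  by (auto intro!: Nat.gr0I)

text \<open>For fixed \<open>g\<close> the remaining triples have product at most
  \<open>y div g ^ 4\<close>. Grouped by the value of the whole product, the disjoint union over
  \<open>g\<close> has the quadruples of a single \<open>n\<close> as its fibres.\<close>

lemma odd_sum_triples:
  "odd (\<Sum>g | squarefree g \<and> g ^ 4 \<le> y. triples (y div g ^ 4)) \<longleftrightarrow> odd (card {n. n \<le> y \<and> primepow n})"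
proof -
  let ?G = "{g. squarefree g \<and> g ^ 4 \<le> y}"
  let ?T = "\<lambda>z. {(f, u, v). 0 < f \<and> 0 < u \<and> u < v \<and> f\<^sup>2 * (u * v) \<le> (z::nat)}"
  define h where "h = (\<lambda>(g::nat, f::nat, u::nat, v::nat). f\<^sup>2 * g ^ 4 * (u * v))"
  have finG: "finite ?G"
  proof (rule finite_subset[of _ "{..y}"])
    have "g \<le> y" if "g ^ 4 \<le> y" for g
      using that self_le_power[of g 4] by (cases "g = 0") auto
    then show "?G \<subseteq> {..y}" by auto
  qed simp
  let ?A = "SIGMA g:?G. ?T (y div g ^ 4)"
  have A: "(g, f, u, v) \<in> ?A \<longleftrightarrow> squarefree g \<and> u < v \<and> 0 < f\<^sup>2 * g ^ 4 * (u * v) \<and> f\<^sup>2 * g ^ 4 * (u * v) \<le> y"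
    for g f u v
  proof -
    have "f\<^sup>2 * (u * v) \<le> y div g ^ 4 \<longleftrightarrow> f\<^sup>2 * g ^ 4 * (u * v) \<le> y" if "squarefree g"
      using squarefree_pos[OF that] by (simp add: less_eq_div_iff_mult_less_eq ac_simps)
    moreover have "g ^ 4 \<le> y" if "0 < f" "0 < u" "u < v" "f\<^sup>2 * g ^ 4 * (u * v) \<le> y"
    proof -
      have "g ^ 4 \<le> f\<^sup>2 * g ^ 4 * (u * v)" using that by simp
      then show ?thesis using that(4) by (rule le_trans)
    qed
    ultimately show ?thesis using squarefree_pos[of g]
      by (auto intro: le_trans)
  qed
  have "(\<Sum>g\<in>?G. triples (y div g ^ 4)) = card ?A"
    unfolding triples_def using finG finite_triples by (simp add: card_SigmaI)
  moreover have "odd (card ?A) \<longleftrightarrow> odd (card {n \<in> {1..y}. primepow n})"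
  proof (rule odd_card_fibres[where h = h])
    show "finite ?A" using finG finite_triples by (intro finite_SigmaI) auto
    show "h x \<in> {1..y}" if "x \<in> ?A" for x
    proof -
      obtain g f u v where x: "x = (g, f, u, v)" by (cases x) auto
      show ?thesis using that unfolding x A by (simp add: h_def Suc_le_eq)
    qed
    fix n assume n: "n \<in> {1..y}"
    have eq: "x \<in> {x \<in> ?A. h x = n} \<longleftrightarrow> x \<in> {(g, f, u, v). squarefree g \<and> u < v \<and> f\<^sup>2 * g ^ 4 * (u * v) = n}" for x
    proof -
      obtain g f u v where x: "x = (g, f, u, v)" by (cases x) auto
      show ?thesis unfolding x mem_Collect_eq A using n
        by (cases "f = 0"; cases "g = 0") (auto simp: h_def)
    qed
    have "bij_betw (\<lambda>(g, f, u, v). (f, g, u, v)) {x \<in> ?A. h x = n}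
        {(f, g, u, v). squarefree g \<and> u < v \<and> f\<^sup>2 * g ^ 4 * (u * v) = n}"
      unfolding set_eqI[OF eq]
      by (rule bij_betwI[where g = "\<lambda>(f, g, u, v). (g, f, u, v)"]) auto
    then show "odd (card {x \<in> ?A. h x = n}) \<longleftrightarrow> primepow n"
      using odd_card_quadruples[of n] n by (simp add: bij_betw_same_card)
  qed auto
  moreover have "{n \<in> {1..y}. primepow n} = {n. n \<le> y \<and> primepow n}"
    using primepow_gt_0_nat by (auto simp: Suc_le_eq)
  ultimately show ?thesis by simp
qed

section \<open>From prime powers to primes\<close>

lemma nth_root_nat_ge_iff: "k > 0 \<Longrightarrow> x \<le> nth_root_nat k n \<longleftrightarrow> x ^ k \<le> n"
  by (meson nth_root_nat_ge nth_root_nat_power_le power_mono le_trans zero_le)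

lemma nth_root_nat_le_self: "0 < k \<Longrightarrow> nth_root_nat k n \<le> n"
  using nth_root_nat_power_le[of k n] self_le_power[of "nth_root_nat k n" k]
  by (cases "nth_root_nat k n = 0") linarith+

text \<open>The fibre over \<open>n = p ^ l\<close> consists of the pairs
  \<open>(k, p ^ (l div k))\<close> for the squarefree divisors \<open>k\<close> of
  \<open>l\<close>, an even number unless \<open>l = 1\<close>. Since a prime power is at least 2,
  restricting to \<open>2 ^ k \<le> y\<close> loses nothing.\<close>

lemma odd_sum_primepows:
  "odd (\<Sum>k | squarefree k \<and> 2 ^ k \<le> y. card {r. r \<le> nth_root_nat k y \<and> primepow r}) \<longleftrightarrow>
   odd (card {p. p \<le> y \<and> prime p})"
proof -
  let ?K = "{k. squarefree k \<and> 2 ^ k \<le> y}"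
  let ?R = "\<lambda>k. {r. r \<le> nth_root_nat k y \<and> primepow r}"
  let ?A = "SIGMA k:?K. ?R k"
  have finK: "finite ?K"
  proof (rule finite_subset[of _ "{..y}"])
    show "?K \<subseteq> {..y}" by (auto intro: le_trans[OF less_imp_le[OF less_exp]])
  qed simp
  have finR: "finite (?R k)" for k by (rule finite_subset[of _ "{..nth_root_nat k y}"]) auto
  have A: "(k, r) \<in> ?A \<longleftrightarrow> squarefree k \<and> primepow r \<and> r ^ k \<le> y" for k r
  proof -
    have "2 ^ k \<le> y" if "primepow r" "r ^ k \<le> y"
      using primepow_gt_Suc_0[OF that(1)] that(2) power_mono[of 2 r k] by linarith
    then show ?thesis using squarefree_pos[of k] by (auto simp: nth_root_nat_ge_iff)
  qed
  have "(\<Sum>k\<in>?K. card (?R k)) = card ?A"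
    using finK finR by (simp add: card_SigmaI)
  moreover have "odd (card ?A) \<longleftrightarrow> odd (card {n \<in> {..y}. prime n})"
  proof (rule odd_card_fibres[where h = "\<lambda>(k, r). r ^ k"])
    show "finite ?A" using finK finR by (intro finite_SigmaI) auto
    show "(case x of (k, r) \<Rightarrow> r ^ k) \<in> {..y}" if "x \<in> ?A" for x
    proof -
      obtain k r where x: "x = (k, r)" by (cases x) auto
      show ?thesis using that unfolding x A by simp
    qed
    fix n assume n: "n \<in> {..y}"
    define F where "F = {(k, r). squarefree k \<and> primepow r \<and> r ^ k = n}"
    have "x \<in> {x \<in> ?A. (case x of (k, r) \<Rightarrow> r ^ k) = n} \<longleftrightarrow> x \<in> F" for x
    proof -
      obtain k r where x: "x = (k, r)" by (cases x) auto
      show ?thesis unfolding x mem_Collect_eq A F_def using n by auto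
    qed
    then have eq: "{x \<in> ?A. (case x of (k, r) \<Rightarrow> r ^ k) = n} = F" by blast
    have "odd (card F) \<longleftrightarrow> prime n"
    proof (cases "primepow n")
      case False
      have "primepow (r ^ k)" if "primepow r" "squarefree k" for r k :: nat
        using that primepow_power_iff_nat[of r k] squarefree_pos[of k] primepow_gt_0_nat[of r] by simp
      with False have "F = {}" by (auto simp: F_def)
      with False show ?thesis by auto
    next
      case True
      then obtain p l where p: "prime p" "l > 0" "n = p ^ l" by (auto simp: primepow_def)
      have p1: "p > 1" using p(1) by (rule prime_gt_1_nat)
      have "bij_betw (\<lambda>k. (k, p ^ (l div k))) {k. k dvd l \<and> squarefree k} F"
      proof (rule bij_betwI[where g = fst])
        show "(\<lambda>k. (k, p ^ (l div k))) \<in> {k. k dvd l \<and> squarefree k} \<rightarrow> F"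
        proof
          fix k assume k: "k \<in> {k. k dvd l \<and> squarefree k}"
          then have "l div k > 0" using p(2) by (auto elim!: dvdE intro!: Nat.gr0I)
          then have "primepow (p ^ (l div k))" using p(1) by simp
          with k p(3) show "(k, p ^ (l div k)) \<in> F" by (simp add: F_def power_mult[symmetric])
        qed
        have main: "k dvd l \<and> r = p ^ (l div k)" if kr: "(k, r) \<in> F" for k r
        proof -
          from kr obtain s j where s: "prime s" "j > 0" "r = s ^ j" and k: "squarefree k" "r ^ k = n"
            by (auto simp: F_def primepow_def)
          have k0: "k > 0" using k(1) by (rule squarefree_pos)
          have e: "s ^ (j * k) = p ^ l" using k(2) s(3) p(3) by (simp add: power_mult)
          have "s dvd s ^ (j * k)" using s(2) k0 by simp
          then have "s dvd p ^ l" using e by simp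
          then have "s = p" using s(1) p(1) by (metis prime_dvd_power primes_dvd_imp_eq)
          with e p1 have "j * k = l" by (simp add: power_inject_exp)
          then show ?thesis using s(3) \<open>s = p\<close> k0 by auto
        qed
        show "fst \<in> F \<rightarrow> {k. k dvd l \<and> squarefree k}"
          using main by (auto simp: F_def)
        show "(fst y, p ^ (l div fst y)) = y" if "y \<in> F" for y
          using main[of "fst y" "snd y"] that by (metis prod.collapse)
      qed simp
      then have "card F = card {k. k dvd l \<and> squarefree k}" by (simp add: bij_betw_same_card)
      moreover have "odd (card {k. k dvd l \<and> squarefree k}) \<longleftrightarrow> l = 1"
      proof (cases "l = 1")
        case True
        then have "{k. k dvd l \<and> squarefree k} = {1}" by auto
        with True show ?thesis by simp
      qed (use p(2) even_card_squarefree_divisors[of l] in simp)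
      moreover have "l = 1 \<longleftrightarrow> prime n"
        using p by (auto simp: prime_power_iff)
      ultimately show ?thesis by simp
    qed
    then show "odd (card {x \<in> ?A. (case x of (k, r) \<Rightarrow> r ^ k) = n}) \<longleftrightarrow> prime n"
      unfolding eq .
  qed auto
  moreover have "{n \<in> {..y}. prime n} = {p. p \<le> y \<and> prime p}" by auto
  ultimately show ?thesis by simp
qed

subsection \<open>Floor sums\<close>

definition floor_sum :: "nat \<Rightarrow> nat \<Rightarrow> nat \<Rightarrow> nat \<Rightarrow> nat" where
  "floor_sum n m a b = (\<Sum>i<n. (a * i + b) div m)"

lemma floor_sum_0 [simp]: "floor_sum 0 m a b = 0"
  by (simp add: floor_sum_def)

text \<open>The division step of the Euclidean recursion: whole multiples of \<open>m\<close> in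
  slope and offset contribute an explicit polynomial.\<close>

lemma floor_sum_reduce:
  "floor_sum n m a b =
     (n * (n - 1) div 2) * (a div m) + n * (b div m) + floor_sum n m (a mod m) (b mod m)"
proof (cases "m = 0")
  case False
  have *: "(a * i + b) div m = i * (a div m) + b div m + (a mod m * i + b mod m) div m" for i
  proof -
    define X where "X = a mod m * i + b mod m"
    define Y where "Y = i * (a div m) + b div m"
    have "a * i + b = (a div m * m + a mod m) * i + (b div m * m + b mod m)" by simp
    also have "\<dots> = X + m * Y"
      unfolding X_def Y_def by (simp only: algebra_simps)
    finally have "(a * i + b) div m = (X + m * Y) div m"
      by (rule arg_cong)
    also have "\<dots> = Y + X div m" using False by simp
    finally show ?thesis unfolding X_def Y_def .
  qed
  have "(\<Sum>i<n. i) = n * (n - 1) div 2"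
    using gauss_sum_nat[of "n - 1"] by (cases n) (auto simp: atLeast0AtMost lessThan_Suc_atMost mult.commute)
  then show ?thesis
    unfolding floor_sum_def * by (simp add: sum.distrib sum_distrib_right[symmetric])
qed (simp add: floor_sum_def)

text \<open>Both sides count the lattice points under a line, once by columns and once by rows. A
  half turn of the rectangle makes the rows start at zero, with the remainder of
  \<open>a * n + b\<close> as the new offset; modulus and slope trade places.\<close>

lemma floor_sum_swap:
  assumes "0 < a" "b < m"
  shows "floor_sum n m a b = floor_sum ((a * n + b) div m) a m ((a * n + b) mod m)"
proof -
  define y where "y = a * n + b"
  define N where "N = y div m"
  define r where "r = y mod m"
  have y: "y = m * N + r" by (simp add: N_def r_def)
  have m0: "m > 0" using assms by simp
  have cardlt: "card {j. j < K \<and> d * (j + 1) \<le> q} = q div d" if d: "d > 0" and K: "q div d \<le> K" for K d q :: nat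
  proof -
    have "j < K \<and> d * (j + 1) \<le> q \<longleftrightarrow> j < q div d" for j
    proof -
      have "d * (j + 1) \<le> q \<longleftrightarrow> j + 1 \<le> q div d"
        unfolding less_eq_div_iff_mult_less_eq[OF d] by (simp only: mult.commute)
      with K show ?thesis by linarith
    qed
    then have "{j. j < K \<and> d * (j + 1) \<le> q} = {..<q div d}" by blast
    then show ?thesis by simp
  qed
  let ?A = "SIGMA i:{..<n}. {j. j < N \<and> m * (j + 1) \<le> a * i + b}"
  let ?B = "SIGMA j:{..<N}. {i. i < n \<and> a * (i + 1) \<le> m * j + r}"
  have "floor_sum n m a b = card ?A"
  proof -
    have "(a * i + b) div m \<le> N" if "i < n" for i
      unfolding N_def y_def using that by (intro div_le_mono) simp
    then have "card {j. j < N \<and> m * (j + 1) \<le> a * i + b} = (a * i + b) div m" if "i < n" for i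
      using that m0 by (intro cardlt) auto
    then show ?thesis unfolding floor_sum_def by (subst card_SigmaI) auto
  qed
  also have "card ?A = card ?B"
  proof (rule bij_betw_same_card[OF bij_betwI])
    \<comment> \<open>Reversing both indices turns the inequality around because
      \<open>a * n + b = m * N + r\<close>.\<close>
    have eq: "m * (j + 1) \<le> a * i + b \<longleftrightarrow> a * ((n - 1 - i) + 1) \<le> m * (N - 1 - j) + r"
      if "i < n" "j < N" for i j
    proof -
      have "a * n = a * i + a * ((n - 1 - i) + 1)"
        using that by (simp only: add_mult_distrib2[symmetric]) simp
      moreover have "m * N = m * (j + 1) + m * (N - 1 - j)"
        using that by (simp only: add_mult_distrib2[symmetric]) simp
      ultimately show ?thesis using y y_def by linarith
    qed
    show "(\<lambda>(i, j). (N - 1 - j, n - 1 - i)) \<in> ?A \<rightarrow> ?B"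
      using eq by auto
    show "(\<lambda>(j, i). (n - 1 - i, N - 1 - j)) \<in> ?B \<rightarrow> ?A"
    proof
      fix x assume "x \<in> ?B"
      then obtain j i where x: "x = (j, i)" "j < N" "i < n" "a * (i + 1) \<le> m * j + r" by auto
      have "m * (N - 1 - j + 1) \<le> a * (n - 1 - i) + b"
        using x eq[of "n - 1 - i" "N - 1 - j"] by simp
      with x show "(case x of (j, i) \<Rightarrow> (n - 1 - i, N - 1 - j)) \<in> ?A" by simp
    qed
  qed auto
  also have "card ?B = floor_sum N a m r"
  proof -
    have "(m * j + r) div a \<le> n" if "j < N" for j
    proof -
      have "m * j + m \<le> m * N" using that by (metis Suc_leI mult_le_mono2 mult_Suc_right add.commute)
      then have "m * j + r \<le> a * n" using y assms(2) unfolding y_def by linarith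
      then have "(m * j + r) div a \<le> a * n div a" by (rule div_le_mono)
      then show ?thesis using assms(1) by simp
    qed
    then have "card {i. i < n \<and> a * (i + 1) \<le> m * j + r} = (m * j + r) div a" if "j < N" for j
      using that assms(1) by (intro cardlt) auto
    then show ?thesis unfolding floor_sum_def by (subst card_SigmaI) auto
  qed
  finally show ?thesis by (simp add: N_def r_def y_def)
qed

subsection \<open>Linear approximation of a block of the hyperbola\<close>

text \<open>Multiplied by \<open>e\<^sup>2\<close>, the excess of the floored hyperbola over its
  tangent at \<open>e\<close> is at most \<open>q * i\<^sup>2\<close> with
  \<open>q \<le> w div u\<close> and \<open>i < h\<close>. This is the resulting bound, in
  operations that the machine has.\<close>

definition block_tol :: "nat \<Rightarrow> nat \<Rightarrow> nat \<Rightarrow> nat" where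
  "block_tol w u h = (w div u) * h * h"

text \<open>The tangent touches at the last point of the block and the block is read backwards from
  there, so that slope and offset are both natural numbers.\<close>

abbreviation block_lower :: "nat \<Rightarrow> nat \<Rightarrow> nat \<Rightarrow> nat" where
  "block_lower w u h \<equiv> floor_sum h ((u + h - 1)\<^sup>2) w (w * (u + h - 1))"

abbreviation block_upper :: "nat \<Rightarrow> nat \<Rightarrow> nat \<Rightarrow> nat" where
  "block_upper w u h \<equiv> floor_sum h ((u + h - 1)\<^sup>2) w (w * (u + h - 1) + block_tol w u h)"

text \<open>Convexity of the hyperbola, in the form
  \<open>(e + i) * (e - i) \<le> e\<^sup>2\<close>.\<close>

lemma tangent_le:
  fixes w e i :: nat
  assumes "i < e"
  shows "(w * i + w * e) div e\<^sup>2 \<le> w div (e - i)"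
proof -
  define t where "t = e - i"
  have e: "e = t + i" and t: "t > 0" using assms by (auto simp: t_def)
  define q where "q = (w * i + w * e) div e\<^sup>2"
  have "q * e\<^sup>2 \<le> w * i + w * e" unfolding q_def by (rule div_times_less_eq_dividend)
  then have "q * e\<^sup>2 * t \<le> (w * i + w * e) * t" by (rule mult_le_mono1)
  also have "\<dots> \<le> w * e\<^sup>2" unfolding e by (simp add: power2_eq_square algebra_simps)
  finally have "(q * t) * e\<^sup>2 \<le> w * e\<^sup>2" by (simp add: ac_simps)
  then have "q * t \<le> w" using assms by simp
  then show ?thesis using t unfolding q_def[symmetric] t_def[symmetric] by (simp add: less_eq_div_iff_mult_less_eq)
qed

text \<open>With \<open>t = e - i\<close>, the identity
  \<open>e\<^sup>2 = t * (t + 2 * i) + i\<^sup>2\<close> isolates the excess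
  \<open>q * i\<^sup>2\<close>, which the tolerance covers.\<close>

lemma le_tangent_plus_tol:
  fixes w u h i :: nat
  assumes "i < h" "0 < u" and e: "e = u + h - 1"
  shows "w div (e - i) \<le> (w * i + (w * e + block_tol w u h)) div e\<^sup>2"
proof -
  define t where "t = e - i"
  have et: "e = t + i" and t: "t \<ge> u" using assms by (auto simp: t_def)
  have e0: "e > 0" using et t assms(2) by simp
  define q where "q = w div t"
  have qt: "q * t \<le> w" unfolding q_def by (rule div_times_less_eq_dividend)
  have "q * i\<^sup>2 \<le> (w div u) * h\<^sup>2"
    using assms(1,2) t unfolding q_def by (intro mult_le_mono div_le_mono2 power_mono) auto
  then have "q * i\<^sup>2 \<le> block_tol w u h" by (simp add: block_tol_def power2_eq_square ac_simps)
  moreover have "q * e\<^sup>2 = (q * t) * (t + 2 * i) + q * i\<^sup>2"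
    unfolding et by (simp add: power2_eq_square algebra_simps)
  moreover have "(q * t) * (t + 2 * i) \<le> w * (t + 2 * i)" using qt by (rule mult_le_mono1)
  moreover have "w * (t + 2 * i) = w * i + w * e" unfolding et by (simp add: algebra_simps)
  ultimately have "q * e\<^sup>2 \<le> w * i + (w * e + block_tol w u h)" by linarith
  then show ?thesis using e0 unfolding q_def[symmetric] t_def[symmetric]
    by (simp add: less_eq_div_iff_mult_less_eq)
qed

lemma sum_block_rev:
  fixes u h :: nat
  shows "(\<Sum>t=u..<u + h. f t) = (\<Sum>i<h. f (u + h - 1 - i))"
  by (rule sum.reindex_bij_witness[of _ "\<lambda>i. u + h - 1 - i" "\<lambda>t. u + h - 1 - t"]) auto

lemma block_exact:
  assumes "0 < u" "block_lower w u h = block_upper w u h"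
  shows "(\<Sum>t=u..<u + h. w div t) = block_lower w u h"
proof (rule antisym)
  let ?e = "u + h - 1"
  have "(\<Sum>i<h. w div (?e - i)) \<le> block_upper w u h"
    unfolding floor_sum_def using assms(1) by (intro sum_mono le_tangent_plus_tol) auto
  then show "(\<Sum>t=u..<u + h. w div t) \<le> block_lower w u h"
    unfolding assms(2) by (simp only: sum_block_rev)
  have "block_lower w u h \<le> (\<Sum>i<h. w div (?e - i))"
    unfolding floor_sum_def using assms(1) by (intro sum_mono tangent_le) auto
  then show "block_lower w u h \<le> (\<Sum>t=u..<u + h. w div t)"
    by (simp only: sum_block_rev)
qed

text \<open>Where the two lines disagree, the hyperbola \<open>q t = w\<close> has a lattice point close by.\<close>

lemma block_inexact:
  assumes u: "0 < u" and ne: "block_lower w u h \<noteq> block_upper w u h" and R: "w * h\<^sup>2 \<le> R * u\<^sup>2"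
  shows "\<exists>t\<in>{u..<u + h}. \<exists>q>0. q * t \<le> w + R \<and> w \<le> q * t + R"
proof -
  define e where "e = u + h - 1"
  define K where "K = block_tol w u h"
  obtain i where i: "i < h" and d: "(w * i + w * e) div e\<^sup>2 \<noteq> (w * i + (w * e + K)) div e\<^sup>2"
  proof -
    have "\<exists>i\<in>{..<h}. (w * i + w * e) div e\<^sup>2 \<noteq> (w * i + (w * e + K)) div e\<^sup>2"
    proof (rule ccontr)
      assume "\<not> ?thesis"
      then have "block_lower w u h = block_upper w u h"
        unfolding floor_sum_def e_def[symmetric] K_def[symmetric] by (intro sum.cong) auto
      with ne show False by simp
    qed
    with that show ?thesis by auto
  qed
  define t where "t = e - i"
  have et: "e = t + i" and tu: "t \<ge> u" and t: "t \<in> {u..<u + h}" using i u by (auto simp: t_def e_def)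
  have e0: "e > 0" and eu: "e \<ge> u" using et tu u by auto
  \<comment> \<open>An integer height that the upper line reaches at \<open>i\<close> and the
    tangent does not. The hyperbola passes between the same two lines, so \<open>q * t\<close> must
    be close to \<open>w\<close>.\<close>
  define q where "q = (w * i + (w * e + K)) div e\<^sup>2"
  have "(w * i + w * e) div e\<^sup>2 \<le> q" unfolding q_def by (intro div_le_mono) simp
  with d have "(w * i + w * e) div e\<^sup>2 < q" unfolding q_def by simp
  then have lo: "w * i + w * e < q * e\<^sup>2" using e0 by (simp add: div_less_iff_less_mult)
  have hi: "q * e\<^sup>2 \<le> w * i + (w * e + K)" unfolding q_def by (rule div_times_less_eq_dividend)
  have q0: "q > 0" using lo by (auto intro!: Nat.gr0I)
  \<comment> \<open>\<open>R\<close> is tailored to this: \<open>w div u * h\<^sup>2 * u\<close> is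
    at most \<open>w * h\<^sup>2\<close>.\<close>
  have Ku: "K * u \<le> R * u\<^sup>2"
  proof -
    have "K * u = (w div u * u) * h\<^sup>2" by (simp add: K_def block_tol_def power2_eq_square ac_simps)
    also have "\<dots> \<le> w * h\<^sup>2" by (intro mult_le_mono1 div_times_less_eq_dividend)
    finally show ?thesis using R by simp
  qed
  then have KRu: "K \<le> R * u" using u by (simp add: power2_eq_square)
  have "q * t \<le> w + R"
  proof -
    have "(q * t) * e\<^sup>2 \<le> (w * i + (w * e + K)) * t" using mult_le_mono1[OF hi, of t] by (simp add: ac_simps)
    also have "\<dots> = w * ((t + 2 * i) * t) + K * t" unfolding et by (simp add: algebra_simps)
    also have "\<dots> \<le> w * e\<^sup>2 + R * e\<^sup>2"
    proof (rule add_mono)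
      show "w * ((t + 2 * i) * t) \<le> w * e\<^sup>2" unfolding et
        by (intro mult_le_mono2) (simp add: power2_eq_square algebra_simps)
      have "K * t \<le> (R * e) * e" using le_trans[OF KRu mult_le_mono2[OF eu]] et by (intro mult_le_mono) auto
      then show "K * t \<le> R * e\<^sup>2" by (simp add: power2_eq_square)
    qed
    finally have "(q * t) * e\<^sup>2 \<le> (w + R) * e\<^sup>2" by (simp add: algebra_simps)
    then show ?thesis using e0 by simp
  qed
  moreover have "w \<le> q * t + R"
  proof -
    have "w * e\<^sup>2 = (w * i + w * e) * t + w * i\<^sup>2" unfolding et by (simp add: power2_eq_square algebra_simps)
    also have "\<dots> \<le> (q * e\<^sup>2) * t + R * e\<^sup>2"
    proof (rule add_mono)
      show "(w * i + w * e) * t \<le> (q * e\<^sup>2) * t" using lo by (intro mult_le_mono1) simp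
      have "w * i\<^sup>2 \<le> w * h\<^sup>2" using i by (intro mult_le_mono2 power_mono) auto
      also have "\<dots> \<le> R * u\<^sup>2" by (rule R)
      also have "\<dots> \<le> R * e\<^sup>2" using eu by (intro mult_le_mono2 power_mono) auto
      finally show "w * i\<^sup>2 \<le> R * e\<^sup>2" .
    qed
    finally have "w * e\<^sup>2 \<le> (q * t + R) * e\<^sup>2" by (simp add: algebra_simps)
    then show ?thesis using e0 by simp
  qed
  ultimately show ?thesis using t q0 by blast
qed

text \<open>Each bad block is sent to \<open>(n, t)\<close> with \<open>n = q * t\<close> within
  \<open>R\<close> of \<open>w\<close> and \<open>t\<close> a divisor of \<open>n\<close> inside the
  block. Blocks are disjoint, so \<open>t\<close> determines the block, and there are at most
  \<open>2 * R + 1\<close> values of \<open>n\<close> with at most \<open>T\<close> divisors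
  each.\<close>

lemma card_inexact_blocks:
  assumes u: "0 < u0" and R: "w * h\<^sup>2 \<le> R * u0\<^sup>2"
    and T: "\<And>n. 0 < n \<Longrightarrow> n \<le> w + R \<Longrightarrow> card {d. d dvd n} \<le> T"
  shows "card {k. k < N \<and> block_lower w (u0 + k * h) h \<noteq> block_upper w (u0 + k * h) h} \<le> (2 * R + 1) * T"
proof -
  let ?X = "{k. k < N \<and> block_lower w (u0 + k * h) h \<noteq> block_upper w (u0 + k * h) h}"
  let ?S = "{n. 0 < n \<and> n \<le> w + R \<and> w \<le> n + R}"
  let ?D = "SIGMA n:?S. {d. d dvd n}"
  have "\<exists>t q. t \<in> {u0 + k * h..<u0 + k * h + h} \<and> q > 0 \<and> q * t \<le> w + R \<and> w \<le> q * t + R" if "k \<in> ?X" for k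
  proof -
    have "R * u0\<^sup>2 \<le> R * (u0 + k * h)\<^sup>2" by (intro mult_le_mono2 power_mono) auto
    then have R': "w * h\<^sup>2 \<le> R * (u0 + k * h)\<^sup>2" using R by (rule le_trans[rotated])
    have "\<exists>t\<in>{u0 + k * h..<u0 + k * h + h}. \<exists>q>0. q * t \<le> w + R \<and> w \<le> q * t + R"
      using that u by (intro block_inexact[OF _ _ R']) auto
    then show ?thesis by blast
  qed
  note ex = this
  define P where "P k t q \<longleftrightarrow> t \<in> {u0 + k * h..<u0 + k * h + h} \<and> q > 0 \<and> q * t \<le> w + R \<and> w \<le> q * t + R"
    for k t q :: nat
  define t where "t k = (SOME t. \<exists>q. P k t q)" for k
  define q where "q k = (SOME q. P k (t k) q)" for k
  have tq: "t k \<in> {u0 + k * h..<u0 + k * h + h} \<and> q k > 0 \<and> q k * t k \<le> w + R \<and> w \<le> q k * t k + R"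
    if "k \<in> ?X" for k
  proof -
    have "\<exists>t q. P k t q" using ex[OF that] unfolding P_def .
    then have "\<exists>q. P k (t k) q" unfolding t_def by (rule someI_ex)
    then have "P k (t k) (q k)" unfolding q_def by (rule someI_ex)
    then show ?thesis unfolding P_def .
  qed
  have inj: "inj_on (\<lambda>k. (q k * t k, t k)) ?X"
  proof (rule inj_onI)
    fix k l assume k: "k \<in> ?X" and l: "l \<in> ?X" and eq: "(q k * t k, t k) = (q l * t l, t l)"
    have le: "a \<le> b" if "u0 + a * h \<le> x" "x < u0 + b * h + h" for a b x
    proof (rule ccontr)
      assume "\<not> a \<le> b"
      then have "b * h + h \<le> a * h" by (metis Suc_leI add.commute mult_Suc mult_le_mono1 not_le)
      with that show False by linarith
    qed
    have "t k = t l" using eq by simp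
    then have "u0 + k * h \<le> t k" "t k < u0 + k * h + h" "u0 + l * h \<le> t k" "t k < u0 + l * h + h"
      using tq[OF k] tq[OF l] by simp_all
    then show "k = l" using le[of k "t k" l] le[of l "t k" k] by (intro antisym)
  qed
  have finS: "finite ?S" by (rule finite_subset[of _ "{..w + R}"]) auto
  have finD: "finite {d. d dvd n}" if "n \<in> ?S" for n using that by (simp add: finite_divisors_nat)
  have "card ?X \<le> card ?D"
  proof (rule card_inj_on_le[OF inj])
    show "(\<lambda>k. (q k * t k, t k)) ` ?X \<subseteq> ?D"
    proof
      fix x assume "x \<in> (\<lambda>k. (q k * t k, t k)) ` ?X"
      then obtain k where k: "k \<in> ?X" "x = (q k * t k, t k)" by blast
      have "0 < t k" using tq[OF k(1)] u by (auto intro: gr0I)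
      then show "x \<in> ?D" using tq[OF k(1)] k(2) by simp
    qed
    show "finite ?D" using finS finD by (intro finite_SigmaI) auto
  qed
  also have "card ?D = (\<Sum>n\<in>?S. card {d. d dvd n})" using finS finD by (intro card_SigmaI) auto
  also have "\<dots> \<le> (\<Sum>n\<in>?S. T)" using T by (intro sum_mono) auto
  also have "\<dots> = card ?S * T" by simp
  also have "card ?S \<le> card {w - R..w + R}" by (intro card_mono) auto
  also have "card {w - R..w + R} \<le> 2 * R + 1" by simp
  finally show ?thesis by simp
qed

subsection \<open>Counting pairs and triples\<close>

definition pairs :: "nat \<Rightarrow> nat" where
  "pairs w = card {(u, v). 0 < u \<and> u < v \<and> u * v \<le> w}"

lemma cofactors_eq_interval:
  assumes "0 < (u::nat)"
  shows "{v. u < v \<and> u * v \<le> w} = {u<..w div u}"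
  using assms by (auto simp: less_eq_div_iff_mult_less_eq mult.commute)

lemma pairs_eq_sum: "pairs w = (\<Sum>u=1..nth_root_nat 2 w. w div u - u)"
proof -
  have "{(u, v). 0 < u \<and> u < v \<and> u * v \<le> w} = (SIGMA u:{1..nth_root_nat 2 w}. {v. u < v \<and> u * v \<le> w})"
  proof -
    have "u ^ 2 \<le> w" if "u < v" "u * v \<le> w" for u v
    proof -
      have "u * u \<le> u * v" using that(1) by simp
      then show ?thesis using that(2) unfolding power2_eq_square by (rule le_trans)
    qed
    then show ?thesis by (auto simp: nth_root_nat_ge_iff Suc_le_eq)
  qed
  moreover have "card {v. u < v \<and> u * v \<le> w} = w div u - u" if "u \<in> {1..nth_root_nat 2 w}" for u
    using that by (simp add: cofactors_eq_interval)
  ultimately show ?thesis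
    unfolding pairs_def by (simp add: cofactors_eq_interval)
qed

text \<open>Modulo two, subtracting \<open>u\<close> is adding it. What remains besides a triangular
  number is a plain sum of quotients, the kind that tangents can approximate.\<close>

lemma pairs_mod_2:
  fixes w defines "s \<equiv> nth_root_nat 2 w"
  shows "pairs w mod 2 = (s * (s + 1) div 2 + (\<Sum>u=1..s. w div u)) mod 2"
proof -
  \<comment> \<open>The truncated subtraction in \<open>pairs_eq_sum\<close> is a true one.\<close>
  have "u \<le> w div u" if "u \<in> {1..s}" for u
  proof -
    have "u ^ 2 \<le> w" using that nth_root_nat_ge_iff[of 2 u w] by (simp add: s_def)
    then show ?thesis using that by (simp add: less_eq_div_iff_mult_less_eq power2_eq_square)
  qed
  then have "pairs w + (\<Sum>u=1..s. u) = (\<Sum>u=1..s. w div u)"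
    unfolding pairs_eq_sum s_def[symmetric] by (simp add: sum.distrib[symmetric])
  moreover have "(\<Sum>u=1..s. u) = s * (s + 1) div 2"
    using gauss_sum_nat[of s] by (simp add: sum.atLeast0_atMost_Suc_shift sum.atLeast_Suc_atMost)
  ultimately show ?thesis by presburger
qed

lemma triples_split:
  assumes F: "0 < F"
  shows "triples z = (\<Sum>f=1..F. pairs (z div f\<^sup>2)) +
    (\<Sum>u=1..nth_root_nat 2 (z div F\<^sup>2). \<Sum>v\<in>{u<..z div F\<^sup>2 div u}. nth_root_nat 2 (z div (u * v)) - F)"
proof -
  let ?M = "z div F\<^sup>2"
  let ?T = "{(f, u, v). 0 < f \<and> 0 < u \<and> u < v \<and> f\<^sup>2 * (u * v) \<le> z}"
  let ?P = "\<lambda>w. {(u, v). 0 < u \<and> u < v \<and> u * v \<le> (w::nat)}"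
  let ?A = "SIGMA f:{1..F}. ?P (z div f\<^sup>2)"
  let ?B = "SIGMA u:{1..nth_root_nat 2 ?M}. SIGMA v:{u<..?M div u}. {F<..nth_root_nat 2 (z div (u * v))}"
  let ?T1 = "{(f, u, v). 0 < f \<and> f \<le> F \<and> 0 < u \<and> u < v \<and> f\<^sup>2 * (u * v) \<le> z}"
  let ?T2 = "{(f, u, v). F < f \<and> 0 < u \<and> u < v \<and> f\<^sup>2 * (u * v) \<le> z}"
  have TT: "?T = ?T1 \<union> ?T2" using F by auto
  have fin: "finite ?T1" "finite ?T2"
    by (rule finite_subset[OF _ finite_triples[of z]], use F in auto)+
  have "triples z = card ?T1 + card ?T2"
    unfolding triples_def TT using fin by (intro card_Un_disjoint) auto
  also have "?T1 = ?A"
    by (auto simp: less_eq_div_iff_mult_less_eq mult.commute)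
  also have "card ?A = (\<Sum>f=1..F. pairs (z div f\<^sup>2))"
  proof -
    have "finite (?P w)" for w
    proof (rule finite_subset[of _ "{..w} \<times> {..w}"])
      have "u \<le> w \<and> v \<le> w" if "0 < u" "u < v" "u * v \<le> w" for u v
      proof -
        have "u \<le> u * v" "v \<le> u * v" using that by auto
        then show ?thesis using that(3) by (meson le_trans)
      qed
      then show "?P w \<subseteq> {..w} \<times> {..w}" by auto
    qed simp
    then show ?thesis unfolding pairs_def by (subst card_SigmaI) auto
  qed
  also have "card ?T2 = card ?B"
  proof (rule bij_betw_same_card[OF bij_betwI])
    have key: "(F < f \<and> 0 < u \<and> u < v \<and> f\<^sup>2 * (u * v) \<le> z) \<longleftrightarrow>
      (u \<in> {1..nth_root_nat 2 ?M} \<and> v \<in> {u<..?M div u} \<and> f \<in> {F<..nth_root_nat 2 (z div (u * v))})" for f u v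
    proof (cases "0 < u \<and> u < v")
      case True
      then have uv: "0 < u * v" by simp
      have 1: "f \<le> nth_root_nat 2 (z div (u * v)) \<longleftrightarrow> f\<^sup>2 * (u * v) \<le> z"
        using True by (simp add: nth_root_nat_ge_iff less_eq_div_iff_mult_less_eq)
      have 2: "v \<le> ?M div u \<longleftrightarrow> F\<^sup>2 * (u * v) \<le> z"
        using True F by (simp add: less_eq_div_iff_mult_less_eq ac_simps)
      have 3: "u \<le> nth_root_nat 2 ?M \<longleftrightarrow> F\<^sup>2 * u\<^sup>2 \<le> z"
        using F by (simp add: nth_root_nat_ge_iff less_eq_div_iff_mult_less_eq ac_simps)
      \<comment> \<open>One \<open>f\<close> beyond \<open>F\<close> already forces this, which
        bounds the pairs to be visited.\<close>
      have "F\<^sup>2 * (u * v) \<le> z" if "F < f" "f\<^sup>2 * (u * v) \<le> z"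
      proof -
        have "F\<^sup>2 * (u * v) \<le> f\<^sup>2 * (u * v)" using that(1) by (intro mult_le_mono1 power_mono) auto
        then show ?thesis using that(2) by (rule le_trans)
      qed
      moreover have "F\<^sup>2 * u\<^sup>2 \<le> z" if "F\<^sup>2 * (u * v) \<le> z"
      proof -
        have "F\<^sup>2 * u\<^sup>2 \<le> F\<^sup>2 * (u * v)" using True by (intro mult_le_mono2) (simp add: power2_eq_square)
        then show ?thesis using that by (rule le_trans)
      qed
      ultimately show ?thesis using True by (auto simp: 1 2 3)
    qed auto
    show "(\<lambda>(f, u, v). (u, v, f)) \<in> ?T2 \<rightarrow> ?B"
      using key by auto
    show "(\<lambda>(u, v, f). (f, u, v)) \<in> ?B \<rightarrow> ?T2"
      using key by auto
  qed auto
  also have "card ?B = (\<Sum>u=1..nth_root_nat 2 ?M. \<Sum>v\<in>{u<..?M div u}. nth_root_nat 2 (z div (u * v)) - F)"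
    by (subst card_SigmaI) auto
  finally show ?thesis .
qed

subsection \<open>The divisor bound\<close>

lemma card_divisors_prime_part:
  fixes n :: nat
  assumes "prime p" "n > 0"
  shows "card {d. d dvd n} \<le> (multiplicity p n + 1) * card {d. d dvd n div p ^ multiplicity p n}"
proof -
  let ?k = "multiplicity p n" let ?m = "n div p ^ ?k"
  have n: "n = p ^ ?k * ?m" by (simp add: multiplicity_dvd)
  have m0: "?m > 0" using n assms(2) by (metis gr0I mult_0_right)
  let ?f = "\<lambda>(i, d). p ^ i * d"
  have "{d. d dvd n} \<subseteq> ?f ` ({..?k} \<times> {d. d dvd ?m})"
  proof
    fix d assume d: "d \<in> {d. d dvd n}"
    let ?i = "multiplicity p d"
    have d0: "d \<noteq> 0" using d assms(2) by auto
    obtain e where e: "d = p ^ ?i * e" "\<not> p dvd e"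
      using multiplicity_decompose'[OF d0, of p] not_prime_unit assms(1) by metis
    have i: "?i \<le> ?k" using d assms(2) by (intro dvd_imp_multiplicity_le) auto
    have "coprime e (p ^ ?k)"
      using e(2) assms(1) by (metis coprime_commute coprime_power_left_iff prime_imp_coprime)
    moreover have "e dvd p ^ ?k * ?m"
    proof -
      have "e dvd d" by (subst e(1)) (rule dvd_triv_right)
      then show ?thesis using d unfolding n[symmetric] by (auto intro: dvd_trans)
    qed
    ultimately have "e dvd ?m" by (simp add: coprime_dvd_mult_right_iff)
    with i have *: "(?i, e) \<in> {..?k} \<times> {d. d dvd ?m}" by simp
    have "d = ?f (?i, e)" unfolding prod.case by (rule e(1))
    then show "d \<in> ?f ` ({..?k} \<times> {d. d dvd ?m})" using * by (rule image_eqI)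
  qed
  moreover have "finite ({..?k} \<times> {d. d dvd ?m})" using m0 by (simp add: finite_divisors_nat)
  ultimately have "card {d. d dvd n} \<le> card ({..?k} \<times> {d. d dvd ?m})" by (rule surj_card_le[rotated])
  then show ?thesis unfolding card_cartesian_product by simp
qed

text \<open>The number of divisors is the product of \<open>k + 1\<close> over the prime powers
  \<open>p ^ k\<close> in \<open>n\<close>. Such a factor is at most
  \<open>(p ^ k) powr \<epsilon>\<close> for \<open>p \<ge> P\<close>, and at most \<open>C0\<close>
  times that for any prime, so only the primes below \<open>P\<close> contribute to the
  constant.\<close>

lemma divisor_bound:
  fixes \<epsilon> :: real
  assumes "\<epsilon> > 0"
  obtains C where "C > 0" "\<And>n. n > 0 \<Longrightarrow> real (card {d. d dvd n}) \<le> C * real n powr \<epsilon>"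
proof -
  \<comment> \<open>Chosen to apply \<open>1 + x \<le> exp x\<close> at
    \<open>x = k * \<epsilon> * ln 2\<close>.\<close>
  define C0 where "C0 = max 1 (1 / (\<epsilon> * ln 2))"
  have C01: "C0 \<ge> 1" by (simp add: C0_def)
  \<comment> \<open>From here on \<open>p powr \<epsilon>\<close> is at least 2, and
    \<open>k + 1 \<le> 2 ^ k\<close>.\<close>
  define P where "P = nat \<lceil>2 powr (1 / \<epsilon>)\<rceil>"
  have small: "real k + 1 \<le> C0 * (real p ^ k) powr \<epsilon>" if "p \<ge> 2" for p k :: nat
  proof -
    have "1 \<le> C0 * (\<epsilon> * ln 2)"
    proof -
      have "1 / (\<epsilon> * ln 2) \<le> C0" by (simp add: C0_def)
      then show ?thesis using assms by (simp add: divide_le_eq)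
    qed
    then have "real k \<le> C0 * (\<epsilon> * ln 2) * real k" using mult_right_mono[of 1 _ "real k"] by simp
    then have "real k + 1 \<le> C0 * (1 + real k * \<epsilon> * ln 2)" using C01 by (simp add: algebra_simps)
    also have "1 + real k * \<epsilon> * ln 2 \<le> exp (real k * \<epsilon> * ln 2)" by (rule exp_ge_add_one_self)
    also have "exp (real k * \<epsilon> * ln 2) = (2 ^ k) powr \<epsilon>"
      by (simp add: powr_def ln_realpow mult.assoc mult.left_commute)
    also have "(2 ^ k) powr \<epsilon> \<le> (real p ^ k) powr \<epsilon>"
      using that assms by (intro powr_mono2 power_mono) auto
    finally show ?thesis using C01 by simp
  qed
  have large: "real k + 1 \<le> (real p ^ k) powr \<epsilon>" if "p \<ge> P" for p k :: nat
  proof -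
    have "2 powr (1 / \<epsilon>) \<le> real p" using that unfolding P_def by linarith
    then have "(2 powr (1 / \<epsilon>)) powr \<epsilon> \<le> real p powr \<epsilon>" using assms by (intro powr_mono2) auto
    then have "2 \<le> real p powr \<epsilon>" using assms by (simp add: powr_powr)
    then have "2 ^ k \<le> (real p powr \<epsilon>) ^ k" by (intro power_mono) auto
    also have "\<dots> = (real p ^ k) powr \<epsilon>"
      by (induction k) (auto simp: powr_mult)
    finally have "2 ^ k \<le> (real p ^ k) powr \<epsilon>" .
    moreover have "real k + 1 \<le> 2 ^ k"
      by (induction k) auto
    ultimately show ?thesis by linarith
  qed
  have main: "n > 0 \<Longrightarrow> real (card {d. d dvd n}) \<le> C0 ^ card {p. p < P \<and> prime p \<and> p dvd n} * real n powr \<epsilon>" for n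
  proof (induction n rule: less_induct)
    case (less n)
    let ?S = "\<lambda>n. {p. p < P \<and> prime p \<and> p dvd n}"
    have finS: "finite (?S n)" for n by simp
    show ?case
    proof (cases "n = 1")
      case True
      then show ?thesis using C01 by simp
    next
      case False
      with less.prems obtain p where p: "prime p" "p dvd n" using prime_factor_nat by blast
      define k where "k = multiplicity p n"
      define m where "m = n div p ^ k"
      have n: "n = p ^ k * m" unfolding k_def m_def by (simp add: multiplicity_dvd)
      have k0: "k > 0" using p less.prems by (simp add: k_def prime_multiplicity_gt_zero_iff)
      have mp: "\<not> p dvd m" unfolding m_def k_def using less.prems p by (intro multiplicity_decompose) auto
      have p2: "p \<ge> 2" using p(1) by (rule prime_ge_2_nat)
      have m0: "m > 0" using n less.prems by (auto intro!: Nat.gr0I)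
      have "1 < p ^ k" using k0 p2 by (intro one_less_power) auto
      then have "m < n" using n m0 by simp
      then have IH: "real (card {d. d dvd m}) \<le> C0 ^ card (?S m) * real m powr \<epsilon>" using less.IH m0 by blast
      have "card {d. d dvd n} \<le> (k + 1) * card {d. d dvd m}"
        using card_divisors_prime_part[OF p(1) less.prems] by (simp add: k_def m_def)
      then have "real (card {d. d dvd n}) \<le> (real k + 1) * real (card {d. d dvd m})"
        unfolding of_nat_le_iff[symmetric, where ?'a = real] by (simp only: of_nat_mult of_nat_add of_nat_1)
      also have "\<dots> \<le> (real k + 1) * (C0 ^ card (?S m) * real m powr \<epsilon>)"
        using IH by (intro mult_left_mono) auto
      also have "\<dots> = ((real k + 1) * C0 ^ card (?S m)) * real m powr \<epsilon>" by simp
      also have "\<dots> \<le> (C0 ^ card (?S n) * (real p ^ k) powr \<epsilon>) * real m powr \<epsilon>"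
      proof (intro mult_right_mono)
        show "(real k + 1) * C0 ^ card (?S m) \<le> C0 ^ card (?S n) * (real p ^ k) powr \<epsilon>"
        proof (cases "p < P")
          case True
          have "insert p (?S m) \<subseteq> ?S n" using p True n by auto
          then have "card (insert p (?S m)) \<le> card (?S n)" by (intro card_mono finS)
          then have "Suc (card (?S m)) \<le> card (?S n)" using mp by simp
          then have "C0 ^ Suc (card (?S m)) \<le> C0 ^ card (?S n)" using C01 by (intro power_increasing)
          then have "C0 ^ Suc (card (?S m)) * (real p ^ k) powr \<epsilon> \<le> C0 ^ card (?S n) * (real p ^ k) powr \<epsilon>"
            by (intro mult_right_mono) auto
          moreover have "(real k + 1) * C0 ^ card (?S m) \<le> (C0 * (real p ^ k) powr \<epsilon>) * C0 ^ card (?S m)"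
            using small[OF p2] C01 by (intro mult_right_mono) auto
          ultimately show ?thesis by (simp add: ac_simps)
        next
          case False
          have "?S m \<subseteq> ?S n" using n by auto
          then have "card (?S m) \<le> card (?S n)" by (intro card_mono finS)
          then have "C0 ^ card (?S m) \<le> C0 ^ card (?S n)" using C01 by (intro power_increasing)
          then have "(real k + 1) * C0 ^ card (?S m) \<le> (real p ^ k) powr \<epsilon> * C0 ^ card (?S n)"
            using large[of p k] False C01 by (intro mult_mono) auto
          then show ?thesis by (simp add: ac_simps)
        qed
      qed auto
      also have "\<dots> = C0 ^ card (?S n) * real n powr \<epsilon>"
        using n by (simp add: powr_mult)
      finally show ?thesis .
    qed
  qed
  show ?thesis
  proof (rule that[of "C0 ^ P"])
    show "C0 ^ P > 0" using C01 by simp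
    fix n :: nat assume "n > 0"
    have "card {p. p < P \<and> prime p \<and> p dvd n} \<le> card {..<P}" by (intro card_mono) auto
    then have "C0 ^ card {p. p < P \<and> prime p \<and> p dvd n} \<le> C0 ^ P" using C01 by (intro power_increasing) auto
    then have "C0 ^ card {p. p < P \<and> prime p \<and> p dvd n} * real n powr \<epsilon> \<le> C0 ^ P * real n powr \<epsilon>"
      by (intro mult_right_mono) auto
    with main[OF \<open>n > 0\<close>] show "real (card {d. d dvd n}) \<le> C0 ^ P * real n powr \<epsilon>" by linarith
  qed
qed

section \<open>Conventions for the programs\<close>

abbreviation R :: "nat \<Rightarrow> operand" where "R i \<equiv> Loc (Cell i)"

abbreviation seq (infixr ";;" 60) where "c ;; d \<equiv> Seq c d"

text \<open>The machine copies only through arithmetic. Subtracting zero, unlike adding it, leaves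
  no bound to prove in \<open>result_ok\<close>.\<close>

abbreviation Mov where "Mov r u \<equiv> Asg r Sub u (Const 0)"

abbreviation agree_off :: "nat set \<Rightarrow> memory \<Rightarrow> memory \<Rightarrow> bool" where
  "agree_off S M' M \<equiv> \<forall>i. i \<notin> S \<longrightarrow> M' i = M i"

lemma agree_off_trans:
  assumes "agree_off S M2 M1" "agree_off S' M1 M" "S \<subseteq> U" "S' \<subseteq> U"
  shows "agree_off U M2 M"
  using assms by (metis subsetD)

subsection \<open>Roots\<close>

text \<open>
  Every subprogram works on its own block of memory cells, inputs included: \<open>10-17\<close> roots
  (input exponent \<open>10\<close>, radicand \<open>11\<close>, output \<open>12\<close>), \<open>20-26\<close> floor sums
  (\<open>n, m, a, b\<close>, output \<open>24\<close>), \<open>30-42\<close> pairs (input \<open>30\<close>, output \<open>33\<close>), \<open>50-60\<close> triples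
  (\<open>50\<close>, \<open>51\<close>), \<open>65-70\<close> squarefreeness (\<open>65\<close>, \<open>66\<close>), \<open>80-84\<close> prime powers (\<open>80\<close>, \<open>81\<close>),
  \<open>90-92\<close> primes (\<open>90\<close>, \<open>91\<close>).
\<close>

definition root_com :: com where
  "root_com =
     Mov 12 (Const 0) ;; Asg 13 Add (R 11) (Const 1) ;; Asg 17 Sub (R 13) (R 12) ;;
     While Less (Const 1) (R 17)
      (Asg 14 Add (R 12) (R 13) ;; Asg 14 Div (R 14) (Const 2) ;;
       Mov 15 (R 11) ;; Mov 16 (Const 0) ;;
       While Less (R 16) (R 10) (Asg 15 Div (R 15) (R 14) ;; Asg 16 Add (R 16) (Const 1)) ;;
       Cond Less (Const 0) (R 15) (Mov 12 (R 14)) (Mov 13 (R 14)) ;;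
       Asg 17 Sub (R 13) (R 12))"

text \<open>Bisection, with the root enclosed by cells 12 and 13. Whether the \<open>k\<close>-th
  power of the midpoint is at most \<open>y\<close> is decided by dividing \<open>y\<close> by the
  midpoint \<open>k\<close> times and looking for a nonzero quotient, so that no large power is ever
  formed.\<close>

lemma wp_root:
  assumes k: "M 10 = k" "0 < k" "k < 2 ^ L" and y: "M 11 = y" "2 * y + 2 < 2 ^ L"
    and Q: "\<And>M' t'. M' 12 = nth_root_nat k y \<Longrightarrow> agree_off {12..17} M' M \<Longrightarrow>
              t' \<le> t + (4 * k + 14) * (L + 1) \<Longrightarrow> Q M' t'"
  shows "wp (2 ^ L) root_com Q M t"
proof -
  define I where "I = (\<lambda>n M' t'. M' 10 = k \<and> M' 11 = y \<and> agree_off {12..17} M' M \<and>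
    M' 17 = M' 13 - M' 12 \<and> M' 12 < M' 13 \<and> M' 13 \<le> y + 1 \<and> M' 12 ^ k \<le> y \<and> y < M' 13 ^ k \<and>
    M' 13 - M' 12 \<le> 2 ^ n \<and> n \<le> L \<and> t' + (4 * k + 13) * n \<le> t + 3 + (4 * k + 13) * L)"
  have "y < (y + 1) ^ k" using self_le_power[of "y + 1" k] k(2) by simp
  then show ?thesis
    unfolding root_com_def using k y
    apply simp
    apply (rule wp_While[where I = I and k = L])
    subgoal by (auto simp: I_def power_0_left)
    subgoal for n M' t'
    proof -
      assume I: "I n M' t'" and tst: "test_op Less (val M' (Const (Suc 0))) (val M' (R 17))"
      let ?mid = "(M' 12 + M' 13) div 2"
      have n: "n > 0" using I tst unfolding I_def by (cases n) auto
      have mid: "M' 12 < ?mid" "?mid < M' 13" "0 < ?mid" using I tst unfolding I_def by auto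
      have half: "M' 13 - ?mid \<le> 2 ^ (n - 1)" "?mid - M' 12 \<le> 2 ^ (n - 1)"
        using I n unfolding I_def by (cases n; auto)+
      define J where "J = (\<lambda>j M'' t''. M'' 16 + j = k \<and> M'' 14 = ?mid \<and> M'' 15 = y div ?mid ^ M'' 16 \<and>
         agree_off {14..16} M'' M' \<and> t'' + 4 * j = t' + 6 + 4 * k)"
      have F: "M' 10 = k" "M' 11 = y" "M' 12 + M' 13 < 2 ^ L"
        using I y(2) unfolding I_def by auto
      show ?thesis
        using n F
        apply simp
        apply (rule wp_While[where I = J and k = k])
        subgoal by (simp add: J_def)
        subgoal for j M'' t''
          using k(3) unfolding J_def by (auto simp: div_mult2_eq power_Suc2 simp del: power_Suc)
        subgoal for j M'' t''
        proof -
          assume J: "J j M'' t''" and nt: "\<not> test_op Less (val M'' (R 16)) (val M'' (R 10))"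
          have M: "M'' 10 = k" "M'' 11 = y" using J I unfolding J_def I_def by auto
          have j: "j = 0" "M'' 16 = k" using J nt M unfolding J_def by auto
          have d: "0 < M'' 15 \<longleftrightarrow> ?mid ^ k \<le> y"
            using J j mid by (simp add: J_def div_greater_zero_iff)
          have fr: "M'' 12 = M' 12" "M'' 13 = M' 13" "M'' 14 = ?mid" "\<And>i. i \<notin> {12..17} \<Longrightarrow> M'' i = M i"
            using J I unfolding J_def I_def by auto
          have tt: "t'' = t' + 6 + 4 * k" using J j unfolding J_def by simp
          have time: "t'' + 7 + (4 * k + 13) * (n - 1) \<le> t + 3 + (4 * k + 13) * L"
            using I n unfolding I_def tt by (cases n) (auto simp: algebra_simps)
          have "n - 1 \<le> L" using I unfolding I_def by linarith
          then show ?thesis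
            using d fr mid half I M n time unfolding I_def by (auto simp: not_le)
        qed
        done
    qed
    subgoal for n M' t'
    proof -
      assume I: "I n M' t'" and tst: "\<not> test_op Less (val M' (Const (Suc 0))) (val M' (R 17))"
      have eq: "M' 13 = M' 12 + 1" using I tst unfolding I_def by auto
      have "nth_root_nat k y = M' 12"
        using I unfolding I_def eq by (intro nth_root_nat_unique) auto
      then show ?thesis using I unfolding I_def by (intro Q) (auto simp: algebra_simps)
    qed
    done
qed

subsection \<open>Floor sums\<close>

definition floor_sum_com :: com where
  "floor_sum_com =
     Mov 24 (Const 0) ;;
     While Less (Const 0) (R 20)
      (Asg 25 Sub (R 20) (Const 1) ;; Asg 25 Mul (R 20) (R 25) ;; Asg 25 Div (R 25) (Const 2) ;;
       Asg 26 Div (R 22) (R 21) ;; Asg 25 Mul (R 25) (R 26) ;; Asg 24 Add (R 24) (R 25) ;;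
       Asg 25 Div (R 23) (R 21) ;; Asg 25 Mul (R 20) (R 25) ;; Asg 24 Add (R 24) (R 25) ;;
       Asg 22 Mod (R 22) (R 21) ;; Asg 23 Mod (R 23) (R 21) ;;
       Asg 25 Mul (R 22) (R 20) ;; Asg 25 Add (R 25) (R 23) ;;
       Asg 20 Div (R 25) (R 21) ;; Asg 23 Mod (R 25) (R 21) ;;
       Mov 25 (R 21) ;; Mov 21 (R 22) ;; Mov 22 (R 25))"

text \<open>A round reduces slope and offset modulo \<open>m\<close> and swaps, taking
  \<open>(m, a)\<close> to \<open>(a mod m, m)\<close>. This at least halves the product
  \<open>a * m\<close> whenever \<open>m \<le> a\<close>, which can fail only in the first round;
  hence at most \<open>L + 2\<close> rounds.\<close>

lemma wp_floor_sum:
  assumes inp: "M 20 = n" "M 21 = m" "M 22 = a" "M 23 = b" and m: "0 < m"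
    and B: "floor_sum n m a b < 2 ^ L" "n * n < 2 ^ L" "m * (n + 1) < 2 ^ L" "a * m < 2 ^ L"
    and Q: "\<And>M' t'. M' 24 = floor_sum n m a b \<Longrightarrow> agree_off {20..26} M' M \<Longrightarrow>
              t' \<le> t + 20 * (L + 3) \<Longrightarrow> Q M' t'"
  shows "wp (2 ^ L) floor_sum_com Q M t"
proof -
  \<comment> \<open>The factor two in the second case pays for a first round that merely exchanges
    \<open>m\<close> and \<open>a\<close>.\<close>
  define meas where "meas m a = (if m \<le> a then a * m else 2 * a * m)" for m a :: nat
  define I where "I = (\<lambda>k M' t'. M' 24 + floor_sum (M' 20) (M' 21) (M' 22) (M' 23) = floor_sum n m a b \<and>
    M' 20 \<le> n \<and> M' 21 \<le> m \<and> agree_off {20..26} M' M \<and>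
    (M' 20 = 0 \<or> 0 < k \<and> 0 < M' 21 \<and> 2 * meas (M' 21) (M' 22) < 2 ^ k) \<and>
    t' + 20 * k \<le> t + 1 + 20 * (L + 2))"
  have "2 * meas m a < 2 ^ (L + 2)" using B(4) unfolding meas_def by auto
  then show ?thesis
    unfolding floor_sum_com_def using inp m
    apply simp
    apply (rule wp_While[where I = I and k = "L + 2"])
    subgoal by (simp add: I_def)
    subgoal for k M' t'
    proof -
      assume I: "I k M' t'" and tst: "test_op Less (val M' (Const 0)) (val M' (R 20))"
      define n' where "n' = M' 20"
      define m' where "m' = M' 21"
      define a' where "a' = M' 22"
      define b' where "b' = M' 23"
      define s where "s = (n' * (n' - 1) div 2) * (a' div m')"
      define u where "u = n' * (b' div m')"
      define y where "y = a' mod m' * n' + b' mod m'"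
      define n2 where "n2 = y div m'"
      have k: "0 < k" and m0: "0 < m'" and meas: "2 * meas m' a' < 2 ^ k" and n0: "0 < n'"
        and n'n: "n' \<le> n" and m'm: "m' \<le> m"
        using I tst unfolding I_def m'_def a'_def n'_def by auto
      have sum: "M' 24 + (s + u + floor_sum n' m' (a' mod m') (b' mod m')) = floor_sum n m a b"
        using I floor_sum_reduce[of n' m' a' b'] unfolding I_def n'_def m'_def a'_def b'_def s_def u_def by simp
      have yB: "y < m' * (n' + 1)"
      proof -
        have "a' mod m' * n' \<le> m' * n'" using m0 by (intro mult_le_mono1) (simp add: less_imp_le)
        moreover have "b' mod m' < m'" using m0 by simp
        ultimately show ?thesis unfolding y_def by (simp only: add_mult_distrib2 mult_1_right)
      qed
      also have "m' * (n' + 1) \<le> m * (n + 1)" using m'm n'n by (intro mult_le_mono) auto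
      finally have yL: "y < 2 ^ L" using B(3) by simp
      have nn: "n' * (n' - 1) < 2 ^ L"
      proof -
        have "n' * (n' - 1) \<le> n * n" using n'n by (intro mult_le_mono) auto
        then show ?thesis using B(2) by simp
      qed
      have "y < (n' + 1) * m'" using yB by (simp only: mult.commute)
      then have "n2 < n' + 1" unfolding n2_def by (rule less_mult_imp_div_less)
      then have n2: "n2 \<le> n" using n'n by simp
      \<comment> \<open>The swap needs \<open>a' mod m'\<close> to be positive. When it is zero, no
        row remains: \<open>n2 = 0\<close> ends the loop before the zero modulus is used, and the
        floor sum still owed vanishes by \<open>fz\<close>.\<close>
      have rest: "n2 = 0 \<or> (0 < k - 1 \<and> 0 < a' mod m' \<and> 2 * meas (a' mod m') m' < 2 ^ (k - 1)) \<and>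
          floor_sum n' m' (a' mod m') (b' mod m') = floor_sum n2 (a' mod m') m' (y mod m')"
      proof (cases "a' mod m' = 0")
        case True
        then have "n2 = 0" unfolding n2_def y_def using m0 by simp
        then show ?thesis by simp
      next
        case False
        have "2 * (2 * (m' * (a' mod m'))) < 2 ^ k"
        proof (cases "m' \<le> a'")
          case True
          have "2 * (a' mod m') \<le> a'"
          proof -
            have "m' + a' mod m' \<le> a'" using True m0
              by (metis add_le_mono1 div_greater_zero_iff div_mult_mod_eq mult.commute mult_le_mono2 Suc_leI mult.right_neutral One_nat_def)
            moreover have "a' mod m' < m'" using m0 by simp
            ultimately show ?thesis by linarith
          qed
          then have "m' * (2 * (a' mod m')) \<le> m' * a'" by (rule mult_le_mono2)
          then have "2 * (2 * (m' * (a' mod m'))) \<le> 2 * (a' * m')" by (simp only: ac_simps)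
          also have "\<dots> < 2 ^ k" using meas True unfolding meas_def by simp
          finally show ?thesis .
        next
          case False
          with meas show ?thesis unfolding meas_def by (simp add: ac_simps)
        qed
        moreover have "a' mod m' \<le> m'" using m0 by (simp add: less_imp_le)
        ultimately have "2 * (2 * meas (a' mod m') m') < 2 ^ k" unfolding meas_def by (simp add: ac_simps)
        moreover have "k \<noteq> 1"
        proof
          assume "k = 1"
          with \<open>2 * (2 * (m' * (a' mod m'))) < 2 ^ k\<close> m0 False show False by simp
        qed
        ultimately have "0 < k - 1" "2 * meas (a' mod m') m' < 2 ^ (k - 1)"
          using k by (auto simp: power_eq_if)
        moreover have "floor_sum n' m' (a' mod m') (b' mod m') = floor_sum n2 (a' mod m') m' (y mod m')"
          unfolding n2_def y_def using False m0 by (intro floor_sum_swap) auto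
        ultimately show ?thesis using False by auto
      qed
      have fz: "n2 = 0 \<Longrightarrow> floor_sum n' m' (a' mod m') (b' mod m') = 0"
      proof -
        assume "n2 = 0"
        then have "y < m'" unfolding n2_def using m0 by (simp add: div_eq_0_iff)
        then have "(a' mod m' * i + b' mod m') div m' = 0" if "i < n'" for i
        proof -
          have "a' mod m' * i \<le> a' mod m' * n'" using that by simp
          with \<open>y < m'\<close> have "a' mod m' * i + b' mod m' < m'" unfolding y_def by linarith
          then show ?thesis by (rule div_less)
        qed
        then show ?thesis unfolding floor_sum_def by simp
      qed
      have B1: "M' 24 + s < 2 ^ L" "M' 24 + s + u < 2 ^ L" "s < 2 ^ L" "u < 2 ^ L" using sum B(1) by linarith+
      have y1: "a' mod m' * n' < 2 ^ L" using yL unfolding y_def by linarith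
      have nn': "n' * (n' - Suc 0) < 2 ^ L" using nn by simp
      have I': "agree_off {20..26} M' M" "t' + 20 * k \<le> t + 1 + 20 * (L + 2)"
        using I unfolding I_def by auto
      have mm: "a' mod m' \<le> m" using m0 m'm mod_less_divisor[OF m0, of a'] by linarith
      note fold = n'_def[symmetric] m'_def[symmetric] a'_def[symmetric] b'_def[symmetric]
      have sum2: "M' 24 + s + u + floor_sum n2 (a' mod m') m' (y mod m') = floor_sum n m a b"
        using sum rest fz by (cases "n2 = 0") auto
      show ?thesis
        using k nn' B1[unfolded s_def u_def One_nat_def] y1 yL[unfolded y_def] I' mm n2[unfolded n2_def y_def]
          rest[unfolded n2_def y_def] sum2[unfolded s_def u_def n2_def y_def One_nat_def]
        by (auto simp: I_def fold)
    qed
    subgoal for k M' t'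
      unfolding I_def by (intro Q) auto
    done
qed

subsection \<open>Naive summation and squarefreeness\<close>

definition sum_div_com :: com where
  "sum_div_com =
     While Less (R 31) (R 32)
      (Asg 34 Div (R 30) (R 31) ;; Asg 33 Add (R 33) (R 34) ;; Asg 33 Mod (R 33) (Const 2) ;;
       Asg 31 Add (R 31) (Const 1))"

lemma wp_sum_div:
  assumes inp: "M 30 = w" "M 31 = u" "M 32 = l" "u \<le> l" "M 33 = X mod 2"
    and B: "l < 2 ^ L" "w + 2 < 2 ^ L"
    and Q: "\<And>M' t'. M' 31 = l \<Longrightarrow> M' 33 = (X + (\<Sum>d=u..<l. w div d)) mod 2 \<Longrightarrow>
              agree_off {31, 33, 34} M' M \<Longrightarrow> t' \<le> t + 6 * (l - u) + 2 \<Longrightarrow> Q M' t'"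
  shows "wp (2 ^ L) sum_div_com Q M t"
proof -
  define I where "I = (\<lambda>k M' t'. k = l - M' 31 \<and> u \<le> M' 31 \<and> M' 31 \<le> l \<and>
     M' 33 = (X + (\<Sum>d=u..<M' 31. w div d)) mod 2 \<and> agree_off {31, 33, 34} M' M \<and>
     t' = t + 6 * (M' 31 - u))"
  show ?thesis unfolding sum_div_com_def
    apply (rule wp_While[where I = I and k = "l - u"])
    subgoal using inp by (simp add: I_def)
    subgoal for k M' t'
    proof -
      assume I: "I k M' t'" and tst: "test_op Less (val M' (R 31)) (val M' (R 32))"
      have F: "M' 30 = w" "M' 32 = l" "M' 31 < l" "u \<le> M' 31" "M' 33 \<le> 1" "k = l - M' 31"
        "M' 33 = (X + (\<Sum>d=u..<M' 31. w div d)) mod 2"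
        using I tst inp unfolding I_def by auto
      have d: "w div M' 31 \<le> w" by simp
      have "M' 33 + w div M' 31 < 2 ^ L" "Suc (M' 31) < 2 ^ L" using F(3,5) d B by linarith+
      moreover have "(M' 33 + w div M' 31) mod 2 = (X + (\<Sum>d=u..<Suc (M' 31). w div d)) mod 2"
        unfolding F(7) using F(4) by (simp add: mod_simps add.assoc)
      ultimately show ?thesis using F(1-4,6) I
        by (auto simp: I_def)
    qed
    subgoal for k M' t'
      using inp unfolding I_def by (intro Q) auto
    done
qed

definition squarefree_com :: com where
  "squarefree_com =
     Mov 66 (Const 1) ;; Mov 67 (Const 2) ;; Mov 68 (Const 4) ;; Asg 69 Add (R 65) (Const 1) ;;
     While Less (R 68) (R 69)
      (Asg 70 Mod (R 65) (R 68) ;;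
       Cond Equal (R 70) (Const 0) (Mov 66 (Const 0)) (Mov 66 (R 66)) ;;
       Asg 67 Add (R 67) (Const 1) ;; Asg 68 Mul (R 67) (R 67))"

text \<open>Trial division by all squares up to \<open>g\<close> is affordable, as the program calls
  it only for \<open>g\<close> below a fourth root of the bound or below a logarithm of it.\<close>

lemma wp_squarefree:
  assumes inp: "M 65 = g" "0 < g" and B: "4 * g + 4 < 2 ^ L"
    and Q: "\<And>M' t'. M' 66 = (if squarefree g then 1 else 0) \<Longrightarrow>
              agree_off {66..70} M' M \<Longrightarrow> t' \<le> t + 8 * nth_root_nat 2 g + 6 \<Longrightarrow> Q M' t'"
  shows "wp (2 ^ L) squarefree_com Q M t"
proof -
  define s where "s = nth_root_nat 2 g"
  define I where "I = (\<lambda>k M' t'. 2 \<le> M' 67 \<and> M' 68 = M' 67 * M' 67 \<and> M' 69 = g + 1 \<and>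
     M' 66 = (if \<exists>d\<in>{2..<M' 67}. d\<^sup>2 dvd g then 0 else 1) \<and> agree_off {66..70} M' M \<and>
     k = s + 1 - M' 67 \<and> t' + 8 * k \<le> t + 4 + 8 * s)"
  show ?thesis unfolding squarefree_com_def using inp B
    apply simp
    apply (rule wp_While[where I = I and k = "s - 1"])
    subgoal by (simp add: I_def)
    subgoal for k M' t'
    proof -
      assume I: "I k M' t'" and tst: "test_op Less (val M' (R 68)) (val M' (R 69))"
      have F: "M' 65 = g" "M' 69 = g + 1" "M' 68 = M' 67 * M' 67" "M' 67 * M' 67 \<le> g" "2 \<le> M' 67"
        "M' 66 = (if \<exists>d\<in>{2..<M' 67}. d\<^sup>2 dvd g then 0 else 1)"
        using I tst inp unfolding I_def by auto
      have s: "M' 67 \<le> s" using F(4) unfolding s_def by (simp add: nth_root_nat_ge_iff power2_eq_square)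
      have "Suc (M' 67) * Suc (M' 67) \<le> 4 * (M' 67 * M' 67)"
        using mult_le_mono[of "Suc (M' 67)" "2 * M' 67" "Suc (M' 67)" "2 * M' 67"] F(5) by simp
      then have "Suc (M' 67) * Suc (M' 67) < 2 ^ L" using F(4) B by linarith
      moreover have "Suc (M' 67) < 2 ^ L"
        using F(4,5) B mult_le_mono[of 1 "M' 67" "M' 67" "M' 67"] by linarith
      moreover have "(\<exists>d\<in>{2..<Suc (M' 67)}. d\<^sup>2 dvd g) \<longleftrightarrow> (\<exists>d\<in>{2..<M' 67}. d\<^sup>2 dvd g) \<or> g mod (M' 67 * M' 67) = 0"
        using F(5) unfolding mod_eq_0_iff_dvd power2_eq_square by (auto simp: less_Suc_eq)
      moreover have "0 < k" using I s unfolding I_def by auto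
      ultimately show ?thesis using F I s
        by (auto simp: I_def)
    qed
    subgoal for k M' t'
    proof -
      assume I: "I k M' t'" and tst: "\<not> test_op Less (val M' (R 68)) (val M' (R 69))"
      have lt: "g < (M' 67)\<^sup>2" using I tst unfolding I_def by (auto simp: power2_eq_square)
      have "squarefree g \<longleftrightarrow> \<not> (\<exists>d\<in>{2..<M' 67}. d\<^sup>2 dvd g)"
      proof
        assume "squarefree g"
        show "\<not> (\<exists>d\<in>{2..<M' 67}. d\<^sup>2 dvd g)"
        proof
          assume "\<exists>d\<in>{2..<M' 67}. d\<^sup>2 dvd g"
          then obtain d where "2 \<le> d" "d\<^sup>2 dvd g" by auto
          with squarefreeD[OF \<open>squarefree g\<close>, of d] show False by simp
        qed
      next
        assume n: "\<not> (\<exists>d\<in>{2..<M' 67}. d\<^sup>2 dvd g)"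
        show "squarefree g"
        proof (rule squarefreeI)
          fix d assume d: "d\<^sup>2 dvd g"
          then have "d\<^sup>2 \<le> g" using inp(2) by (rule dvd_imp_le)
          with lt have "d\<^sup>2 < (M' 67)\<^sup>2" by linarith
          then have "d < M' 67" by (rule power_less_imp_less_base) simp
          with n d have "\<not> 2 \<le> d" by auto
          moreover have "d \<noteq> 0" using d inp(2) by (auto simp: power2_eq_square)
          ultimately show "d dvd 1" by simp
        qed
      qed
      then show ?thesis using I unfolding I_def s_def by (intro Q) auto
    qed
    done
qed

subsection \<open>Counting pairs\<close>

text \<open>\<open>floor_sum_com\<close> destroys its inputs, so they are loaded afresh for the
  second line. Cell 42 holds the exclusive end of the block and is advanced to that of the next
  one.\<close>

definition block_com :: com where
  "block_com =
     Asg 39 Sub (R 42) (Const 1) ;;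
     Mov 20 (R 36) ;; Asg 21 Mul (R 39) (R 39) ;; Mov 22 (R 30) ;; Asg 23 Mul (R 30) (R 39) ;;
     floor_sum_com ;; Mov 38 (R 24) ;;
     Mov 20 (R 36) ;; Asg 21 Mul (R 39) (R 39) ;; Mov 22 (R 30) ;; Asg 23 Mul (R 30) (R 39) ;;
     Asg 40 Div (R 30) (R 31) ;; Asg 40 Mul (R 40) (R 36) ;; Asg 40 Mul (R 40) (R 36) ;;
     Asg 23 Add (R 23) (R 40) ;;
     floor_sum_com ;;
     Cond Equal (R 38) (R 24)
      (Asg 33 Add (R 33) (R 24) ;; Asg 33 Mod (R 33) (Const 2) ;; Mov 31 (R 42))
      (Mov 32 (R 42) ;; sum_div_com) ;;
     Asg 42 Add (R 31) (R 36)"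

text \<open>The overflow conditions are to be linear consequences of one assumption, so the powers
  of \<open>w\<close> are written as products that serve as atoms. The floor sums of a block are the
  most demanding: they are bounded by \<open>w ^ 4 + 2 * w ^ 3\<close>.\<close>

lemma poly_bounds:
  assumes "((w::nat) + 2) ^ 4 < B"
  shows "w * w * w * w + 3 * (w * w * w) + 3 * (w * w) + 4 * w + 8 < B"
proof -
  have "(w + 2) ^ 4 = w * w * w * w + 8 * (w * w * w) + 24 * (w * w) + 32 * w + 16"
    by (simp add: eval_nat_numeral algebra_simps)
  then show ?thesis using assms by linarith
qed

lemma floor_sum_le: "0 < m \<Longrightarrow> floor_sum n m a b \<le> n * (a * n + b)"
proof -
  assume "0 < m"
  have "floor_sum n m a b \<le> (\<Sum>i<n. a * n + b)"
    unfolding floor_sum_def by (intro sum_mono order.trans[OF div_le_dividend]) simp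
  then show ?thesis by simp
qed

lemma wp_block:
  assumes inp: "M 30 = w" "M 31 = u" "M 36 = h" "M 42 = u + h" "M 33 = X mod 2"
    and u: "0 < u" "0 < h" "u + h \<le> w + 1" and B: "(w + 2) ^ 4 < 2 ^ L"
    and Q: "\<And>M' t'. M' 31 = u + h \<Longrightarrow> M' 42 = u + h + h \<Longrightarrow>
              M' 33 = (X + (\<Sum>d=u..<u + h. w div d)) mod 2 \<Longrightarrow>
              agree_off ({20..26} \<union> {31..34} \<union> {38, 39, 40, 42}) M' M \<Longrightarrow>
              t' \<le> t + 50 * (L + 3) + (if block_lower w u h \<noteq> block_upper w u h then 6 * h else 0) \<Longrightarrow> Q M' t'"
  shows "wp (2 ^ L) block_com Q M t"
proof -
  define e where "e = u + h - 1"
  define tol where "tol = w div u * h * h"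
  have e: "e \<le> w" and e0: "0 < e" and h: "h \<le> w" using u by (auto simp: e_def)
  note P = poly_bounds[OF B]
  have ee: "e * e \<le> w * w" and we: "w * e \<le> w * w" using e by (auto intro: mult_le_mono)
  have wu: "w div u * h \<le> w * w" using h by (intro mult_le_mono) auto
  have tol: "tol \<le> w * w * w" unfolding tol_def using h wu by (intro mult_le_mono) auto
  have p1: "w * (e * e) \<le> w * w * w" using mult_le_mono2[OF ee, of w] by (simp add: ac_simps)
  have p2: "e * e * (h + 1) \<le> w * w * w + w * w"
    using mult_le_mono[OF ee, of "h + 1" "w + 1"] h by (simp add: algebra_simps)
  have fs: "floor_sum h (e * e) w b < 2 ^ L" if "b \<le> w * w + w * w * w" for b
  proof -
    have "w * h + b \<le> w * w + (w * w + w * w * w)" using h that by (intro add_mono) auto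
    then have "h * (w * h + b) \<le> w * (w * w + (w * w + w * w * w))" using h by (intro mult_le_mono)
    then have "floor_sum h (e * e) w b \<le> w * (w * w + (w * w + w * w * w))"
      using floor_sum_le[of "e * e" h w b] e0 by simp
    then show ?thesis using P by (simp add: algebra_simps)
  qed
  have hh: "h * h \<le> w * w" using h by (intro mult_le_mono)
  show ?thesis unfolding block_com_def
    apply (simp add: inp e_def[symmetric, unfolded One_nat_def])
    apply (intro conjI)
    subgoal using ee P by linarith
    subgoal using we P by linarith
    apply (rule wp_floor_sum[where n = h and m = "e * e" and a = w and b = "w * e"])
    subgoal by simp
    subgoal by simp
    subgoal by simp
    subgoal by simp
    subgoal using e0 by simp
    subgoal using we by (intro fs) linarith
    subgoal using hh P by linarith
    subgoal using p2 P by linarith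
    subgoal using p1 P by linarith
    subgoal premises prems for M1 t1
    proof -
      have F: "M1 36 = h" "M1 39 = e" "M1 30 = w" "M1 31 = u" "M1 42 = u + h" "M1 33 = X mod 2"
        "M1 24 = floor_sum h (e * e) w (w * e)"
        using prems(1,2) inp by auto
      show ?thesis
        apply (simp add: F tol_def[symmetric])
        apply (intro conjI)
        subgoal using ee P by linarith
        subgoal using we P by linarith
        subgoal using wu P by linarith
        subgoal using tol P by linarith
        subgoal using tol we P by linarith
        apply (rule wp_floor_sum[where n = h and m = "e * e" and a = w and b = "w * e + tol"])
        subgoal by simp
        subgoal by simp
        subgoal by simp
        subgoal by simp
        subgoal using e0 by simp
        subgoal using we tol by (intro fs) linarith
        subgoal using hh P by linarith
        subgoal using p2 P by linarith
        subgoal using p1 P by linarith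
        subgoal premises prems2 for M2 t2
        proof -
          have G: "M2 36 = h" "M2 30 = w" "M2 31 = u" "M2 42 = u + h" "M2 33 = X mod 2"
            "M2 24 = block_upper w u h" "M2 38 = block_lower w u h"
            using prems2(1,2) F by (auto simp: e_def tol_def block_tol_def power2_eq_square)
          have fr: "agree_off ({20..26} \<union> {31..34} \<union> {38, 39, 40, 42}) M2 M"
            using prems2(2) prems(2) by auto
          have up: "block_upper w u h \<le> w * (w * w + (w * w + w * w * w))"
          proof -
            have "w * h + (w * e + tol) \<le> w * w + (w * w + w * w * w)" using h tol we by (intro add_mono) auto
            then have "h * (w * h + (w * e + tol)) \<le> w * (w * w + (w * w + w * w * w))"
              using h by (intro mult_le_mono)
            then show ?thesis
              using floor_sum_le[of "e * e" h w "w * e + tol", OF mult_pos_pos[OF e0 e0]]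
              unfolding e_def tol_def block_tol_def power2_eq_square by linarith
          qed
          have upL: "block_upper w u h + 1 < 2 ^ L" using up P by (simp add: algebra_simps)
          have w2: "w + 2 < 2 ^ L" and uhL: "u + h < 2 ^ L" "u + h + h < 2 ^ L" using P u h by linarith+
          show ?thesis
          proof (cases "block_lower w u h = block_upper w u h")
            case True
            have "X mod 2 + block_upper w u h < 2 ^ L" using upL by linarith
            moreover have "(X mod 2 + block_upper w u h) mod 2 = (X + (\<Sum>d=u..<u + h. w div d)) mod 2"
              using block_exact[OF u(1) True] True by (simp add: mod_simps)
            moreover have "Q (M2(33 := (X mod 2 + block_upper w u h) mod 2, 31 := u + h, 42 := u + h + h))
              (Suc (Suc (Suc (Suc (Suc (Suc t2))))))"
            proof (rule Q)
              show "agree_off ({20..26} \<union> {31..34} \<union> {38, 39, 40, 42}) (M2(33 := (X mod 2 + block_upper w u h) mod 2, 31 := u + h, 42 := u + h + h)) M"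
              proof (intro allI impI)
                fix i :: nat assume i: "i \<notin> {20..26} \<union> {31..34} \<union> {38, 39, 40, 42}"
                then have "M2 i = M i" using fr by blast
                with i show "(M2(33 := (X mod 2 + block_upper w u h) mod 2, 31 := u + h, 42 := u + h + h)) i = M i"
                  by auto
              qed
            qed (use calculation(2) prems(3) prems2(3) in auto)
            ultimately show ?thesis using True uhL by (simp add: G)
          next
            case False
            show ?thesis
              apply (simp add: G False[unfolded One_nat_def])
              apply (rule wp_sum_div[where w = w and u = u and l = "u + h" and X = X])
              subgoal using G by simp
              subgoal using G by simp
              subgoal by simp
              subgoal by simp
              subgoal using G by simp
              subgoal using uhL by simp
              subgoal using w2 by simp
              subgoal premises p3 for M3 t3
              proof -
                have "Q (M3(42 := u + h + h)) (t3 + 1)"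
                proof (rule Q)
                  show "agree_off ({20..26} \<union> {31..34} \<union> {38, 39, 40, 42}) (M3(42 := u + h + h)) M"
                  proof (intro allI impI)
                    fix i :: nat assume i: "i \<notin> {20..26} \<union> {31..34} \<union> {38, 39, 40, 42}"
                    then have "M3 i = (M2(32 := u + h)) i" using p3(3) by auto
                    moreover have "M2 i = M i" using fr i by blast
                    ultimately show "(M3(42 := u + h + h)) i = M i" using i by auto
                  qed
                qed (use p3 prems(3) prems2(3) False in auto)
                moreover have "M3 36 = h" using p3(3) G by auto
                ultimately show ?thesis using p3(1) uhL by simp
              qed
              done
          qed
        qed
        done
    qed
    done
qed

text \<open>The limit \<open>s + 2\<close> turns the strict test into the condition that the next
  block ends at \<open>s\<close> or before. A tail of fewer than \<open>h\<close> terms is left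
  over.\<close>

definition block_loop_com :: com where
  "block_loop_com =
     Asg 41 Add (R 35) (Const 2) ;; Asg 42 Add (R 31) (R 36) ;;
     While Less (R 42) (R 41) block_com"

text \<open>The time is split into a logarithmic charge for each of the \<open>N\<close> blocks and
  a charge of \<open>6 * h\<close> for each bad one, so that the bad blocks can be counted
  separately.\<close>

lemma wp_block_loop:
  assumes inp: "M 30 = w" "M 35 = s" "M 36 = h" "M 31 = u0" "M 33 = X mod 2"
    and u0: "0 < u0" "u0 \<le> s + 1" and h: "0 < h" "h \<le> w" and s: "s \<le> w" and B: "(w + 2) ^ 4 < 2 ^ L"
    and Q: "\<And>M' t' N. u0 + N * h \<le> s + 1 \<Longrightarrow> M' 31 = u0 + N * h \<Longrightarrow> s + 1 < M' 31 + h \<Longrightarrow>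
              M' 33 = (X + (\<Sum>d=u0..<M' 31. w div d)) mod 2 \<Longrightarrow>
              agree_off ({20..26} \<union> {31..34} \<union> {38..42}) M' M \<Longrightarrow>
              t' \<le> t + N * (50 * (L + 3) + 2) +
                 6 * h * card {k. k < N \<and> block_lower w (u0 + k * h) h \<noteq> block_upper w (u0 + k * h) h} + 4 \<Longrightarrow> Q M' t'"
  shows "wp (2 ^ L) block_loop_com Q M t"
proof -
  define bad where "bad k \<longleftrightarrow> block_lower w (u0 + k * h) h \<noteq> block_upper w (u0 + k * h) h" for k
  define c where "c = 50 * (L + 3) + 2"
  define I where "I = (\<lambda>n M' t'. \<exists>N. n + N = s + 1 \<and> u0 + N * h \<le> s + 1 \<and> M' 31 = u0 + N * h \<and> M' 42 = M' 31 + h \<and>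
     M' 33 = (X + (\<Sum>d=u0..<M' 31. w div d)) mod 2 \<and> M' 41 = s + 2 \<and>
     agree_off ({20..26} \<union> {31..34} \<union> {38..42}) M' M \<and>
     t' \<le> t + 2 + N * c + 6 * h * card {k. k < N \<and> bad k})"
  have bnd: "s + 2 < 2 ^ L" "u0 + h < 2 ^ L"
    using poly_bounds[OF B] u0 h s by linarith+
  show ?thesis unfolding block_loop_com_def using inp bnd
    apply simp
    apply (rule wp_While[where I = I and k = "s + 1"])
    subgoal unfolding I_def using u0 by (intro exI[of _ 0]) auto
    subgoal premises prems for n M' t'
    proof -
      have tst: "test_op Less (val M' (R 42)) (val M' (R 41))" and I: "I n M' t'" using prems by auto
      obtain N where N: "n + N = s + 1" "u0 + N * h \<le> s + 1" "M' 31 = u0 + N * h" "M' 42 = M' 31 + h"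
         "M' 33 = (X + (\<Sum>d=u0..<M' 31. w div d)) mod 2" "M' 41 = s + 2"
         "agree_off ({20..26} \<union> {31..34} \<union> {38..42}) M' M"
         "t' \<le> t + 2 + N * c + 6 * h * card {k. k < N \<and> bad k}"
        using I unfolding I_def by blast
      have lt: "u0 + N * h + h \<le> s + 1" using tst N(3,4,6) by simp
      have "N \<le> N * h" using h by simp
      then have n: "0 < n" using N(1) lt u0 h by linarith
      have F: "M' 30 = w" "M' 36 = h" using N(7) inp by auto
      have "wp (2 ^ L) block_com (I (n - 1)) M' (t' + 2)"
      proof (rule wp_block[where w = w and u = "u0 + N * h" and h = h and X = "X + (\<Sum>d=u0..<u0 + N * h. w div d)"])
        show "u0 + N * h + h \<le> w + 1" using lt s by linarith
        fix M'' t''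
        assume Q: "M'' 31 = u0 + N * h + h" "M'' 42 = u0 + N * h + h + h"
          "M'' 33 = (X + (\<Sum>d = u0..<u0 + N * h. w div d) + (\<Sum>d = u0 + N * h..<u0 + N * h + h. w div d)) mod 2"
          "agree_off ({20..26} \<union> {31..34} \<union> {38, 39, 40, 42}) M'' M'"
          "t'' \<le> t' + 2 + 50 * (L + 3) + (if block_lower w (u0 + N * h) h \<noteq> block_upper w (u0 + N * h) h then 6 * h else 0)"
        have sum: "(\<Sum>d = u0..<u0 + N * h. w div d) + (\<Sum>d = u0 + N * h..<u0 + N * h + h. w div d) =
           (\<Sum>d = u0..<u0 + N * h + h. w div d)" by (rule sum.atLeastLessThan_concat) auto
        have "{k. k < Suc N \<and> bad k} = (if bad N then insert N {k. k < N \<and> bad k} else {k. k < N \<and> bad k})"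
          by (auto simp: less_Suc_eq)
        then have card: "card {k. k < Suc N \<and> bad k} = card {k. k < N \<and> bad k} + (if bad N then 1 else 0)"
          by simp
        show "I (n - 1) M'' t''"
          unfolding I_def
        proof (intro exI[of _ "Suc N"] conjI)
          show "n - 1 + Suc N = s + 1" using N(1) n by simp
          show "u0 + Suc N * h \<le> s + 1" using lt by simp
          show "M'' 31 = u0 + Suc N * h" using Q by simp
          show "M'' 42 = M'' 31 + h" using Q by simp
          show "M'' 33 = (X + (\<Sum>d = u0..<M'' 31. w div d)) mod 2"
            unfolding Q(3) Q(1) sum[symmetric] by (simp only: add.assoc)
          show "M'' 41 = s + 2" using Q N by simp
          show "agree_off ({20..26} \<union> {31..34} \<union> {38..42}) M'' M"
            by (rule agree_off_trans[OF Q(4) N(7)]) auto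
          have "t'' \<le> (t + 2 + N * c + 6 * h * card {k. k < N \<and> bad k}) + 2 + 50 * (L + 3) + (if bad N then 6 * h else 0)"
            using Q(5)[folded bad_def] N(8) by linarith
          also have "\<dots> = t + 2 + Suc N * c + 6 * h * card {k. k < Suc N \<and> bad k}"
            unfolding card c_def by (simp add: algebra_simps)
          finally show "t'' \<le> t + 2 + Suc N * c + 6 * h * card {k. k < Suc N \<and> bad k}" .
        qed
      qed (use F N(3,4,5) u0 h B in simp_all)
      with n show ?thesis by simp
    qed
    subgoal premises prems for n M' t'
    proof -
      have tst: "\<not> test_op Less (val M' (R 42)) (val M' (R 41))" and I: "I n M' t'" using prems by auto
      from I obtain N where N: "u0 + N * h \<le> s + 1" "M' 31 = u0 + N * h" "M' 42 = M' 31 + h"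
         "M' 33 = (X + (\<Sum>d=u0..<M' 31. w div d)) mod 2" "M' 41 = s + 2"
         "agree_off ({20..26} \<union> {31..34} \<union> {38..42}) M' M"
         "t' \<le> t + 2 + N * c + 6 * h * card {k. k < N \<and> bad k}"
        unfolding I_def by blast
      show ?thesis
      proof (rule Q[OF N(1,2) _ N(4) N(6)])
        show "s + 1 < M' 31 + h" using tst N(3,5) by simp
        show "t' + 2 \<le> t + N * (50 * (L + 3) + 2) + 6 * h * card {k. k < N \<and> block_lower w (u0 + k * h) h \<noteq> block_upper w (u0 + k * h) h} + 4"
          using N(7) unfolding c_def bad_def by linarith
      qed
    qed
    done
qed

text \<open>Each summand is at most a constant times \<open>(L + 3) * T * h ^ 5\<close>. The divisor
  bound \<open>T\<close> enters through the bad blocks alone.\<close>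

lemma pairs_cost:
  fixes h :: nat
  assumes "1 \<le> h" "1 \<le> T" "N \<le> 64 * h ^ 5" "bad \<le> (2 * (4096 * h ^ 4) + 1) * T"
  shows "84 * (L + 1) + 6 * h ^ 5 + N * (50 * (L + 3) + 2) + 6 * h * bad + 6 * h + 40 \<le> 100000 * (L + 3) * T * h ^ 5"
proof -
  have h: "h \<le> h ^ 5" "1 \<le> h ^ 5" using assms(1) self_le_power[of h 5] by auto
  define Y where "Y = (L + 3) * T * h ^ 5"
  have Th: "h ^ 5 \<le> T * h ^ 5" using assms(2) by simp
  have LT: "(L + 3) * h ^ 5 \<le> Y" using mult_le_mono2[OF Th, of "L + 3"] by (simp add: Y_def ac_simps)
  have L1: "L + 3 \<le> Y" using le_trans[OF mult_le_mono2[OF h(2), of "L + 3"] LT] by (simp only: mult_1_right)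
  have "3 * h ^ 5 \<le> (L + 3) * h ^ 5" by (intro mult_le_mono1) simp
  then have h3: "3 * h ^ 5 \<le> Y" using LT by (rule le_trans)
  have T3: "3 * (T * h ^ 5) \<le> Y" unfolding Y_def mult.assoc by (intro mult_le_mono1) simp
  have "N * (50 * (L + 3) + 2) \<le> (64 * h ^ 5) * (51 * (L + 3))"
    using assms(3) by (intro mult_le_mono) auto
  also have "\<dots> = 3264 * ((L + 3) * h ^ 5)" by simp
  also have "\<dots> \<le> 3264 * Y" using LT by (rule mult_le_mono2)
  finally have a: "N * (50 * (L + 3) + 2) \<le> 3264 * Y" .
  have "6 * h * bad \<le> 6 * h * ((2 * (4096 * h ^ 4) + 1) * T)" using assms(4) by (intro mult_le_mono2)
  also have "\<dots> = 49152 * (T * (h * h ^ 4)) + 6 * (T * h)" by (simp add: algebra_simps)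
  also have "h * h ^ 4 = h ^ 5" using power_Suc[of h 4] by simp
  also have "T * h \<le> T * h ^ 5" using h(1) by simp
  finally have b: "6 * h * bad \<le> 20000 * Y" using T3 by linarith
  have "84 * (L + 1) + 6 * h ^ 5 + N * (50 * (L + 3) + 2) + 6 * h * bad + 6 * h + 40 \<le> 100000 * Y"
  proof -
    define A where "A = N * (50 * (L + 3) + 2)"
    define A' where "A' = 6 * h * bad"
    have "A \<le> 3264 * Y" "A' \<le> 20000 * Y" using a b unfolding A_def A'_def .
    moreover have "84 * L + 252 \<le> 84 * Y" using mult_le_mono2[OF L1, of 84] by simp
    moreover have "12 * h ^ 5 \<le> 4 * Y" using mult_le_mono2[OF h3, of 4] by simp
    moreover have "6 * h \<le> 6 * h ^ 5" using h(1) by (rule mult_le_mono2)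
    ultimately have "84 * L + 84 + 6 * h ^ 5 + A + A' + 6 * h + 40 \<le> 3264 * Y + 20000 * Y + 84 * Y + 4 * Y"
      by linarith
    then have "84 * (L + 1) + 6 * h ^ 5 + A + A' + 6 * h + 40 \<le> 23352 * Y" by simp
    also have "\<dots> \<le> 100000 * Y" by (rule mult_le_mono1) simp
    finally show ?thesis unfolding A_def A'_def .
  qed
  then show ?thesis unfolding Y_def by (simp only: mult.assoc)
qed

definition pairs_com :: com where
  "pairs_com =
     Mov 10 (Const 2) ;; Mov 11 (R 30) ;; root_com ;; Mov 35 (R 12) ;;
     Mov 10 (Const 12) ;; root_com ;; Mov 36 (R 12) ;;
     Asg 33 Add (R 35) (Const 1) ;; Asg 33 Mul (R 35) (R 33) ;; Asg 33 Div (R 33) (Const 2) ;;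
     Asg 33 Mod (R 33) (Const 2) ;;
     Mov 31 (Const 1) ;;
     Asg 32 Mul (R 36) (R 36) ;; Asg 32 Mul (R 32) (R 36) ;; Asg 32 Mul (R 32) (R 36) ;;
     Asg 32 Mul (R 32) (R 36) ;; Asg 32 Add (R 32) (Const 1) ;;
     sum_div_com ;;
     block_loop_com ;;
     Asg 32 Add (R 35) (Const 1) ;; sum_div_com"

text \<open>\<open>T\<close> belongs to the analysis and is never computed. The divisor counts
  needed are those of \<open>n \<le> w + R\<close> with \<open>R = 4096 * h ^ 4\<close>, and
  \<open>h ^ 4 \<le> w\<close> turns this into \<open>4097 * w\<close>.\<close>

lemma wp_pairs:
  assumes inp: "M 30 = w" "0 < w" and B: "(w + 2) ^ 4 < 2 ^ L" "12 < L"
    and T: "1 \<le> T" "\<And>n. 0 < n \<Longrightarrow> n \<le> 4097 * w \<Longrightarrow> card {d. d dvd n} \<le> T"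
    and Q: "\<And>M' t'. M' 33 = pairs w mod 2 \<Longrightarrow>
              agree_off {10..42} M' M \<Longrightarrow>
              t' \<le> t + 100000 * (L + 3) * T * nth_root_nat 12 w ^ 5 \<Longrightarrow> Q M' t'"
  shows "wp (2 ^ L) pairs_com Q M t"
proof -
  define s where "s = nth_root_nat 2 w"
  define h where "h = nth_root_nat 12 w"
  note P = poly_bounds[OF B(1)]
  have s2: "s\<^sup>2 \<le> w" and h12: "h ^ 12 \<le> w" unfolding s_def h_def by (auto intro: nth_root_nat_power_le)
  have sw: "s \<le> w" using s2 self_le_power[of s 2] by (cases "s = 0") auto
  have h1: "1 \<le> h" using inp(2) unfolding h_def by (simp add: nth_root_nat_ge_iff)
  have h5w: "h ^ 5 \<le> w" and hw: "h \<le> w"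
    using h12 h1 power_increasing[of 5 12 h] power_increasing[of 1 12 h] by auto
  have h5s: "h ^ 5 \<le> s" unfolding s_def
  proof (subst nth_root_nat_ge_iff)
    have "(h ^ 5) ^ 2 = h ^ 10" by (simp add: power_mult[symmetric])
    also have "\<dots> \<le> h ^ 12" using h1 by (intro power_increasing) auto
    finally show "(h ^ 5) ^ 2 \<le> w" using h12 by simp
  qed simp
  \<comment> \<open>Replacing \<open>h + 1\<close> by \<open>2 * h\<close> costs the factor
    \<open>2 ^ 12\<close>, and its square root 64 in the bound for \<open>s\<close>.\<close>
  have w12: "w < 4096 * h ^ 12"
  proof -
    have "\<not> (h + 1) ^ 12 \<le> w" using nth_root_nat_ge_iff[of 12 "h + 1" w] by (simp add: h_def)
    then have "w < (h + 1) ^ 12" by simp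
    also have "\<dots> \<le> (2 * h) ^ 12" using h1 by (intro power_mono) auto
    finally show ?thesis by (simp add: power_mult_distrib)
  qed
  have s6: "s < 64 * h ^ 6"
  proof -
    have "s\<^sup>2 < (64 * h ^ 6)\<^sup>2" using s2 w12 by (simp add: power_mult_distrib power_mult[symmetric])
    then show ?thesis by (rule power_less_imp_less_base) simp
  qed
  have hp: "h * h \<le> w" "h * h * h \<le> w" "h * h * h * h \<le> w" "h * h * h * h * h \<le> w" "h * h * h * h * h = h ^ 5"
  proof -
    have "h ^ j \<le> w" if "j \<le> 12" for j
      using power_increasing[OF that h1] h12 by (rule le_trans)
    from this[of 2] this[of 3] this[of 4] h5w
    show "h * h \<le> w" "h * h * h \<le> w" "h * h * h * h \<le> w" "h * h * h * h * h \<le> w" "h * h * h * h * h = h ^ 5"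
      by (auto simp: eval_nat_numeral ac_simps)
  qed
  have ss: "s * (s + 1) \<le> w * w + w" using sw mult_le_mono[OF sw, of "s + 1" "w + 1"] by simp
  have cL: "12 < (2::nat) ^ L" using power_increasing[of 4 L "2::nat"] B(2) by simp
  \<comment> \<open>The blocks start at \<open>h ^ 5 + 1\<close>, so \<open>R\<close> has to exceed
    \<open>w * h\<^sup>2\<close> divided by \<open>h ^ 10\<close>, which is less than
    \<open>4096 * h ^ 4\<close>.\<close>
  have bad: "card {k. k < N \<and> block_lower w (h ^ 5 + 1 + k * h) h \<noteq> block_upper w (h ^ 5 + 1 + k * h) h}
      \<le> (2 * (4096 * h ^ 4) + 1) * T" for N
  proof (rule card_inexact_blocks)
    have "w * h\<^sup>2 \<le> 4096 * h ^ 12 * h\<^sup>2" using w12 by (intro mult_le_mono1) simp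
    also have "\<dots> = 4096 * h ^ 4 * (h ^ 5)\<^sup>2" by (simp add: power_mult[symmetric] power_add[symmetric])
    also have "\<dots> \<le> 4096 * h ^ 4 * (h ^ 5 + 1)\<^sup>2" by (intro mult_le_mono2 power_mono) auto
    finally show "w * h\<^sup>2 \<le> 4096 * h ^ 4 * (h ^ 5 + 1)\<^sup>2" .
    have "h ^ 4 \<le> w" using h12 h1 power_increasing[of 4 12 h] by linarith
    then show "card {d. d dvd n} \<le> T" if "0 < n" "n \<le> w + 4096 * h ^ 4" for n
      using that by (intro T) auto
  qed simp
  let ?X = "s * (s + 1) div 2"
  show ?thesis unfolding pairs_com_def using inp
    apply simp
    apply (rule wp_root[where k = 2 and y = w])
    subgoal by simp
    subgoal by simp
    subgoal using cL by linarith
    subgoal by simp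
    subgoal using P by linarith
    apply simp
    subgoal premises p for M1 t1
    apply (rule wp_root[where k = 12 and y = w])
    subgoal by simp
    subgoal by simp
    subgoal using cL by linarith
    subgoal using p by simp
    subgoal using P by linarith
    subgoal premises q for M2 t2
    proof -
      have F: "M2 35 = s" "M2 12 = h" "M2 30 = w" using p q by (auto simp: s_def h_def)
      have fr: "agree_off {10..42} M2 M" using p(4) q(2) by auto
      have t2: "t2 \<le> t + 84 * (L + 1) + 4" using p(5) q(3) by simp
      show ?thesis
        apply (simp add: F)
        apply (intro conjI)
        subgoal using sw P by linarith
        subgoal using ss P by simp
        subgoal using hp P by linarith
        subgoal using hp P by linarith
        subgoal using hp P by linarith
        subgoal using hp P by linarith
        subgoal using hp P by linarith
        apply (rule wp_sum_div[where w = w and u = 1 and l = "h ^ 5 + 1" and X = ?X])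
        subgoal using F by simp
        subgoal by simp
        subgoal using hp by simp
        subgoal by simp
        subgoal by simp
        subgoal using h5w P by linarith
        subgoal using P by linarith
        subgoal premises r for M3 t3
        proof -
          have G: "M3 30 = w" "M3 35 = s" "M3 36 = h" "M3 31 = h ^ 5 + 1"
            "M3 33 = (?X + (\<Sum>d=1..<h ^ 5 + 1. w div d)) mod 2"
            using F r by auto
          have fr3: "agree_off {10..42} M3 M" using fr r(3) by auto
          show ?thesis
            apply simp
            apply (rule wp_block_loop[OF G(1,2,3,4,5) _ _ _ hw sw B(1)])
            subgoal by simp
            subgoal using h5s by simp
            subgoal using h1 by simp
            subgoal premises b for M4 t4 N
            proof -
              have H: "M4 30 = w" "M4 35 = s" using b(5) G by auto
              have le: "h ^ 5 + 1 \<le> M4 31" "M4 31 \<le> s + 1" using b(1,2) by auto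
              have "h ^ 6 = h ^ 5 * h" using power_Suc2[of h 5] by simp
              then have "s < (64 * h ^ 5) * h" using s6 by (simp only: mult.assoc)
              moreover have "N * h \<le> s" using b(1) by simp
              ultimately have "N * h < (64 * h ^ 5) * h" by (rule le_less_trans[rotated])
              then have N: "N \<le> 64 * h ^ 5" by simp
              have s1: "s + 1 < 2 ^ L" using sw P by linarith
              have fr4: "agree_off {10..42} M4 M" using fr3 b(5) by auto
              show ?thesis
                apply (simp add: H)
                apply (rule conjI)
                subgoal using s1 by simp
                apply (rule wp_sum_div[where w = w and u = "M4 31" and l = "s + 1"
                    and X = "?X + (\<Sum>d=1..<h ^ 5 + 1. w div d) + (\<Sum>d=h ^ 5 + 1..<M4 31. w div d)"])
                subgoal using H by simp
                subgoal by simp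
                subgoal by simp
                subgoal using le by simp
                subgoal using b(4) by simp
                subgoal using s1 by simp
                subgoal using P by linarith
                subgoal premises z for M5 t5
                proof (rule Q)
                  have s1: "(\<Sum>d=1..<h ^ 5 + 1. w div d) + (\<Sum>d=h ^ 5 + 1..<M4 31. w div d) =
                      (\<Sum>d=1..<M4 31. w div d)"
                    using le by (intro sum.atLeastLessThan_concat) auto
                  have s2: "(\<Sum>d=1..<M4 31. w div d) + (\<Sum>d=M4 31..<s + 1. w div d) =
                      (\<Sum>d=1..<s + 1. w div d)"
                    using le by (intro sum.atLeastLessThan_concat) auto
                  have "(\<Sum>d=1..<h ^ 5 + 1. w div d) + (\<Sum>d=h ^ 5 + 1..<M4 31. w div d) +
                      (\<Sum>d=M4 31..<s + 1. w div d) = (\<Sum>d=1..<s + 1. w div d)"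
                    using s2 unfolding s1[symmetric] .
                  also have "{1..<s + 1} = {1..s}" by auto
                  finally show "M5 33 = pairs w mod 2"
                    unfolding z(2) pairs_mod_2 s_def[symmetric] by (simp add: add.assoc)
                  show "agree_off {10..42} M5 M" using fr4 z(3) by auto
                  have t3: "t3 \<le> t + 84 * (L + 1) + 25 + 6 * h ^ 5" using r(4) t2 by simp
                  have "6 * (s + 1 - M4 31) \<le> 6 * h" using b(3) by simp
                  then have "t5 \<le> t4 + 6 * h + 5" using z(4) by simp
                  then have "t5 \<le> t + (84 * (L + 1) + 6 * h ^ 5 + N * (50 * (L + 3) + 2) +
                     6 * h * card {k. k < N \<and> block_lower w (h ^ 5 + 1 + k * h) h \<noteq> block_upper w (h ^ 5 + 1 + k * h) h} + 6 * h + 40)"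
                    using b(6) t3 by linarith
                  with pairs_cost[OF h1 T(1) N bad[of N], of L]
                  show "t5 \<le> t + 100000 * (L + 3) * T * nth_root_nat 12 w ^ 5"
                    unfolding h_def[symmetric] by linarith
                qed
                done
            qed
            done
        qed
        done
    qed
    done
    done
qed

subsection \<open>Counting triples\<close>

definition cost_pairs :: "nat \<Rightarrow> nat \<Rightarrow> nat \<Rightarrow> nat" where
  "cost_pairs L T w = 100000 * (L + 3) * T * nth_root_nat 12 w ^ 5"

definition small_com :: com where
  "small_com =
     Mov 51 (Const 0) ;; Mov 53 (Const 1) ;; Asg 54 Add (R 52) (Const 1) ;;
     While Less (R 53) (R 54)
      (Asg 30 Mul (R 53) (R 53) ;; Asg 30 Div (R 50) (R 30) ;; pairs_com ;;
       Asg 51 Add (R 51) (R 33) ;; Asg 51 Mod (R 51) (Const 2) ;; Asg 53 Add (R 53) (Const 1))"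

lemma wp_small:
  assumes inp: "M 50 = z" "M 52 = F" "F\<^sup>2 \<le> z" and B: "(z + 2) ^ 4 < 2 ^ L" "12 < L"
    and T: "1 \<le> T" "\<And>n. 0 < n \<Longrightarrow> n \<le> 4097 * z \<Longrightarrow> card {d. d dvd n} \<le> T"
    and Q: "\<And>M' t'. M' 51 = (\<Sum>f=1..F. pairs (z div f\<^sup>2)) mod 2 \<Longrightarrow>
              agree_off ({10..49} \<union> {51, 53, 54}) M' M \<Longrightarrow>
              t' \<le> t + 5 + (\<Sum>f=1..F. cost_pairs L T (z div f\<^sup>2) + 10) \<Longrightarrow> Q M' t'"
  shows "wp (2 ^ L) small_com Q M t"
proof -
  define I where "I = (\<lambda>k M' t'. 1 \<le> M' 53 \<and> M' 53 \<le> F + 1 \<and> M' 54 = F + 1 \<and> k = F + 1 - M' 53 \<and>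
    M' 51 = (\<Sum>f=1..<M' 53. pairs (z div f\<^sup>2)) mod 2 \<and> agree_off ({10..49} \<union> {51, 53, 54}) M' M \<and>
    t' \<le> t + 3 + (\<Sum>f=1..<M' 53. cost_pairs L T (z div f\<^sup>2) + 10))"
  note P = poly_bounds[OF B(1)]
  have Fz: "F \<le> z" using inp(3) self_le_power[of F 2] by (cases "F = 0") auto
  have FL: "Suc F < 2 ^ L" using Fz P by linarith
  show ?thesis unfolding small_com_def using inp FL
    apply simp
    apply (rule wp_While[where I = I and k = F])
    subgoal by (simp add: I_def)
    subgoal premises prems for k M' t'
    proof -
      have I: "I k M' t'" and tst: "test_op Less (val M' (R 53)) (val M' (R 54))" using prems by auto
      define f where "f = M' 53"
      have F: "M' 53 = f" "M' 50 = z" "M' 54 = F + 1" "1 \<le> f" "f \<le> F" "k = F + 1 - f" "M' 51 \<le> 1"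
        "M' 51 = (\<Sum>f=1..<f. pairs (z div f\<^sup>2)) mod 2" "agree_off ({10..49} \<union> {51, 53, 54}) M' M"
        "t' \<le> t + 3 + (\<Sum>f=1..<f. cost_pairs L T (z div f\<^sup>2) + 10)"
        using I tst inp unfolding I_def f_def by auto
      have f2: "f * f \<le> z"
        using power_mono[OF F(5), of 2] inp(3) unfolding power2_eq_square by simp
      have w: "0 < z div (f * f)" "z div (f * f) \<le> z" using f2 F(4) by (auto simp: div_greater_zero_iff)
      have ff: "f * f < 2 ^ L" using f2 P by linarith
      have k: "0 < k" using F by simp
      show ?thesis using k
        apply (simp add: F ff)
        apply (rule wp_pairs[where w = "z div (f * f)" and T = T])
        subgoal by simp
        subgoal by (rule w)
        subgoal by (rule le_less_trans[OF power_mono B(1)]) (use w(2) in simp_all)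
        subgoal by (rule B)
        subgoal by (rule T)
        subgoal for n using mult_le_mono2[OF w(2), of 4097] by (intro T) linarith+
        subgoal premises p for M1 t1
        proof -
          have G: "M1 53 = f" "M1 51 = M' 51" "M1 50 = z" "M1 54 = F + 1" using p F by auto
          have s1: "M' 51 + pairs (z div (f * f)) mod 2 < 2 ^ L"
          proof -
            have "M' 51 + pairs (z div (f * f)) mod 2 \<le> 2" using F(7) by simp
            then show ?thesis using P by linarith
          qed
          have s2: "Suc f < 2 ^ L" using F(5) FL by simp
          have fr: "agree_off ({10..49} \<union> {51, 53, 54}) M1 M"
          proof (intro allI impI)
            fix i :: nat assume i: "i \<notin> {10..49} \<union> {51, 53, 54}"
            then have "M1 i = M' i" using p(3) by auto
            then show "M1 i = M i" using F(9) i by auto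
          qed
          have sum: "(M' 51 + pairs (z div (f * f)) mod 2) mod 2 = (\<Sum>f=1..<Suc f. pairs (z div f\<^sup>2)) mod 2"
            unfolding F(8) using F(4) by (simp add: mod_simps power2_eq_square)
          have t1: "t1 + 3 \<le> t + 3 + (\<Sum>f=1..<Suc f. cost_pairs L T (z div f\<^sup>2) + 10)"
            using p(4) F(10) F(4) by (simp add: cost_pairs_def power2_eq_square)
          show ?thesis
            apply (simp add: G p(2) s1 s2)
            unfolding I_def
          proof (intro conjI)
            show "\<forall>i. i \<notin> {10..49} \<union> {51, 53, 54} \<longrightarrow>
              (M1(51 := (M' 51 + pairs (z div (f * f)) mod 2) mod 2, 53 := Suc f)) i = M i"
              using fr by auto
          qed (use F(4,5,6) G sum t1 k in auto)
        qed
        done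
    qed
    subgoal premises prems for k M' t'
    proof -
      have I: "I k M' t'" and tst: "\<not> test_op Less (val M' (R 53)) (val M' (R 54))" using prems by auto
      have "M' 53 = F + 1" using I tst unfolding I_def by auto
      moreover have "{1..<F + 1} = {1..F}" by auto
      ultimately show ?thesis using I unfolding I_def by (intro Q) auto
    qed
    done
qed

definition row_com :: com where
  "row_com =
     Asg 58 Div (R 55) (R 57) ;; Asg 58 Add (R 58) (Const 1) ;; Asg 59 Add (R 57) (Const 1) ;;
     While Less (R 59) (R 58)
      (Asg 11 Mul (R 57) (R 59) ;; Asg 11 Div (R 50) (R 11) ;; root_com ;;
       Asg 60 Sub (R 12) (R 52) ;; Asg 51 Add (R 51) (R 60) ;; Asg 51 Mod (R 51) (Const 2) ;;
       Asg 59 Add (R 59) (Const 1))"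

lemma wp_row:
  assumes inp: "M 50 = z" "M 52 = F" "M 55 = m" "M 57 = u" "M 10 = 2" "M 51 = X mod 2"
    and u: "0 < u" "u * u \<le> m" "m \<le> z" and B: "(z + 2) ^ 4 < 2 ^ L"
    and Q: "\<And>M' t'. M' 51 = (X + (\<Sum>v\<in>{u<..m div u}. nth_root_nat 2 (z div (u * v)) - F)) mod 2 \<Longrightarrow>
              agree_off ({11..17} \<union> {51, 58, 59, 60}) M' M \<Longrightarrow>
              t' \<le> t + 5 + (m div u) * (22 * (L + 1) + 10) \<Longrightarrow> Q M' t'"
  shows "wp (2 ^ L) row_com Q M t"
proof -
  let ?g = "\<lambda>v. nth_root_nat 2 (z div (u * v)) - F"
  \<comment> \<open>The price of \<open>root_com\<close> for exponent 2 has the factor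
    \<open>22 = 4 * 2 + 14\<close>; the 10 covers the rest of the body.\<close>
  define c where "c = 22 * (L + 1) + 10"
  define q where "q = m div u"
  define I where "I = (\<lambda>k M' t'. u < M' 59 \<and> M' 59 \<le> q + 1 \<and> M' 58 = q + 1 \<and> k = q + 1 - M' 59 \<and>
    M' 51 = (X + (\<Sum>v\<in>{u<..<M' 59}. ?g v)) mod 2 \<and> agree_off ({11..17} \<union> {51, 58, 59, 60}) M' M \<and>
    t' + k * c \<le> t + 3 + q * c)"
  note P = poly_bounds[OF B]
  have uq: "u \<le> q" "q \<le> m" using u unfolding q_def by (auto simp: less_eq_div_iff_mult_less_eq)
  have L: "Suc q < 2 ^ L" "Suc u < 2 ^ L" using uq u P by linarith+
  show ?thesis unfolding row_com_def using inp L
    apply (simp add: q_def[symmetric])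
    apply (rule wp_While[where I = I and k = "q - u"])
    subgoal using uq unfolding I_def by (auto simp: atLeastSucLessThan_greaterThanLessThan[symmetric])
    subgoal premises prems for k M' t'
    proof -
      have I: "I k M' t'" and tst: "test_op Less (val M' (R 59)) (val M' (R 58))" using prems by auto
      define v where "v = M' 59"
      have F: "M' 59 = v" "M' 50 = z" "M' 57 = u" "M' 52 = F" "M' 10 = 2" "M' 58 = q + 1" "u < v" "v \<le> q" "k = q + 1 - v"
        "M' 51 \<le> 1" "M' 51 = (X + (\<Sum>v\<in>{u<..<v}. ?g v)) mod 2"
        "agree_off ({11..17} \<union> {51, 58, 59, 60}) M' M" "t' + k * c \<le> t + 3 + q * c"
        using I tst inp unfolding I_def v_def by auto
      have "v * u \<le> m" using F(8) u(1) unfolding q_def by (simp add: less_eq_div_iff_mult_less_eq)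
      then have uv: "u * v < 2 ^ L" using u(3) P by (simp add: mult.commute)
      have y: "z div (u * v) \<le> z" by simp
      have k: "0 < k" "k = Suc (k - 1)" using F by auto
      show ?thesis using k(1)
        apply (simp add: F uv)
        apply (rule wp_root[where k = 2 and y = "z div (u * v)"])
        subgoal using F by simp
        subgoal by simp
        subgoal using P by linarith
        subgoal by simp
        subgoal using y P by linarith
        subgoal premises p for M1 t1
        proof -
          have G: "M1 59 = v" "M1 51 = M' 51" "M1 52 = F" "M1 58 = q + 1" using p F by auto
          have r: "nth_root_nat 2 (z div (u * v)) \<le> z"
            using nth_root_nat_le_self[of 2 "z div (u * v)"] y by linarith
          have s1: "M' 51 + ?g v < 2 ^ L" using F(10) r P by linarith
          have s2: "Suc v < 2 ^ L" using F(8) L by simp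
          have fr: "agree_off ({11..17} \<union> {51, 58, 59, 60}) M1 M"
          proof (intro allI impI)
            fix i :: nat assume i: "i \<notin> {11..17} \<union> {51, 58, 59, 60}"
            then have "M1 i = M' i" using p(3) by auto
            then show "M1 i = M i" using F(12) i by auto
          qed
          have "{u<..<Suc v} = insert v {u<..<v}" using F(7) by auto
          then have S: "(\<Sum>v\<in>{u<..<Suc v}. ?g v) = (\<Sum>v\<in>{u<..<v}. ?g v) + ?g v"
            by (simp only:) (subst sum.insert, auto)
          have sum: "(M' 51 + ?g v) mod 2 = (X + (\<Sum>v\<in>{u<..<Suc v}. ?g v)) mod 2"
            unfolding F(11) S by (simp only: mod_simps add.assoc)
          have "k * c = (k - 1) * c + c" using k(2) by (metis mult_Suc add.commute)
          then have t1: "t1 + 4 + (k - 1) * c \<le> t + 3 + q * c"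
            using p(4) F(13) unfolding c_def by simp
          show ?thesis
            apply (simp add: G p(2) s1 s2)
            unfolding I_def
          proof (intro conjI)
            show "agree_off ({11..17} \<union> {51, 58, 59, 60}) (M1(60 := ?g v, 51 := (M' 51 + ?g v) mod 2, 59 := Suc v)) M"
              using fr by auto
          qed (use F(7,8,9) G sum t1 k in auto)
        qed
        done
    qed
    subgoal premises prems for k M' t'
    proof -
      have I: "I k M' t'" and tst: "\<not> test_op Less (val M' (R 59)) (val M' (R 58))" using prems by auto
      have eq: "M' 59 = q + 1" using I tst unfolding I_def by auto
      have set: "{u<..<q + 1} = {u<..m div u}" unfolding q_def by auto
      have "t' + 2 \<le> t + 5 + q * c" using I unfolding I_def by simp
      moreover have "M' 51 = (X + (\<Sum>v\<in>{u<..m div u}. ?g v)) mod 2" using I set eq unfolding I_def by simp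
      ultimately show ?thesis using I unfolding I_def c_def q_def by (intro Q) auto
    qed
    done
qed

definition large_com :: com where
  "large_com =
     Asg 55 Mul (R 52) (R 52) ;; Asg 55 Div (R 50) (R 55) ;;
     Mov 10 (Const 2) ;; Mov 11 (R 55) ;; root_com ;; Asg 56 Add (R 12) (Const 1) ;; Mov 57 (Const 1) ;;
     While Less (R 57) (R 56) (row_com ;; Asg 57 Add (R 57) (Const 1))"

lemma wp_large:
  fixes z F
  defines "m \<equiv> z div F\<^sup>2"
  defines "s \<equiv> nth_root_nat 2 m"
  assumes inp: "M 50 = z" "M 52 = F" "M 51 = X mod 2" and F: "F\<^sup>2 \<le> z" "0 < F"
    and B: "(z + 2) ^ 4 < 2 ^ L"
    and Q: "\<And>M' t'. M' 51 = (X + (\<Sum>u=1..s. \<Sum>v\<in>{u<..m div u}. nth_root_nat 2 (z div (u * v)) - F)) mod 2 \<Longrightarrow>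
              agree_off ({10..17} \<union> {51} \<union> {53..60}) M' M \<Longrightarrow>
              t' \<le> t + 22 * (L + 1) + 8 + (\<Sum>u=1..s. (m div u) * (22 * (L + 1) + 10) + 8) \<Longrightarrow> Q M' t'"
  shows "wp (2 ^ L) large_com Q M t"
proof -
  let ?g = "\<lambda>u. \<Sum>v\<in>{u<..m div u}. nth_root_nat 2 (z div (u * v)) - F"
  define c where "c u = (m div u) * (22 * (L + 1) + 10) + 8" for u
  define I where "I = (\<lambda>k M' t'. 1 \<le> M' 57 \<and> M' 57 \<le> s + 1 \<and> M' 56 = s + 1 \<and> M' 55 = m \<and> M' 10 = 2 \<and> k = s + 1 - M' 57 \<and>
    M' 51 = (X + (\<Sum>u=1..<M' 57. ?g u)) mod 2 \<and> agree_off ({10..17} \<union> {51} \<union> {53..60}) M' M \<and>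
    t' \<le> t + 22 * (L + 1) + 6 + (\<Sum>u=1..<M' 57. c u))"
  note P = poly_bounds[OF B]
  have mz: "m \<le> z" unfolding m_def by simp
  have s2: "s * s \<le> m" unfolding s_def power2_eq_square[symmetric] by (rule nth_root_nat_power_le) simp
  have sz: "s \<le> z" using nth_root_nat_le_self[of 2 m] mz unfolding s_def by linarith
  have FF: "F * F < 2 ^ L" using F P unfolding power2_eq_square by linarith
  have m: "z div (F * F) = m" unfolding m_def power2_eq_square ..
  show ?thesis unfolding large_com_def
    apply (simp add: inp FF m)
    apply (rule wp_root[where k = 2 and y = m])
    subgoal by simp
    subgoal by simp
    subgoal using P by linarith
    subgoal by simp
    subgoal using mz P by linarith
    subgoal premises p for M0 t0
    proof -
      have sL: "Suc s < 2 ^ L" using sz P by linarith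
      have G0: "M0 12 = s" "M0 10 = 2" "M0 55 = m" "M0 51 = X mod 2" using p(1,2) inp by (auto simp: s_def)
      have fr0: "agree_off ({10..17} \<union> {51} \<union> {53..60}) M0 M"
      proof (intro allI impI)
        fix i :: nat assume i: "i \<notin> {10..17} \<union> {51} \<union> {53..60}"
        then have "M0 i = (M(55 := m, 10 := 2, 11 := m)) i" using p(2) by auto
        then show "M0 i = M i" using i by auto
      qed
      show ?thesis
        apply (simp add: G0 sL)
        apply (rule wp_While[where I = I and k = s])
        subgoal
          unfolding I_def
        proof (intro conjI)
          show "agree_off ({10..17} \<union> {51} \<union> {53..60}) (M0(56 := Suc s, 57 := Suc 0)) M"
            using fr0 by auto
        qed (use G0 p(3) in simp_all)
        subgoal premises prems for k M' t'
        proof -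
          have I: "I k M' t'" and tst: "test_op Less (val M' (R 57)) (val M' (R 56))" using prems by auto
          define u where "u = M' 57"
          have F: "M' 57 = u" "M' 50 = z" "M' 52 = F" "M' 10 = 2" "M' 55 = m" "M' 56 = s + 1" "1 \<le> u" "u \<le> s" "k = s + 1 - u"
            "M' 51 = (X + (\<Sum>u=1..<u. ?g u)) mod 2"
            "agree_off ({10..17} \<union> {51} \<union> {53..60}) M' M" "t' \<le> t + 22 * (L + 1) + 6 + (\<Sum>u=1..<u. c u)"
            using I tst inp unfolding I_def u_def by auto
          have uu: "u * u \<le> m" using mult_le_mono[OF F(8) F(8)] s2 by linarith
          show ?thesis
            apply simp
            apply (rule conjI)
            subgoal using F(8,9) by simp
            apply (rule wp_row[OF F(2,3,5,1,4,10) _ uu mz B])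
            subgoal using F(7) by simp
            subgoal premises q for M1 t1
            proof -
              have G: "M1 57 = u" "M1 56 = s + 1" "M1 55 = m" "M1 10 = 2" using q(2) F(1,4,5,6) by auto
              have s2: "Suc u < 2 ^ L" using F(8) sz P by linarith
              have fr: "agree_off ({10..17} \<union> {51} \<union> {53..60}) M1 M"
              proof (intro allI impI)
                fix i :: nat assume i: "i \<notin> {10..17} \<union> {51} \<union> {53..60}"
                then have "M1 i = M' i" using q(2) by auto
                also have "M' i = M i" using F(11) i by simp
                finally show "M1 i = M i" .
              qed
              have S: "(\<Sum>u=1..<Suc u. ?g u) = (\<Sum>u=1..<u. ?g u) + ?g u"
                and csum: "(\<Sum>u=1..<Suc u. c u) = (\<Sum>u=1..<u. c u) + c u"
                using F(7) by (simp_all only: sum.atLeastLessThan_Suc)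
              have sum: "M1 51 = (X + (\<Sum>u=1..<Suc u. ?g u)) mod 2"
                unfolding q(1) S by (simp only: add.assoc)
              have t1: "t1 + 1 \<le> t + 22 * (L + 1) + 6 + (\<Sum>u=1..<Suc u. c u)"
                unfolding csum c_def[of u] using q(3) F(12) by linarith
              show ?thesis
                apply (simp add: G s2)
                unfolding I_def
              proof (intro conjI)
                show "agree_off ({10..17} \<union> {51} \<union> {53..60}) (M1(57 := Suc u)) M"
                  using fr by auto
              qed (use F(7,8,9) G sum t1 in \<open>simp_all del: sum.op_ivl_Suc\<close>)
            qed
            done
        qed
        subgoal premises prems for k M' t'
        proof -
          have I: "I k M' t'" and tst: "\<not> test_op Less (val M' (R 57)) (val M' (R 56))" using prems by auto
          have eq: "M' 57 = s + 1" using I tst unfolding I_def by auto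
          have set: "{1..<s + 1} = {1..s}" by auto
          have I2: "M' 51 = (X + (\<Sum>u=1..<M' 57. ?g u)) mod 2"
            "t' \<le> t + 22 * (L + 1) + 6 + (\<Sum>u=1..<M' 57. c u)"
            "agree_off ({10..17} \<union> {51} \<union> {53..60}) M' M" using I unfolding I_def by blast+
          have "t' + 2 \<le> t + 22 * (L + 1) + 8 + (\<Sum>u=1..s. c u)"
            using I2(2) unfolding eq set by linarith
          then show ?thesis using I2(1,3) unfolding eq set c_def by (intro Q)
        qed
        done
    qed
    done
qed

text \<open>The tenth root of \<open>z ^ 3\<close> is z^(3/10), rounded down, in integer
  arithmetic.\<close>

definition triples_com :: com where
  "triples_com =
     Mov 10 (Const 10) ;; Asg 11 Mul (R 50) (R 50) ;; Asg 11 Mul (R 11) (R 50) ;; root_com ;; Mov 52 (R 12) ;;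
     small_com ;; large_com"

definition cost_triples :: "nat \<Rightarrow> nat \<Rightarrow> nat \<Rightarrow> nat" where
  "cost_triples L T z = (let F = nth_root_nat 10 (z ^ 3); m = z div F\<^sup>2 in
     76 * (L + 1) + 20 + (\<Sum>f=1..F. cost_pairs L T (z div f\<^sup>2) + 10) +
     (\<Sum>u=1..nth_root_nat 2 m. (m div u) * (22 * (L + 1) + 10) + 8))"

text \<open>The tenth power of the root is at most \<open>z ^ 3\<close>, hence at most
  \<open>z ^ 5\<close>. Thus \<open>z div f\<^sup>2\<close> stays positive for every
  \<open>f\<close> up to the cut, as \<open>wp_pairs\<close> demands.\<close>

lemma nth_root_10_cube_square_le: "(nth_root_nat 10 (z ^ 3))\<^sup>2 \<le> z"
proof (rule ccontr)
  let ?F = "nth_root_nat 10 (z ^ 3)"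
  assume "\<not> ?F\<^sup>2 \<le> z"
  then have "z ^ 5 < (?F\<^sup>2) ^ 5" by (intro power_strict_mono) auto
  also have "\<dots> = ?F ^ 10" by (simp add: power_mult[symmetric])
  also have "\<dots> \<le> z ^ 3" by (rule nth_root_nat_power_le) simp
  also have "\<dots> \<le> z ^ 5" by (cases "z = 0") (auto intro: power_increasing)
  finally show False by simp
qed

lemma wp_triples:
  assumes inp: "M 50 = z" "0 < z" and B: "(z + 2) ^ 4 < 2 ^ L" "12 < L"
    and T: "1 \<le> T" "\<And>n. 0 < n \<Longrightarrow> n \<le> 4097 * z \<Longrightarrow> card {d. d dvd n} \<le> T"
    and Q: "\<And>M' t'. M' 51 = triples z mod 2 \<Longrightarrow> agree_off ({10..49} \<union> {51..60}) M' M \<Longrightarrow>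
              t' \<le> t + cost_triples L T z \<Longrightarrow> Q M' t'"
  shows "wp (2 ^ L) triples_com Q M t"
proof -
  define F where "F = nth_root_nat 10 (z ^ 3)"
  note P = poly_bounds[OF B(1)]
  have F0: "0 < F" using nth_root_nat_ge_iff[of 10 1 "z ^ 3"] inp(2) unfolding F_def by simp
  have F2: "F\<^sup>2 \<le> z" unfolding F_def by (rule nth_root_10_cube_square_le)
  have z3: "2 * (z * z * z) + 2 < 2 ^ L" "z * z * z < 2 ^ L" "z * z < 2 ^ L" using P by linarith+
  have cL: "12 < (2::nat) ^ L" using power_increasing[of 4 L "2::nat"] B(2) by simp
  show ?thesis unfolding triples_com_def
    apply (simp add: inp z3)
    apply (rule wp_root[where k = 10 and y = "z * z * z"])
    subgoal by simp
    subgoal by simp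
    subgoal using cL by linarith
    subgoal by simp
    subgoal using z3 by simp
    subgoal premises p for M1 t1
    proof -
      have F: "M1 12 = F" "M1 50 = z" using p(1,2) inp(1) by (auto simp: F_def power3_eq_cube)
      show ?thesis
        apply simp
        apply (rule wp_small[where z = z and F = F and T = T])
        subgoal using F by simp
        subgoal using F by simp
        subgoal by (rule F2)
        subgoal by (rule B)
        subgoal by (rule B)
        subgoal by (rule T)
        subgoal by (rule T)
        subgoal premises q for M2 t2
        proof -
          have G: "M2 50 = z" "M2 52 = F" using q(2) F by auto
          have fr: "agree_off ({10..49} \<union> {51..60}) M2 M"
          proof (intro allI impI)
            fix i :: nat assume i: "i \<notin> {10..49} \<union> {51..60}"
            then have "M2 i = (M1(52 := M1 12)) i" using q(2) by auto
            also have "\<dots> = M1 i" using i by auto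
            also have "\<dots> = M i" using p(2) i by auto
            finally show "M2 i = M i" .
          qed
          show ?thesis
          proof (rule wp_large[OF G q(1) F2 F0 B(1)], rule Q)
            fix M3 t3
            assume r: "M3 51 = ((\<Sum>f=1..F. pairs (z div f\<^sup>2)) +
                (\<Sum>u=1..nth_root_nat 2 (z div F\<^sup>2). \<Sum>v\<in>{u<..z div F\<^sup>2 div u}. nth_root_nat 2 (z div (u * v)) - F)) mod 2"
              "agree_off ({10..17} \<union> {51} \<union> {53..60}) M3 M2"
              "t3 \<le> t2 + 22 * (L + 1) + 8 + (\<Sum>u=1..nth_root_nat 2 (z div F\<^sup>2). (z div F\<^sup>2 div u) * (22 * (L + 1) + 10) + 8)"
            show "M3 51 = triples z mod 2" unfolding r(1) triples_split[OF F0] ..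
            show "agree_off ({10..49} \<union> {51..60}) M3 M"
            proof (intro allI impI)
              fix i :: nat assume i: "i \<notin> {10..49} \<union> {51..60}"
              then have "M3 i = M2 i" using r(2) by auto
              also have "\<dots> = M i" using fr i by blast
              finally show "M3 i = M i" .
            qed
            show "t3 \<le> t + cost_triples L T z"
            proof -
              define W where "W = L + 1"
              have "t1 \<le> t + 3 + 54 * W" using p(3) unfolding W_def by simp
              moreover have "t2 \<le> t1 + 6 + (\<Sum>f=1..F. cost_pairs L T (z div f\<^sup>2) + 10)" using q(3) by linarith
              ultimately show ?thesis
                using r(3) unfolding cost_triples_def Let_def F_def[symmetric] W_def[symmetric] by linarith
            qed
          qed
        qed
        done
    qed
    done
qed

subsection \<open>Counting prime powers and primes modulo two\<close>

text \<open>\<open>Mov 81 (R 81)\<close> takes the place of an empty statement. Cell 83 follows the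
  fourth power of cell 82, and \<open>y + 1\<close> in cell 84 makes the strict test include
  \<open>y\<close>.\<close>

definition primepow_com :: com where
  "primepow_com =
     Mov 81 (Const 0) ;; Mov 82 (Const 1) ;; Mov 83 (Const 1) ;; Asg 84 Add (R 80) (Const 1) ;;
     While Less (R 83) (R 84)
      (Mov 65 (R 82) ;; squarefree_com ;;
       Cond Equal (R 66) (Const 1)
        (Asg 50 Div (R 80) (R 83) ;; triples_com ;; Asg 81 Add (R 81) (R 51) ;; Asg 81 Mod (R 81) (Const 2))
        (Mov 81 (R 81)) ;;
       Asg 82 Add (R 82) (Const 1) ;; Asg 83 Mul (R 82) (R 82) ;; Asg 83 Mul (R 83) (R 83))"

definition cost_primepow :: "nat \<Rightarrow> nat \<Rightarrow> nat \<Rightarrow> nat" where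
  "cost_primepow L T y =
     10 + (\<Sum>g=1..nth_root_nat 4 y. cost_triples L T (y div g ^ 4) + 8 * nth_root_nat 2 g + 30)"

lemma wp_primepow:
  assumes inp: "M 80 = y" "0 < y" and B: "(y + 2) ^ 4 < 2 ^ L" "12 < L"
    and T: "1 \<le> T" "\<And>n. 0 < n \<Longrightarrow> n \<le> 4097 * y \<Longrightarrow> card {d. d dvd n} \<le> T"
    and Q: "\<And>M' t'. M' 81 = card {n. n \<le> y \<and> primepow n} mod 2 \<Longrightarrow>
              agree_off ({10..70} \<union> {81..84}) M' M \<Longrightarrow>
              t' \<le> t + cost_primepow L T y \<Longrightarrow> Q M' t'"
  shows "wp (2 ^ L) primepow_com Q M t"
proof -
  define G where "G = nth_root_nat 4 y"
  let ?s = "\<lambda>g. if squarefree g then triples (y div g ^ 4) else 0"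
  define c where "c g = cost_triples L T (y div g ^ 4) + 8 * nth_root_nat 2 g + 30" for g
  define I where "I = (\<lambda>k M' t'. 1 \<le> M' 82 \<and> M' 82 \<le> G + 1 \<and> k = G + 1 - M' 82 \<and> M' 83 = M' 82 ^ 4 \<and> M' 84 = y + 1 \<and>
    M' 81 = (\<Sum>g=1..<M' 82. ?s g) mod 2 \<and> agree_off ({10..70} \<union> {81..84}) M' M \<and>
    t' \<le> t + 4 + (\<Sum>g=1..<M' 82. c g))"
  note P = poly_bounds[OF B(1)]
  \<comment> \<open>The next fourth power is bounded by a linear term in \<open>y\<close> with a
    larger coefficient than \<open>poly_bounds\<close> provides.\<close>
  have P2: "32 * y + 16 < 2 ^ L"
  proof -
    have "(y + 2) ^ 4 = y * y * y * y + 8 * (y * y * y) + 24 * (y * y) + 32 * y + 16"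
      by (simp add: eval_nat_numeral algebra_simps)
    then show ?thesis using B(1) by linarith
  qed
  have sy: "Suc y < 2 ^ L" using P by linarith
  have res: "(\<Sum>g=1..G. ?s g) mod 2 = card {n. n \<le> y \<and> primepow n} mod 2"
  proof -
    have eq: "{g. squarefree g \<and> g ^ 4 \<le> y} = {g \<in> {1..G}. squarefree g}"
      unfolding G_def using squarefree_pos by (auto simp: nth_root_nat_ge_iff Suc_le_eq)
    have "(\<Sum>g=1..G. ?s g) = (\<Sum>g | squarefree g \<and> g ^ 4 \<le> y. triples (y div g ^ 4))"
      unfolding eq by (rule sum.inter_filter[symmetric]) simp
    then show ?thesis using odd_sum_triples[of y] by (simp add: mod_2_eq_odd)
  qed
  show ?thesis unfolding primepow_com_def
    apply (simp add: inp(1) sy)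
    apply (rule wp_While[where I = I and k = G])
    subgoal using inp by (simp add: I_def)
    subgoal premises prems for k M' t'
    proof -
      have I: "I k M' t'" and tst: "test_op Less (val M' (R 83)) (val M' (R 84))" using prems by auto
      define g where "g = M' 82"
      have F: "M' 82 = g" "M' 83 = g ^ 4" "M' 80 = y" "M' 84 = y + 1" "1 \<le> g" "g \<le> G + 1" "k = G + 1 - g" "M' 81 \<le> 1"
        "M' 81 = (\<Sum>g=1..<g. ?s g) mod 2" "g ^ 4 \<le> y"
        "agree_off ({10..70} \<union> {81..84}) M' M" "t' \<le> t + 4 + (\<Sum>g=1..<g. c g)"
        using I tst inp unfolding I_def g_def by auto
      have gG: "g \<le> G" using F(10) unfolding G_def by (simp add: nth_root_nat_ge_iff)
      have gy: "g \<le> y" using F(5,10) self_le_power[of g 4] by linarith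
      have k: "0 < k" using F(7) gG by simp
      have z: "0 < y div g ^ 4" "y div g ^ 4 \<le> y" using F(5,10) by (auto simp: div_greater_zero_iff)
      \<comment> \<open>The body forms the next fourth power before the test can reject it, so
        \<open>g + 1\<close> has to fit as well.\<close>
      have "(g + 1) ^ 4 \<le> (2 * g) ^ 4" using F(5) by (intro power_mono) auto
      then have g4: "(g + 1) ^ 4 \<le> 16 * y" using F(10) by (simp add: power_mult_distrib)
      have g2: "(g + 1) * (g + 1) \<le> (g + 1) ^ 4" using power_increasing[of 2 4 "g + 1"] by (simp add: power2_eq_square)
      have g44: "(g + 1) * (g + 1) * ((g + 1) * (g + 1)) = (g + 1) ^ 4"
        by (simp only: power4_eq_xxxx mult.assoc)
      have gB: "Suc g < 2 ^ L" "Suc g * Suc g < 2 ^ L" "Suc g * Suc g * (Suc g * Suc g) < 2 ^ L"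
        "Suc g * Suc g * (Suc g * Suc g) = Suc g ^ 4"
        using g2 g4 g44 gy P2 unfolding Suc_eq_plus1 by linarith+
      have csum: "(\<Sum>g=1..<Suc g. c g) = (\<Sum>g=1..<g. c g) + c g"
        and ssum: "(\<Sum>g=1..<Suc g. ?s g) = (\<Sum>g=1..<g. ?s g) + ?s g" using F(5) by simp_all
      have fin: "I (k - 1) (M''(82 := Suc g, 83 := Suc g ^ 4)) t''"
        if "M'' 81 = (\<Sum>g=1..<Suc g. ?s g) mod 2" "agree_off ({10..70} \<union> {81..84}) M'' M'"
           "M'' 84 = y + 1" "t'' \<le> t' + c g" for M'' t''
        unfolding I_def
      proof (intro conjI)
        show "agree_off ({10..70} \<union> {81..84}) (M''(82 := Suc g, 83 := Suc g ^ 4)) M"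
        proof (intro allI impI)
          fix i :: nat assume i: "i \<notin> {10..70} \<union> {81..84}"
          then have "M'' i = M' i" using that(2) by simp
          also have "M' i = M i" using F(11) i by simp
          finally have "M'' i = M i" .
          then show "(M''(82 := Suc g, 83 := Suc g ^ 4)) i = M i" using i by auto
        qed
        show "t'' \<le> t + 4 + (\<Sum>g=1..<(M''(82 := Suc g, 83 := Suc g ^ 4)) 82. c g)"
          using that(4) F(12) csum by simp
      qed (use that F gG k in auto)
      show ?thesis using k
        apply simp
        apply (rule wp_squarefree[where g = g])
        subgoal using F by simp
        subgoal using F by simp
        subgoal using gy P2 by linarith
        subgoal premises p for M1 t1
        proof -
          have G1: "M1 82 = g" "M1 83 = g ^ 4" "M1 80 = y" "M1 81 = M' 81" "M1 84 = y + 1" using p(3) F by auto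
          show ?thesis
          proof (cases "squarefree g")
            case False
            have "I (k - 1) (M1(81 := M' 81, 82 := Suc g, 83 := Suc g ^ 4)) (Suc (Suc (Suc (Suc (Suc (Suc t1))))))"
            proof (rule fin)
              show "(M1(81 := M' 81)) 81 = (\<Sum>g=1..<Suc g. ?s g) mod 2" using ssum F(9) False by simp
              show "agree_off ({10..70} \<union> {81..84}) (M1(81 := M' 81)) M'"
                using p(3) by auto
            qed (use G1 p(4) in \<open>auto simp: c_def\<close>)
            then show ?thesis using p(2) False G1 gB by (simp add: fun_upd_twist)
          next
            case True
            show ?thesis
              apply (simp add: p(2) True G1)
              apply (rule wp_triples[where z = "y div g ^ 4" and T = T])
              subgoal by simp
              subgoal by (rule z)
              subgoal by (rule le_less_trans[OF power_mono B(1)]) (use z(2) in simp_all)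
              subgoal by (rule B)
              subgoal by (rule T)
              subgoal for n using mult_le_mono2[OF z(2), of 4097] by (intro T) linarith+
              subgoal premises q for M2 t2
              proof -
                have H: "M2 82 = g" "M2 81 = M' 81" "M2 84 = y + 1" using q(2) G1 by auto
                have s1: "M' 81 + triples (y div g ^ 4) mod 2 < 2 ^ L"
                proof -
                  have "M' 81 + triples (y div g ^ 4) mod 2 \<le> 2" using F(8) by simp
                  then show ?thesis using P by linarith
                qed
                let ?v = "(M' 81 + triples (y div g ^ 4) mod 2) mod 2"
                have "I (k - 1) (M2(81 := ?v, 82 := Suc g, 83 := Suc g ^ 4)) (Suc (Suc (Suc (Suc (Suc t2)))))"
                proof (rule fin)
                  show "(M2(81 := ?v)) 81 = (\<Sum>g=1..<Suc g. ?s g) mod 2"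
                    unfolding ssum F(9) using True by (simp add: mod_simps)
                  show "agree_off ({10..70} \<union> {81..84}) (M2(81 := ?v)) M'"
                  proof (intro allI impI)
                    fix i :: nat assume i: "i \<notin> {10..70} \<union> {81..84}"
                    then have "M2 i = (M1(50 := y div g ^ 4)) i" using q(2) by auto
                    also have "\<dots> = M1 i" using i by auto
                    also have "\<dots> = M' i" using p(3) i by auto
                    finally show "(M2(81 := ?v)) i = M' i" using i by auto
                  qed
                qed (use H p(4) q(3) in \<open>auto simp: c_def\<close>)
                then show ?thesis using H q(1) s1 gB by simp
              qed
              done
          qed
        qed
        done
    qed
    subgoal premises prems for k M' t'
    proof -
      have I: "I k M' t'" and tst: "\<not> test_op Less (val M' (R 83)) (val M' (R 84))" using prems by auto
      have "\<not> M' 82 \<le> G" unfolding G_def using I tst by (auto simp: nth_root_nat_ge_iff I_def)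
      then have eq: "M' 82 = G + 1" using I unfolding I_def by simp
      have set: "{1..<G + 1} = {1..G}" by auto
      have I2: "M' 81 = (\<Sum>g=1..<M' 82. ?s g) mod 2" "t' \<le> t + 4 + (\<Sum>g=1..<M' 82. c g)"
        "agree_off ({10..70} \<union> {81..84}) M' M" using I unfolding I_def by blast+
      have "t' + 2 \<le> t + cost_primepow L T y"
        using I2(2) unfolding eq set cost_primepow_def G_def[symmetric] c_def[symmetric] by linarith
      then show ?thesis using I2(1,3) unfolding eq set res by (intro Q)
    qed
    done
qed

section \<open>Programs for primes and for the parity in an interval\<close>

definition prime_com :: com where
  "prime_com =
     Mov 91 (Const 0) ;; Mov 92 (Const 1) ;; Mov 10 (Const 1) ;; Mov 11 (R 90) ;; root_com ;;
     While Less (Const 1) (R 12)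
      (Mov 80 (R 12) ;; Mov 65 (R 92) ;; squarefree_com ;;
       Cond Equal (R 66) (Const 1)
        (primepow_com ;; Asg 91 Add (R 91) (R 81) ;; Asg 91 Mod (R 91) (Const 2))
        (Mov 91 (R 91)) ;;
       Asg 92 Add (R 92) (Const 1) ;; Mov 10 (R 92) ;; Mov 11 (R 90) ;; root_com)"

text \<open>The loop runs through the exponents \<open>k\<close> whose \<open>k\<close>-th root of
  \<open>y\<close> is at least 2. There are fewer than \<open>L\<close> of them, as
  \<open>2 ^ k \<le> y < 2 ^ L\<close>, and each squarefree one calls \<open>primepow_com\<close> on
  a root \<open>r \<le> y\<close>, so one bound \<open>C\<close> serves all calls.\<close>

lemma wp_prime:
  assumes inp: "M 90 = y" and B: "(y + 2) ^ 4 < 2 ^ L" "12 < L"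
    and T: "1 \<le> T" "\<And>n. 0 < n \<Longrightarrow> n \<le> 4097 * y \<Longrightarrow> card {d. d dvd n} \<le> T"
    and C: "\<And>r. 0 < r \<Longrightarrow> r \<le> y \<Longrightarrow> cost_primepow L T r \<le> C"
    and Q: "\<And>M' t'. M' 91 = card {p. p \<le> y \<and> prime p} mod 2 \<Longrightarrow>
              agree_off {10..92} M' M \<Longrightarrow>
              t' \<le> t + (L + 1) * (C + (4 * L + 14) * (L + 1) + 8 * L + 30) \<Longrightarrow> Q M' t'"
  shows "wp (2 ^ L) prime_com Q M t"
proof -
  let ?s = "\<lambda>k. if squarefree k then card {r. r \<le> nth_root_nat k y \<and> primepow r} else 0"
  define c where "c = C + (4 * L + 14) * (L + 1) + 8 * L + 30"
  \<comment> \<open>The disjunction remembers that the previous exponent passed the test; for the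
    first exponent there is none, and \<open>y\<close> may even be 0. At the exit it shows that the
    exponents visited are exactly those with \<open>2 ^ k \<le> y\<close>.\<close>
  define I where "I = (\<lambda>n M' t'. 1 \<le> M' 92 \<and> n = L - M' 92 \<and> M' 12 = nth_root_nat (M' 92) y \<and> M' 90 = y \<and>
    (M' 92 = 1 \<or> 2 ^ (M' 92 - 1) \<le> y) \<and> M' 92 \<le> L \<and>
    M' 91 = (\<Sum>k=1..<M' 92. ?s k) mod 2 \<and> agree_off {10..92} M' M \<and>
    t' \<le> t + M' 92 * c)"
  note P = poly_bounds[OF B(1)]
  have yL: "y < 2 ^ L" using P by linarith
  have cL: "12 < (2::nat) ^ L" using power_increasing[of 4 L "2::nat"] B(2) by simp
  have L2: "Suc L \<le> 2 ^ L" using less_exp[of L] by (rule Suc_leI)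
  show ?thesis unfolding prime_com_def
    apply (simp add: inp)
    apply (rule wp_root[where k = 1 and y = y])
    subgoal by simp
    subgoal by simp
    subgoal using cL by linarith
    subgoal by simp
    subgoal using P by linarith
    subgoal premises p for M0 t0
      apply (rule wp_While[where I = I and k = "L - 1"])
      subgoal
        unfolding I_def
      proof (intro conjI)
        have t0: "t0 \<le> t + 4 + 18 * (L + 1)" using p(3) by simp
        have "18 * (L + 1) \<le> (4 * L + 14) * (L + 1)" using B(2) by (intro mult_le_mono1) simp
        then show "t0 \<le> t + M0 92 * c" using p(2) t0 unfolding c_def by simp
        show "agree_off {10..92} M0 M" using p(2) by auto
      qed (use p(1,2) inp B(2) in auto)
      subgoal premises prems for n M' t'
      proof -
        have I: "I n M' t'" and tst: "test_op Less (val M' (Const (Suc 0))) (val M' (R 12))" using prems by auto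
        define k where "k = M' 92"
        define r where "r = nth_root_nat k y"
        have F: "M' 92 = k" "M' 12 = r" "M' 90 = y" "1 \<le> k" "n = L - k" "1 < r" "M' 91 \<le> 1"
          "M' 91 = (\<Sum>k=1..<k. ?s k) mod 2" "agree_off {10..92} M' M" "t' \<le> t + k * c"
          using I tst unfolding I_def k_def r_def by auto
        have "2 \<le> nth_root_nat k y" using F(6) unfolding r_def by simp
        then have k2: "2 ^ k \<le> y" using F(4) by (simp add: nth_root_nat_ge_iff)
        then have "(2::nat) ^ k < 2 ^ L" using yL by (rule le_less_trans)
        then have kL: "k < L" by simp
        have ky: "k < y" using k2 less_exp[of k] by linarith
        have n: "0 < n" using F kL by simp
        have ry: "r \<le> y" unfolding r_def using F(4) by (intro nth_root_nat_le_self) simp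
        have sk: "Suc k < 2 ^ L" using kL L2 by linarith
        have ssum: "(\<Sum>k=1..<Suc k. ?s k) = (\<Sum>k=1..<k. ?s k) + ?s k" using F(4) by simp
        have fin: "wp (2 ^ L) root_com (I (n - 1)) (M''(92 := Suc k, 10 := Suc k, 11 := y)) t''"
          if "M'' 91 = (\<Sum>k=1..<Suc k. ?s k) mod 2" "agree_off {10..92} M'' M'"
             "M'' 90 = y" "t'' \<le> t' + C + 8 * L + 30" for M'' t''
        proof (rule wp_root[where k = "Suc k" and y = y])
          fix M3 t3
          assume r: "M3 12 = nth_root_nat (Suc k) y"
            "agree_off {12..17} M3 (M''(92 := Suc k, 10 := Suc k, 11 := y))"
            "t3 \<le> t'' + (4 * Suc k + 14) * (L + 1)"
          have G: "M3 92 = Suc k" "M3 90 = y" "M3 91 = M'' 91" using r(2) that(3) by auto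
          show "I (n - 1) M3 t3" unfolding I_def
          proof (intro conjI)
            show "agree_off {10..92} M3 M"
            proof (intro allI impI)
              fix i :: nat assume i: "i \<notin> {10..92}"
              then have "M3 i = M'' i" using r(2) by auto
              also have "\<dots> = M' i" using that(2) i by simp
              also have "\<dots> = M i" using F(9) i by simp
              finally show "M3 i = M i" .
            qed
            have "(4 * Suc k + 14) * (L + 1) \<le> (4 * L + 14) * (L + 1)" using kL by (intro mult_le_mono1) simp
            then show "t3 \<le> t + M3 92 * c" using r(3) that(4) F(10) G unfolding c_def by simp
          qed (use G r(1) that(1) F kL k2 in auto)
        qed (use sk P in auto)
        have sqk: "8 * nth_root_nat 2 k \<le> 8 * L"
        proof -
          have "nth_root_nat 2 k \<le> k" by (rule nth_root_nat_le_self) simp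
          then show ?thesis using kL by simp
        qed
        show ?thesis using n
          apply simp
          apply (rule wp_squarefree[where g = k])
          subgoal using F by simp
          subgoal using F by simp
          subgoal using ky P by linarith
          subgoal premises p for M1 t1
          proof -
            have G1: "M1 92 = k" "M1 80 = r" "M1 90 = y" "M1 91 = M' 91" using p(3) F by auto
            have fr1: "agree_off {10..92} M1 M'" using p(3) by auto
            show ?thesis
            proof (cases "squarefree k")
              case False
              have "wp (2 ^ L) root_com (I (n - 1)) (M1(91 := M' 91, 92 := Suc k, 10 := Suc k, 11 := y)) (Suc (Suc (Suc (Suc (Suc (Suc t1))))))"
              proof (rule fin)
                show "(M1(91 := M' 91)) 91 = (\<Sum>k=1..<Suc k. ?s k) mod 2" using ssum F(8) False by simp
                show "agree_off {10..92} (M1(91 := M' 91)) M'" using fr1 by auto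
              qed (use G1 p(4) sqk in auto)
              then show ?thesis using p(2) False G1 sk by simp
            next
              case True
              show ?thesis
                apply (simp add: p(2) True G1)
                apply (rule wp_primepow[where y = r and T = T])
                subgoal using G1 by simp
                subgoal using F by simp
                subgoal by (rule le_less_trans[OF power_mono B(1)]) (use ry in simp_all)
                subgoal by (rule B)
                subgoal by (rule T)
                subgoal for n using mult_le_mono2[OF ry, of 4097] by (intro T) linarith+
                subgoal premises q for M2 t2
                proof -
                  let ?N = "card {n. n \<le> r \<and> primepow n}"
                  have H: "M2 92 = k" "M2 90 = y" "M2 91 = M' 91" using q(2) G1 by auto
                  have s1: "M' 91 + ?N mod 2 < 2 ^ L"
                  proof -
                    have "M' 91 + ?N mod 2 \<le> 2" using F(7) by simp
                    then show ?thesis using P by linarith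
                  qed
                  let ?v = "(M' 91 + ?N mod 2) mod 2"
                  have "wp (2 ^ L) root_com (I (n - 1)) (M2(91 := ?v, 92 := Suc k, 10 := Suc k, 11 := y)) (Suc (Suc (Suc (Suc (Suc t2)))))"
                  proof (rule fin)
                    show "(M2(91 := ?v)) 91 = (\<Sum>k=1..<Suc k. ?s k) mod 2"
                      unfolding ssum F(8) using True by (simp add: mod_simps r_def)
                    show "agree_off {10..92} (M2(91 := ?v)) M'"
                    proof (intro allI impI)
                      fix i :: nat assume i: "i \<notin> {10..92}"
                      then have "M2 i = M1 i" using q(2) by auto
                      also have "\<dots> = M' i" using fr1 i by simp
                      finally show "(M2(91 := ?v)) i = M' i" using i by auto
                    qed
                    have "cost_primepow L T r \<le> C" using F(6) ry by (intro C) auto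
                    then show "Suc (Suc (Suc (Suc (Suc t2)))) \<le> t' + C + 8 * L + 30" using q(3) p(4) sqk by simp
                  qed (use H in auto)
                  then show ?thesis using H q(1) s1 sk by simp
                qed
                done
            qed
          qed
          done
      qed
      subgoal premises prems for n M' t'
      proof -
        have I: "I n M' t'" and tst: "\<not> test_op Less (val M' (Const (Suc 0))) (val M' (R 12))" using prems by auto
        define k where "k = M' 92"
        have F: "M' 12 = nth_root_nat k y" "1 \<le> k" "k = 1 \<or> 2 ^ (k - 1) \<le> y" "k \<le> L"
          "M' 91 = (\<Sum>k=1..<k. ?s k) mod 2" "t' \<le> t + k * c"
          using I unfolding I_def k_def by auto
        have "\<not> 2 \<le> nth_root_nat k y" using tst F(1) by simp
        then have yk: "y < 2 ^ k" using F(2) by (simp add: nth_root_nat_ge_iff)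
        have eq: "{k. squarefree k \<and> 2 ^ k \<le> y} = {j \<in> {1..<k}. squarefree j}"
        proof (intro equalityI subsetI)
          fix j assume j: "j \<in> {k. squarefree k \<and> 2 ^ k \<le> y}"
          then have "2 ^ j \<le> y" by simp
          then have "(2::nat) ^ j < 2 ^ k" using yk by (rule le_less_trans)
          then have "j < k" by simp
          then show "j \<in> {j \<in> {1..<k}. squarefree j}" using j squarefree_pos[of j] by simp
        next
          fix j assume j: "j \<in> {j \<in> {1..<k}. squarefree j}"
          then have "(2::nat) ^ j \<le> 2 ^ (k - 1)" by (intro power_increasing) auto
          moreover have "k \<noteq> 1" using j by auto
          ultimately have "2 ^ j \<le> y" using F(3) by linarith
          then show "j \<in> {k. squarefree k \<and> 2 ^ k \<le> y}" using j by simp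
        qed
        have "(\<Sum>k=1..<k. ?s k) = (\<Sum>k | squarefree k \<and> 2 ^ k \<le> y. card {r. r \<le> nth_root_nat k y \<and> primepow r})"
          unfolding eq by (rule sum.inter_filter[symmetric]) simp
        then have "M' 91 = card {p. p \<le> y \<and> prime p} mod 2"
          unfolding F(5) using odd_sum_primepows[of y] by (simp add: mod_2_eq_odd)
        moreover have "t' + 2 \<le> t + (L + 1) * c"
        proof -
          have "k * c \<le> L * c" using F(4) by (intro mult_le_mono1)
          moreover have "2 \<le> c" unfolding c_def by simp
          ultimately show ?thesis using F(6) unfolding add_mult_distrib mult_1 by linarith
        qed
        moreover have "agree_off {10..92} M' M" using I unfolding I_def by blast
        ultimately show ?thesis unfolding c_def by (intro Q)
      qed
      done
    done
qed

text \<open>\<open>prime_com\<close> touches only the cells from 10 to 92, so the input in cells 0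
  and 1 and the first count in cell 3 survive the calls.\<close>

definition parity_com :: com where
  "parity_com =
     Mov 90 (R 1) ;; prime_com ;; Mov 3 (R 91) ;;
     Asg 90 Sub (R 0) (Const 1) ;; prime_com ;;
     Asg 0 Add (R 3) (R 91) ;; Asg 0 Mod (R 0) (Const 2)"

lemma wp_parity:
  fixes a b :: nat
  assumes inp: "M 0 = a" "M 1 = b" and y: "a - 1 \<le> y" "b \<le> y" and B: "(y + 2) ^ 4 < 2 ^ L" "12 < L"
    and T: "1 \<le> T" "\<And>n. 0 < n \<Longrightarrow> n \<le> 4097 * y \<Longrightarrow> card {d. d dvd n} \<le> T"
    and C: "\<And>r. 0 < r \<Longrightarrow> r \<le> y \<Longrightarrow> cost_primepow L T r \<le> C"
  shows "wp (2 ^ L) parity_com (\<lambda>M' t'.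
     M' 0 = (card {p. p \<le> b \<and> prime p} + card {p. p \<le> a - 1 \<and> prime p}) mod 2 \<and>
     t' \<le> 10 + 2 * ((L + 1) * (C + (4 * L + 14) * (L + 1) + 8 * L + 30))) M 0"
proof -
  have B': "(z + 2) ^ 4 < 2 ^ L" if "z \<le> y" for z
    by (rule le_less_trans[OF power_mono B(1)]) (use that in simp_all)
  have L2: "2 < (2::nat) ^ L" using power_increasing[of 2 L "2::nat"] B(2) by simp
  show ?thesis unfolding parity_com_def
    apply (simp add: inp del: One_nat_def)
    apply (rule wp_prime[where y = b and T = T and C = C])
    subgoal by simp
    subgoal using B'[OF y(2)] .
    subgoal by (rule B)
    subgoal by (rule T)
    subgoal for n using mult_le_mono2[OF y(2), of 4097] by (intro T) linarith+
    subgoal using y by (intro C) auto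
    subgoal premises p for M1 t1
    proof -
      have F: "M1 0 = a" using p(2) inp by auto
      show ?thesis
        apply (simp add: F p(1) del: One_nat_def)
        apply (rule wp_prime[where y = "a - 1" and T = T and C = C])
        subgoal by simp
        subgoal using B'[OF y(1)] .
        subgoal by (rule B)
        subgoal by (rule T)
        subgoal for n using mult_le_mono2[OF y(1), of 4097] by (intro T) linarith+
        subgoal using y by (intro C) auto
        subgoal premises q for M2 t2
        proof -
          have G: "M2 3 = card {p. p \<le> b \<and> prime p} mod 2" using q(2) by auto
          have "card {p. p \<le> b \<and> prime p} mod 2 + card {p. p \<le> a - 1 \<and> prime p} mod 2 \<le> 2" by simp
          then have "card {p. p \<le> b \<and> prime p} mod 2 + card {p. p \<le> a - 1 \<and> prime p} mod 2 < 2 ^ L" using L2 by linarith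
          then show ?thesis using p(3) q(3) by (simp add: G q(1) mod_simps del: One_nat_def)
        qed
        done
    qed
    done
qed

lemma com_below_parity: "com_below 100 parity_com"
  by (simp add: parity_com_def prime_com_def primepow_com_def triples_com_def small_com_def large_com_def row_com_def
      pairs_com_def block_loop_com_def block_com_def sum_div_com_def squarefree_com_def floor_sum_com_def root_com_def)

subsection \<open>Asymptotics of the running time\<close>

text \<open>Telescoping: if \<open>s\<close> and \<open>t\<close> are the sixth roots of
  \<open>n\<close> and \<open>n + 1\<close>, then
  \<open>1 = t ^ 6 - s ^ 6 \<le> 6 * (t - s) * t ^ 5\<close>. The exponent is the one that
  \<open>f\<close> has in \<open>(z / f\<^sup>2) powr (5 / 12)\<close>.\<close>

lemma sum_powr_le: "(\<Sum>f=1..n. real f powr (- 5 / 6)) \<le> 6 * real n powr (1 / 6)"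
proof (induction n)
  case (Suc n)
  define s where "s = real n powr (1 / 6)"
  define t where "t = real (Suc n) powr (1 / 6)"
  have st: "0 \<le> s" "s \<le> t" "0 < t" unfolding s_def t_def by (auto intro: powr_mono2)
  have s6: "s ^ 6 = real n"
    unfolding s_def by (cases "n = 0") (auto simp: powr_power)
  have t6: "t ^ 6 = real n + 1" unfolding t_def by (simp add: powr_power)
  have t5: "t ^ 5 = real (Suc n) powr (5 / 6)" unfolding t_def by (simp add: powr_power)
  have "t ^ 6 - s ^ 6 = (t - s) * (\<Sum>i<6. t ^ i * s ^ (5 - i))"
    using diff_power_eq_sum[of t 5 s] by simp
  also have "\<dots> \<le> (t - s) * (\<Sum>i<(6::nat). t ^ 5)"
  proof (intro mult_left_mono sum_mono)
    fix i assume i: "i \<in> {..<(6::nat)}"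
    have "t ^ i * s ^ (5 - i) \<le> t ^ i * t ^ (5 - i)"
      using st by (intro mult_left_mono power_mono) auto
    also have "\<dots> = t ^ 5" using i by (simp add: power_add[symmetric])
    finally show "t ^ i * s ^ (5 - i) \<le> t ^ 5" .
  qed (use st in auto)
  finally have "1 \<le> (t - s) * (6 * t ^ 5)" unfolding s6 t6 by simp
  also have "\<dots> = 6 * (t - s) * t ^ 5" by (simp only: mult.assoc mult.left_commute)
  finally have "1 \<le> 6 * (t - s) * t ^ 5" .
  then have "1 / t ^ 5 \<le> 6 * (t - s)" unfolding pos_divide_le_eq[OF zero_less_power[OF st(3)]] .
  moreover have "real (Suc n) powr (- 5 / 6) = 1 / t ^ 5"
    unfolding t5 using powr_minus_divide[of "real (Suc n)" "5 / 6"] by simp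
  ultimately have "real (Suc n) powr (- 5 / 6) \<le> 6 * t - 6 * s" by simp
  then show ?case using Suc.IH unfolding s_def[symmetric] t_def[symmetric] by simp
qed simp

lemma power_powr: "0 < x \<Longrightarrow> (x ^ n) powr a = x powr (real n * a)" for x a :: real
  by (simp only: powr_realpow[symmetric] powr_powr)

lemma nth_root_nat_le_powr:
  assumes "0 < k"
  shows "real (nth_root_nat k n) \<le> real n powr (1 / real k)"
proof -
  define r where "r = nth_root_nat k n"
  have "r ^ k \<le> n" unfolding r_def using assms by (rule nth_root_nat_power_le)
  then have "real (r ^ k) \<le> real n" by (simp only: of_nat_le_iff)
  then have "real r ^ k \<le> real n" by simp
  then have "(real r ^ k) powr (1 / real k) \<le> real n powr (1 / real k)" by (intro powr_mono2) auto
  moreover have "(real r ^ k) powr (1 / real k) = real r"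
  proof (cases "r = 0")
    case False
    then show ?thesis using assms by (simp add: power_powr)
  qed (use assms in simp)
  ultimately show ?thesis unfolding r_def by simp
qed

lemma cost_pairs_le:
  "real (cost_pairs L T w) \<le> 100000 * real ((L + 3) * T) * real w powr (5 / 12)"
proof (cases "w = 0")
  case True
  then show ?thesis by (simp add: cost_pairs_def)
next
  case False
  define h where "h = nth_root_nat 12 w"
  have "real h \<le> real w powr (1 / 12)" unfolding h_def using nth_root_nat_le_powr[of 12 w] by simp
  then have "real h ^ 5 \<le> (real w powr (1 / 12)) ^ 5" by (intro power_mono) auto
  also have "\<dots> = real w powr (5 / 12)" using False by (simp add: powr_power)
  finally have "100000 * real ((L + 3) * T) * real h ^ 5 \<le> 100000 * real ((L + 3) * T) * real w powr (5 / 12)"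
    by (intro mult_left_mono) auto
  moreover have "real (cost_pairs L T w) = 100000 * real ((L + 3) * T) * real h ^ 5"
    unfolding cost_pairs_def h_def by simp
  ultimately show ?thesis by simp
qed

lemma real_div_powr_le:
  assumes "0 \<le> e"
  shows "real (a div b) powr e \<le> real a powr e * real b powr (- e)"
proof (cases "b = 0")
  case False
  have "real (a div b) powr e \<le> (real a / real b) powr e"
    using assms by (intro powr_mono2 of_nat_div_le_of_nat) auto
  also have "\<dots> = real a powr e * real b powr (- e)"
    using False by (simp add: powr_divide powr_minus_divide)
  finally show ?thesis .
qed simp

text \<open>With \<open>F\<close> about z^(3/10), the small part costs z^(5/12) F^(1/6) = z^(5/12 +
  1/20), and the large part is bounded by m^(7/6) for \<open>m\<close> about z^(2/5). Both exponents
  are 7/15.\<close>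

lemma cost_triples_le:
  assumes z: "0 < z" and T: "1 \<le> T"
  shows "real (cost_triples L T z) \<le> 700000 * real ((L + 3) * T) * real z powr (7 / 15)"
proof -
  define S where "S = real ((L + 3) * T)"
  define F where "F = nth_root_nat 10 (z ^ 3)"
  define m where "m = z div F\<^sup>2"
  define s where "s = nth_root_nat 2 m"
  define Z where "Z = real z powr (7 / 15)"
  have "L + 3 \<le> (L + 3) * T" using T by simp
  then have S: "real L + 3 \<le> S" unfolding S_def by linarith
  have Z1: "1 \<le> Z" unfolding Z_def using z by (simp add: ge_one_powr_ge_zero)
  have S0: "0 \<le> S" "1 \<le> S" using S by linarith+
  have F0: "0 < F" using nth_root_nat_ge_iff[of 10 1 "z ^ 3"] z unfolding F_def by simp
  have F2: "F\<^sup>2 \<le> z" unfolding F_def by (rule nth_root_10_cube_square_le)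
  have Fle: "real F \<le> real z powr (3 / 10)"
  proof -
    have "real F \<le> real (z ^ 3) powr (1 / 10)" unfolding F_def using nth_root_nat_le_powr[of 10 "z ^ 3"] by simp
    also have "\<dots> = real z powr (3 / 10)" using z by (simp add: power_powr)
    finally show ?thesis .
  qed
  have Fge: "real z powr (3 / 10) \<le> 2 * real F"
  proof -
    have "\<not> (F + 1) ^ 10 \<le> z ^ 3" using nth_root_nat_ge_iff[of 10 "F + 1" "z ^ 3"] by (simp add: F_def)
    then have "z ^ 3 \<le> (F + 1) ^ 10" by simp
    also have "\<dots> \<le> (2 * F) ^ 10" using F0 by (intro power_mono) auto
    finally have "real (z ^ 3) \<le> real ((2 * F) ^ 10)" by (simp only: of_nat_le_iff)
    then have "real z ^ 3 \<le> (2 * real F) ^ 10" by simp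
    then have "(real z ^ 3) powr (1 / 10) \<le> ((2 * real F) ^ 10) powr (1 / 10)" by (intro powr_mono2) auto
    moreover have "(real z ^ 3) powr (1 / 10) = real z powr (3 / 10)" using z by (simp add: power_powr)
    moreover have "((2 * real F) ^ 10) powr (1 / 10) = 2 * real F" using F0 by (subst power_powr) auto
    ultimately show ?thesis by simp
  qed
  have small: "real (\<Sum>f=1..F. cost_pairs L T (z div f\<^sup>2) + 10) \<le> 600060 * S * Z"
  proof -
    have "real (cost_pairs L T (z div f\<^sup>2) + 10) \<le> 100010 * S * (real z powr (5 / 12)) * real f powr (- 5 / 6)"
      if f: "f \<in> {1..F}" for f
    proof -
      have f2: "f\<^sup>2 \<le> z" by (rule order.trans[OF power_mono F2]) (use f in simp_all)
      \<comment> \<open>The overhead of 10 per term is absorbed because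
        \<open>f\<^sup>2 \<le> z\<close> makes the main term at least 1.\<close>
      have "1 \<le> real z / real (f\<^sup>2)" using f f2 by (simp add: le_divide_eq del: of_nat_power)
      then have "1 \<le> (real z / real (f\<^sup>2)) powr (5 / 12)" by (simp add: ge_one_powr_ge_zero)
      also have eq: "\<dots> = real z powr (5 / 12) * real f powr (- 5 / 6)"
        using f by (simp add: powr_divide power_powr powr_minus_divide)
      finally have 1: "1 \<le> real z powr (5 / 12) * real f powr (- 5 / 6)" .
      have "real (z div f\<^sup>2) powr (5 / 12) \<le> (real z / real (f\<^sup>2)) powr (5 / 12)"
        by (intro powr_mono2 of_nat_div_le_of_nat) auto
      then have 2: "real (z div f\<^sup>2) powr (5 / 12) \<le> real z powr (5 / 12) * real f powr (- 5 / 6)" unfolding eq .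
      have "real (cost_pairs L T (z div f\<^sup>2)) \<le> 100000 * S * (real z powr (5 / 12) * real f powr (- 5 / 6))"
        unfolding S_def by (rule order.trans[OF cost_pairs_le mult_left_mono[OF 2]]) auto
      moreover have "10 \<le> 10 * S * (real z powr (5 / 12) * real f powr (- 5 / 6))"
        using mult_mono[OF S0(2) 1] S0 by simp
      ultimately show ?thesis by (simp add: algebra_simps)
    qed
    then have "real (\<Sum>f=1..F. cost_pairs L T (z div f\<^sup>2) + 10)
        \<le> (\<Sum>f=1..F. 100010 * S * (real z powr (5 / 12)) * real f powr (- 5 / 6))"
      unfolding of_nat_sum by (intro sum_mono)
    also have "\<dots> = 100010 * S * real z powr (5 / 12) * (\<Sum>f=1..F. real f powr (- 5 / 6))"
      by (simp add: sum_distrib_left)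
    also have "\<dots> \<le> 100010 * S * real z powr (5 / 12) * (6 * real z powr (1 / 20))"
    proof (intro mult_left_mono)
      have "real F powr (1 / 6) \<le> (real z powr (3 / 10)) powr (1 / 6)" using Fle by (intro powr_mono2) auto
      also have "\<dots> = real z powr (1 / 20)" by (simp add: powr_powr)
      finally show "(\<Sum>f=1..F. real f powr (- 5 / 6)) \<le> 6 * real z powr (1 / 20)"
        using sum_powr_le[of F] by linarith
    qed (use S0 in auto)
    also have "\<dots> = 600060 * S * (real z powr (5 / 12) * real z powr (1 / 20))" by simp
    also have "real z powr (5 / 12) * real z powr (1 / 20) = Z"
      unfolding Z_def powr_add[symmetric] by simp
    finally show ?thesis .
  qed
  have large: "real (\<Sum>u=1..s. (m div u) * (22 * (L + 1) + 10) + 8) \<le> 2112 * S * Z"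
  proof -
    have sm: "s \<le> m" unfolding s_def by (rule nth_root_nat_le_self) simp
    have "real ((m div u) * (22 * (L + 1) + 10) + 8) \<le> 22 * S * real m * real u powr (- 5 / 6)"
      if u: "u \<in> {1..s}" for u
    proof -
      have "1 \<le> m div u" using u sm by (simp add: Suc_le_eq div_greater_zero_iff)
      then have "(m div u) * (22 * (L + 1) + 10) + 8 \<le> (m div u) * (22 * (L + 1) + 10) + (m div u) * 8" by simp
      also have "\<dots> = (m div u) * (22 * L + 40)" by (simp add: algebra_simps)
      finally have "real ((m div u) * (22 * (L + 1) + 10) + 8) \<le> real ((m div u) * (22 * L + 40))"
        by (simp only: of_nat_le_iff)
      also have "\<dots> = real (m div u) * (22 * real L + 40)" by simp
      also have "\<dots> \<le> (real m / real u) * (22 * S)"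
        using S by (intro mult_mono of_nat_div_le_of_nat) auto
      \<comment> \<open>Weakening 1/u to this power lets \<open>sum_powr_le\<close> replace a
        harmonic sum. The loss of a factor m^(1/6) still fits under the exponent 7/15, since
        \<open>m\<close> is only about z^(2/5).\<close>
      also have "real m / real u \<le> real m * real u powr (- 5 / 6)"
      proof -
        have "real u powr (- 1) \<le> real u powr (- 5 / 6)" using u by (intro powr_mono) auto
        then have "real m * real u powr (- 1) \<le> real m * real u powr (- 5 / 6)" by (intro mult_left_mono) auto
        then show ?thesis using u by (simp add: powr_minus_divide)
      qed
      then have "(real m / real u) * (22 * S) \<le> (real m * real u powr (- 5 / 6)) * (22 * S)"
        using S0 by (intro mult_right_mono) auto
      finally show ?thesis by (simp add: ac_simps)
    qed
    then have "real (\<Sum>u=1..s. (m div u) * (22 * (L + 1) + 10) + 8)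
        \<le> (\<Sum>u=1..s. 22 * S * real m * real u powr (- 5 / 6))"
      unfolding of_nat_sum by (intro sum_mono)
    also have "\<dots> = 22 * S * real m * (\<Sum>u=1..s. real u powr (- 5 / 6))"
      by (simp add: sum_distrib_left)
    also have "\<dots> \<le> 22 * S * real m * (6 * real m powr (1 / 6))"
    proof (intro mult_left_mono)
      have "real s powr (1 / 6) \<le> real m powr (1 / 6)" using sm by (intro powr_mono2) auto
      then show "(\<Sum>u=1..s. real u powr (- 5 / 6)) \<le> 6 * real m powr (1 / 6)"
        using sum_powr_le[of s] by linarith
    qed (use S0 in auto)
    also have "\<dots> = 132 * S * (real m * real m powr (1 / 6))" by simp
    also have "real m * real m powr (1 / 6) \<le> 16 * Z"
    proof -
      have "real m \<le> real z / real (F\<^sup>2)" unfolding m_def by (rule of_nat_div_le_of_nat)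
      also have "\<dots> \<le> 4 * real z powr (2 / 5)"
      proof -
        have "real z powr (3 / 10) * real z powr (3 / 10) \<le> (2 * real F) * (2 * real F)"
          using Fge by (intro mult_mono) auto
        then have "real z powr (3 / 5) \<le> 4 * real (F\<^sup>2)"
          by (simp add: powr_add[symmetric] power2_eq_square)
        then have "real z powr (2 / 5) * real z powr (3 / 5) \<le> real z powr (2 / 5) * (4 * real (F\<^sup>2))"
          by (intro mult_left_mono) auto
        then have "real z \<le> 4 * real z powr (2 / 5) * real (F\<^sup>2)"
          using z by (simp add: powr_add[symmetric] ac_simps)
        then show ?thesis using F0 by (simp add: divide_le_eq)
      qed
      finally have m4: "real m \<le> 4 * real z powr (2 / 5)" .
      have "real m powr (7 / 6) \<le> (4 * real z powr (2 / 5)) powr (7 / 6)" using m4 by (intro powr_mono2) auto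
      also have "\<dots> = 4 powr (7 / 6) * Z" unfolding Z_def by (simp add: powr_mult powr_powr)
      also have "\<dots> \<le> 16 * Z"
      proof (intro mult_right_mono)
        have "(4::real) powr (7 / 6) \<le> 4 powr 2" by (intro powr_mono) auto
        then show "(4::real) powr (7 / 6) \<le> 16" by simp
      qed (use Z1 in auto)
      also have "real m powr (7 / 6) = real m * real m powr (1 / 6)"
      proof (cases "m = 0")
        case False
        have "real m powr (7 / 6) = real m powr (1 + 1 / 6)" by simp
        also have "\<dots> = real m * real m powr (1 / 6)" unfolding powr_add using False by simp
        finally show ?thesis .
      qed simp
      finally show ?thesis .
    qed
    then have "132 * S * (real m * real m powr (1 / 6)) \<le> 132 * S * (16 * Z)"
      using S0 by (intro mult_left_mono) auto
    finally show ?thesis by simp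
  qed
  have const: "real (76 * (L + 1) + 20) \<le> 76 * S * Z"
  proof -
    have "real (76 * (L + 1) + 20) \<le> 76 * S * 1" using S by simp
    also have "\<dots> \<le> 76 * S * Z" using Z1 S0 by (intro mult_left_mono) auto
    finally show ?thesis .
  qed
  have "real (cost_triples L T z) = real (76 * (L + 1) + 20) +
     real (\<Sum>f=1..F. cost_pairs L T (z div f\<^sup>2) + 10) + real (\<Sum>u=1..s. (m div u) * (22 * (L + 1) + 10) + 8)"
    unfolding cost_triples_def Let_def F_def[symmetric] m_def[symmetric] s_def[symmetric] by (simp only: of_nat_add)
  also have "\<dots> \<le> 76 * S * Z + 600060 * S * Z + 2112 * S * Z"
    using const small large by linarith
  also have "\<dots> = 602248 * (S * Z)" by simp
  also have "\<dots> \<le> 700000 * (S * Z)" using S0 Z1 by (intro mult_right_mono) auto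
  finally show ?thesis unfolding S_def Z_def by (simp only: mult.assoc)
qed

text \<open>Division by \<open>g ^ 4\<close> makes the costs decay like g^(-28/15), and since 28/15
  = 4 * 7/15 exceeds 1, the sum over \<open>g\<close> is bounded by the constant \<open>W\<close>.
  The squarefreeness tests add only y^(1/4 + 1/8).\<close>

lemma cost_primepow_le:
  obtains c :: real where "0 < c"
    "\<And>L T y. 0 < y \<Longrightarrow> 1 \<le> T \<Longrightarrow> real (cost_primepow L T y) \<le> c * real ((L + 3) * T) * real y powr (7 / 15)"
proof -
  define W where "W = (\<Sum>n. real n powr (- 28 / 15))"
  have summ: "summable (\<lambda>n. real n powr (- 28 / 15))"
    by (subst summable_real_powr_iff) simp
  have W0: "0 \<le> W" unfolding W_def using summ by (intro suminf_nonneg) auto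
  define c where "c = 700000 * W + 48"
  have "real (cost_primepow L T y) \<le> c * real ((L + 3) * T) * real y powr (7 / 15)"
    if y: "0 < y" and T: "1 \<le> T" for L T y
  proof -
    define S where "S = real ((L + 3) * T)"
    define G where "G = nth_root_nat 4 y"
    define Y where "Y = real y powr (7 / 15)"
    have "L + 3 \<le> (L + 3) * T" using T by simp
    then have S: "1 \<le> S" unfolding S_def by linarith
    have Y1: "1 \<le> Y" unfolding Y_def using y by (simp add: ge_one_powr_ge_zero)
    have G4: "G ^ 4 \<le> y" unfolding G_def by (rule nth_root_nat_power_le) simp
    have Gle: "real G \<le> real y powr (1 / 4)" unfolding G_def using nth_root_nat_le_powr[of 4 y] by simp
    have t: "real (cost_triples L T (y div g ^ 4)) \<le> 700000 * S * Y * real g powr (- 28 / 15)"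
      if g: "g \<in> {1..G}" for g
    proof -
      have "g ^ 4 \<le> y" by (rule order.trans[OF power_mono G4]) (use g in simp_all)
      then have "0 < y div g ^ 4" using g by (simp add: div_greater_zero_iff)
      then have "real (cost_triples L T (y div g ^ 4)) \<le> 700000 * S * real (y div g ^ 4) powr (7 / 15)"
        unfolding S_def using T by (rule cost_triples_le)
      also have "\<dots> \<le> 700000 * S * (Y * real g powr (- 28 / 15))"
      proof (intro mult_left_mono)
        have "real (y div g ^ 4) powr (7 / 15) \<le> Y * real (g ^ 4) powr (- (7 / 15))"
          unfolding Y_def by (rule real_div_powr_le) simp
        also have "real (g ^ 4) powr (- (7 / 15)) = real g powr (- 28 / 15)"
          using g by (simp add: power_powr)
        finally show "real (y div g ^ 4) powr (7 / 15) \<le> Y * real g powr (- 28 / 15)" .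
      qed (use S in auto)
      finally show ?thesis by simp
    qed
    have q: "8 * real (nth_root_nat 2 g) + 30 \<le> 38 * real y powr (1 / 8)" if g: "g \<in> {1..G}" for g
    proof -
      have "real (nth_root_nat 2 g) \<le> real g powr (1 / 2)" using nth_root_nat_le_powr[of 2 g] by simp
      also have "\<dots> \<le> (real y powr (1 / 4)) powr (1 / 2)" using g Gle by (intro powr_mono2) auto
      also have "\<dots> = real y powr (1 / 8)" by (simp add: powr_powr)
      finally have "real (nth_root_nat 2 g) \<le> real y powr (1 / 8)" .
      moreover have "1 \<le> real y powr (1 / 8)" using y by (simp add: ge_one_powr_ge_zero)
      ultimately show ?thesis by linarith
    qed
    have "real (cost_primepow L T y) = 10 + ((\<Sum>g=1..G. real (cost_triples L T (y div g ^ 4))) +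
        (\<Sum>g=1..G. 8 * real (nth_root_nat 2 g) + 30))"
      unfolding cost_primepow_def G_def[symmetric] by (simp add: sum.distrib)
    also have "(\<Sum>g=1..G. real (cost_triples L T (y div g ^ 4))) \<le> (\<Sum>g=1..G. 700000 * S * Y * real g powr (- 28 / 15))"
      using t by (intro sum_mono)
    also have "\<dots> = 700000 * S * Y * (\<Sum>g=1..G. real g powr (- 28 / 15))" by (simp add: sum_distrib_left)
    also have "\<dots> \<le> 700000 * S * Y * W"
      unfolding W_def using S Y1 summ by (intro mult_left_mono sum_le_suminf) auto
    also have "(\<Sum>g=1..G. 8 * real (nth_root_nat 2 g) + 30) \<le> (\<Sum>g=1..G. 38 * real y powr (1 / 8))"
      using q by (intro sum_mono)
    also have "\<dots> = 38 * (real G * real y powr (1 / 8))" by simp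
    also have "real G * real y powr (1 / 8) \<le> Y"
    proof -
      have "real G * real y powr (1 / 8) \<le> real y powr (1 / 4) * real y powr (1 / 8)"
        using Gle by (intro mult_right_mono) auto
      also have "\<dots> = real y powr (3 / 8)" by (simp add: powr_add[symmetric])
      also have "\<dots> \<le> Y" unfolding Y_def using y by (intro powr_mono) auto
      finally show ?thesis .
    qed
    also have "10 + (700000 * S * Y * W + 38 * Y) \<le> c * S * Y"
    proof -
      have "Y \<le> S * Y" "1 \<le> S * Y" using S Y1 mult_mono[OF S Y1] by (auto simp: mult_le_cancel_right1)
      then have "10 + (700000 * S * Y * W + 38 * Y) \<le> 10 * (S * Y) + (700000 * S * Y * W + 38 * (S * Y))"
        by linarith
      also have "\<dots> = c * S * Y" unfolding c_def by (simp add: algebra_simps)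
      finally show ?thesis .
    qed
    finally show ?thesis unfolding S_def Y_def by simp
  qed
  moreover have "0 < c" using W0 unfolding c_def by linarith
  ultimately show ?thesis by (intro that)
qed

section \<open>The interval and the final estimate\<close>

lemma card_primes_interval_parity:
  fixes a b :: real
  assumes "1 \<le> a" "a \<le> b"
  shows "card {p :: nat. prime p \<and> real p \<in> {a..b}} mod 2 =
    (card {p. p \<le> nat \<lfloor>b\<rfloor> \<and> prime p} + card {p. p \<le> nat \<lceil>a\<rceil> - 1 \<and> prime p}) mod 2"
proof -
  define l where "l = nat \<lceil>a\<rceil>"
  define u where "u = nat \<lfloor>b\<rfloor>"
  let ?I = "{p :: nat. prime p \<and> real p \<in> {a..b}}"
  have I: "p \<in> ?I \<longleftrightarrow> prime p \<and> l \<le> p \<and> p \<le> u" for p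
    unfolding l_def u_def using assms by (auto simp: nat_le_iff le_nat_iff le_floor_iff ceiling_le_iff)
  have l: "1 \<le> l" unfolding l_def using assms by linarith
  \<comment> \<open>This includes an interval without integers, where
    \<open>l = u + 1\<close>.\<close>
  have "l - 1 \<le> u"
  proof -
    have "\<lceil>a\<rceil> - 1 \<le> \<lfloor>b\<rfloor>" using assms by linarith
    then show ?thesis unfolding l_def u_def by linarith
  qed
  then have "{p. p \<le> u \<and> prime p} = ?I \<union> {p. p \<le> l - 1 \<and> prime p}"
    unfolding set_eq_iff Un_iff I using l by auto
  moreover have "?I \<inter> {p. p \<le> l - 1 \<and> prime p} = {}"
    unfolding set_eq_iff Int_iff I using l by auto
  moreover have "finite {p. p \<le> u \<and> prime p}" by (rule finite_subset[of _ "{..u}"]) auto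
  ultimately have "card {p. p \<le> u \<and> prime p} = card ?I + card {p. p \<le> l - 1 \<and> prime p}"
    by (simp add: card_Un_disjoint)
  then show ?thesis unfolding l_def u_def by presburger
qed

text \<open>Logarithms are absorbed by \<open>ln x \<le> x powr \<delta> / \<delta>\<close>; the
  factor 2 bounds \<open>1 / ln 2\<close>.\<close>

lemma bits_le_powr:
  fixes \<delta> :: real
  assumes "0 < \<delta>" "1 \<le> x" "real n \<le> 2 * x + 2"
  shows "real (bits n) \<le> (4 + 2 / \<delta>) * x powr \<delta>"
proof -
  have x1: "1 \<le> x powr \<delta>" using assms by (simp add: ge_one_powr_ge_zero)
  have "real (floor_log n) \<le> 3 + 2 * ln x"
  proof (cases "n = 0")
    case False
    have "2 ^ floor_log n \<le> n" using False by (simp add: floor_log_exp2_le)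
    then have "real (2 ^ floor_log n) \<le> real n" by (simp only: of_nat_le_iff)
    also have "\<dots> \<le> 4 * x" using assms by simp
    finally have "ln (2 ^ floor_log n) \<le> ln (4 * x)" using assms by (intro iffD2[OF ln_le_cancel_iff]) auto
    then have "real (floor_log n) * ln 2 \<le> ln 4 + ln x" using assms by (simp add: ln_realpow ln_mult)
    moreover have "ln (4::real) = 2 * ln 2" using ln_realpow[of "2::real" 2] by simp
    moreover have "1 / 2 \<le> ln (2::real)" using ln_le_minus_one[of "1 / 2 :: real"] by (simp add: ln_div)
    ultimately have "real (floor_log n) * ln 2 \<le> (2 + 2 * ln x) * ln 2"
      using assms mult_left_mono[of "1 / 2" "ln 2" "2 * ln x"] by (simp add: algebra_simps)
    then show ?thesis by simp
  qed (use assms in simp)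
  moreover have "ln x \<le> x powr \<delta> / \<delta>" using assms by (intro ln_powr_bound)
  ultimately have "real (bits n) \<le> 4 + 2 * (x powr \<delta> / \<delta>)" unfolding bits_def by simp
  also have "\<dots> \<le> 4 * x powr \<delta> + 2 * (x powr \<delta> / \<delta>)" using x1 by simp
  also have "\<dots> = (4 + 2 / \<delta>) * x powr \<delta>" by (simp add: algebra_simps)
  finally show ?thesis .
qed

text \<open>Of the five factors \<open>L + 3\<close>, one comes from the loop over the root
  exponents, two from a single round of it, and two from the bit cost of an instruction.\<close>

lemma cost_total_le:
  assumes "real C \<le> c * (real L + 3) * T * Y" "0 \<le> c" "1 \<le> T" "1 \<le> Y"
  shows "real ((10 + 2 * ((L + 1) * (C + (4 * L + 14) * (L + 1) + 8 * L + 30))) * (10 * L\<^sup>2))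
     \<le> (20 * c + 1500) * (real L + 3) ^ 5 * T * Y"
proof -
  define l where "l = real L + 3"
  have l: "3 \<le> l" "real L \<le> l" "real L + 1 \<le> l" "1 \<le> l" unfolding l_def by simp_all
  have TY: "1 \<le> T * Y" using mult_mono[OF assms(3,4)] assms by simp
  have l2: "l * l \<ge> 1 * 1" using l by (intro mult_mono) auto
  have a: "(4 * real L + 14) * (real L + 1) + 8 * real L + 30 \<le> 50 * (l * l)"
    unfolding l_def by (simp add: algebra_simps)
  have b: "50 * (l * l) \<le> 50 * (l * l) * (T * Y)"
    using mult_left_mono[OF TY, of "50 * (l * l)"] l2 by simp
  have "real C + (4 * real L + 14) * (real L + 1) + 8 * real L + 30 \<le> c * l * (T * Y) + 50 * (l * l) * (T * Y)"
    using assms(1) a b unfolding l_def[symmetric] by (simp add: mult.assoc)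
  also have "c * l * (T * Y) \<le> c * (l * l) * (T * Y)"
    using assms(2) l TY by (intro mult_right_mono mult_left_mono) auto
  finally have m: "real C + (4 * real L + 14) * (real L + 1) + 8 * real L + 30 \<le> (c + 50) * (l * l) * (T * Y)"
    by (simp add: algebra_simps)
  have "(real L + 1) * (real C + (4 * real L + 14) * (real L + 1) + 8 * real L + 30)
      \<le> l * ((c + 50) * (l * l) * (T * Y))"
    using l m by (intro mult_mono) auto
  moreover have "10 \<le> 10 * (l * (l * l) * (T * Y))"
  proof -
    have "1 * 1 \<le> l * (l * l)" using l l2 by (intro mult_mono) auto
    then have "1 * 1 \<le> (l * (l * l)) * (T * Y)" using TY by (intro mult_mono) auto
    then show ?thesis by simp
  qed
  ultimately have n: "10 + 2 * ((real L + 1) * (real C + (4 * real L + 14) * (real L + 1) + 8 * real L + 30))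
      \<le> (2 * c + 110) * (l * (l * l) * (T * Y))"
    by (simp add: algebra_simps)
  have "(10 + 2 * ((real L + 1) * (real C + (4 * real L + 14) * (real L + 1) + 8 * real L + 30))) * (10 * (real L)\<^sup>2)
      \<le> (2 * c + 110) * (l * (l * l) * (T * Y)) * (10 * l\<^sup>2)"
    using l n assms(2) TY by (intro mult_mono power_mono) auto
  also have "\<dots> = (20 * c + 1100) * (l ^ 5 * (T * Y))"
    by (simp add: algebra_simps eval_nat_numeral)
  also have "\<dots> \<le> (20 * c + 1500) * (l ^ 5 * (T * Y))"
    using l TY by (intro mult_right_mono) auto
  finally show ?thesis
    unfolding l_def by (simp only: of_nat_mult of_nat_add of_nat_power of_nat_numeral of_nat_1 mult.assoc)
qed

theorem theorem2:
  fixes c :: real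
  assumes "0 < c" and "c \<le> 1 / 2"
  shows "\<exists>P :: program. \<forall>\<epsilon>::real. \<epsilon> > 0 \<longrightarrow> (\<exists>C::real. \<forall>x a b :: real.
           1 \<le> x \<longrightarrow> a \<le> b \<longrightarrow> {a..b} \<subseteq> {x..2 * x} \<longrightarrow> b - a \<le> x powr (1 / 2 + c) \<longrightarrow>
           (\<exists>t. computes_in_time P (interval_input a b x)
                  (card {p :: nat. prime p \<and> real p \<in> {a..b}} mod 2) t \<and>
                real t \<le> C * x powr (max c (7 / 15) + \<epsilon>)))"
proof (intro exI[of _ "compile 0 parity_com"] allI impI)
  \<comment> \<open>The program has been fixed before \<epsilon>, which only influences the
    constants of the analysis.\<close>
  fix \<epsilon> :: real assume \<epsilon>: "0 < \<epsilon>"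
  \<comment> \<open>Seven factors \<open>x powr \<delta>\<close> will be spent: six are allowed for
    the logarithms and one for the divisor bound \<open>T\<close>.\<close>
  define \<delta> where "\<delta> = \<epsilon> / 7"
  have \<delta>: "0 < \<delta>" using \<epsilon> by (simp add: \<delta>_def)
  obtain D where D: "0 < D" "\<And>n. 0 < n \<Longrightarrow> real (card {d. d dvd n}) \<le> D * real n powr \<delta>"
    using divisor_bound[OF \<delta>] by blast
  obtain c1 where c1: "0 < c1"
    "\<And>L T y. 0 < y \<Longrightarrow> 1 \<le> T \<Longrightarrow> real (cost_primepow L T y) \<le> c1 * real ((L + 3) * T) * real y powr (7 / 15)"
    using cost_primepow_le by blast
  \<comment> \<open>From \<open>L + 3 = 4 * bits (y + 2) + 16\<close>, the bit length being
    estimated by \<open>bits_le_powr\<close>.\<close>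
  define K where "K = 4 * (4 + 2 / \<delta>) + 16"
  \<comment> \<open>The number 8194 arises from \<open>n \<le> 4097 * y\<close> and
    \<open>y \<le> 2 * x\<close>; the added 1 makes \<open>T\<close> at least 1.\<close>
  define D' where "D' = D * 8194 powr \<delta> + 1"
  define C where "C = (20 * c1 + 1500) * K ^ 6 * D' * 2"
  have K0: "0 < K" unfolding K_def using \<delta> by (simp add: add_pos_pos)
  have D'0: "0 < D'" unfolding D'_def using D(1) by (simp add: add_nonneg_pos)
  show "\<exists>C::real. \<forall>x a b :: real.
           1 \<le> x \<longrightarrow> a \<le> b \<longrightarrow> {a..b} \<subseteq> {x..2 * x} \<longrightarrow> b - a \<le> x powr (1 / 2 + c) \<longrightarrow>
           (\<exists>t. computes_in_time (compile 0 parity_com) (interval_input a b x)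
                  (card {p :: nat. prime p \<and> real p \<in> {a..b}} mod 2) t \<and>
                real t \<le> C * x powr (max c (7 / 15) + \<epsilon>))"
  proof (intro exI[of _ C] allI impI)
    fix x a b :: real
    assume x: "1 \<le> x" and ab: "a \<le> b" and sub: "{a..b} \<subseteq> {x..2 * x}"
    have ax: "x \<le> a" "b \<le> 2 * x" using sub ab by auto
    define l where "l = nat \<lceil>a\<rceil>"
    define u where "u = nat \<lfloor>b\<rfloor>"
    define y where "y = nat \<lfloor>2 * x\<rfloor>"
    \<comment> \<open>Four times the bit length makes room for \<open>(y + 2) ^ 4\<close>, and the
      13 ensures \<open>12 < L\<close>.\<close>
    define L where "L = 4 * bits (y + 2) + 13"
    define T where "T = nat \<lfloor>D' * x powr \<delta>\<rfloor>"
    \<comment> \<open>The factor 2 covers \<open>2 powr (7 / 15)\<close>, which arises in passing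
      from \<open>y \<le> 2 * x\<close> to \<open>x\<close>.\<close>
    define Y where "Y = 2 * x powr (7 / 15)"
    define N where "N = nat \<lfloor>c1 * real ((L + 3) * T) * Y\<rfloor>"
    have x\<delta>: "1 \<le> x powr \<delta>" using x \<delta> by (simp add: ge_one_powr_ge_zero)
    have yx: "real y \<le> 2 * x" "2 \<le> y" unfolding y_def using x by linarith+
    have ly: "l - 1 \<le> y" "u \<le> y" "l \<le> y + 1" "nat \<lfloor>x\<rfloor> \<le> y"
      unfolding l_def u_def y_def using ax ab x by linarith+
    have L12: "12 < L" "1 \<le> L" unfolding L_def by simp_all
    have yL: "(y + 2) ^ 4 < 2 ^ L"
    proof -
      have "y + 2 < 2 ^ bits (y + 2)" using floor_log_exp2_gt[of "y + 2"] by (simp add: bits_def)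
      then have "(y + 2) ^ 4 < (2 ^ bits (y + 2)) ^ 4" by (intro power_strict_mono) auto
      also have "\<dots> = 2 ^ (4 * bits (y + 2))" by (simp add: power_mult[symmetric] mult.commute)
      also have "\<dots> \<le> 2 ^ L" unfolding L_def by (intro power_increasing) auto
      finally show ?thesis .
    qed
    have y2L: "y + 2 < 2 ^ L" using self_le_power[of "y + 2" 4] yL by simp
    have Lle: "real L + 3 \<le> K * x powr \<delta>"
    proof -
      have "real (bits (y + 2)) \<le> (4 + 2 / \<delta>) * x powr \<delta>" using yx by (intro bits_le_powr[OF \<delta> x]) simp
      then have "real L + 3 \<le> 4 * ((4 + 2 / \<delta>) * x powr \<delta>) + 16" unfolding L_def by simp
      also have "\<dots> \<le> 4 * ((4 + 2 / \<delta>) * x powr \<delta>) + 16 * x powr \<delta>" using x\<delta> by simp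
      also have "\<dots> = K * x powr \<delta>" unfolding K_def by (simp add: algebra_simps)
      finally show ?thesis .
    qed
    have T1: "1 \<le> T"
    proof -
      have "1 * 1 \<le> D' * x powr \<delta>" using x\<delta> D by (intro mult_mono) (auto simp: D'_def)
      then show ?thesis unfolding T_def by (simp add: le_nat_iff le_floor_iff)
    qed
    have Tle: "real T \<le> D' * x powr \<delta>" unfolding T_def using D'0 by simp
    have Tdiv: "card {d. d dvd n} \<le> T" if n: "0 < n" "n \<le> 4097 * y" for n
    proof -
      have "real n \<le> 8194 * x" using n(2) yx(1) by linarith
      then have "real n powr \<delta> \<le> (8194 * x) powr \<delta>" using \<delta> by (intro powr_mono2) auto
      also have "\<dots> = 8194 powr \<delta> * x powr \<delta>" by (rule powr_mult)
      finally have "D * real n powr \<delta> \<le> D * (8194 powr \<delta> * x powr \<delta>)" using D(1) by (intro mult_left_mono) auto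
      also have "\<dots> \<le> D' * x powr \<delta>" unfolding D'_def by (simp add: algebra_simps)
      finally have "real (card {d. d dvd n}) \<le> D' * x powr \<delta>" using D(2)[OF n(1)] by linarith
      then show ?thesis unfolding T_def by (simp add: le_nat_iff le_floor_iff)
    qed
    have Y1: "1 \<le> Y" unfolding Y_def using x ge_one_powr_ge_zero[of x "7 / 15"] by simp
    have yY: "real r powr (7 / 15) \<le> Y" if "r \<le> y" for r
    proof -
      have "real r powr (7 / 15) \<le> (2 * x) powr (7 / 15)" using that yx(1) by (intro powr_mono2) auto
      also have "\<dots> = 2 powr (7 / 15) * x powr (7 / 15)" by (rule powr_mult)
      also have "\<dots> \<le> 2 powr 1 * x powr (7 / 15)" by (intro mult_right_mono powr_mono) auto
      finally show ?thesis unfolding Y_def by simp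
    qed
    have cost: "cost_primepow L T r \<le> N" if r: "0 < r" "r \<le> y" for r
    proof -
      have "real (cost_primepow L T r) \<le> c1 * real ((L + 3) * T) * real r powr (7 / 15)" using c1(2)[OF r(1) T1] .
      also have "\<dots> \<le> c1 * real ((L + 3) * T) * Y" using yY[OF r(2)] c1(1) by (intro mult_left_mono) auto
      finally show ?thesis unfolding N_def by (simp add: le_nat_iff le_floor_iff)
    qed
    have Nle: "real N \<le> c1 * (real L + 3) * real T * Y"
    proof -
      have "0 \<le> c1 * real ((L + 3) * T) * Y" using c1(1) Y1 by simp
      then have "real N \<le> c1 * real ((L + 3) * T) * Y" unfolding N_def by linarith
      then show ?thesis by (simp add: mult.assoc)
    qed
    let ?ns = "interval_input a b x"
    define steps where "steps = 10 + 2 * ((L + 1) * (N + (4 * L + 14) * (L + 1) + 8 * L + 30))"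
    have ns: "?ns = [l, u, nat \<lfloor>x\<rfloor>]" by (simp add: interval_input_def l_def u_def)
    have "wp (2 ^ L) parity_com (\<lambda>M' t'.
        M' 0 = (card {p. p \<le> u \<and> prime p} + card {p. p \<le> l - 1 \<and> prime p}) mod 2 \<and> t' \<le> steps)
        (initial_memory ?ns) 0"
      unfolding steps_def
      by (rule wp_parity[where y = y and T = T])
         (use ly yL L12 T1 Tdiv cost in \<open>auto simp: ns initial_memory_def\<close>)
    moreover have "com_below (2 ^ L) parity_com"
    proof (rule com_below_mono[OF com_below_parity])
      have "(2::nat) ^ 7 \<le> 2 ^ L" using L12 by (intro power_increasing) auto
      then show "(100::nat) \<le> 2 ^ L" by simp
    qed
    moreover have "\<forall>n\<in>set ?ns. n < 2 ^ L"
    proof -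
      have "l < 2 ^ L" "u < 2 ^ L" "nat \<lfloor>x\<rfloor> < 2 ^ L" using ly y2L by linarith+
      then show ?thesis unfolding ns by simp
    qed
    ultimately obtain t where t: "computes_in_time (compile 0 parity_com) ?ns
        ((card {p. p \<le> u \<and> prime p} + card {p. p \<le> l - 1 \<and> prime p}) mod 2) t" "t \<le> steps * (10 * L\<^sup>2)"
      using computes_in_time_compile[OF _ _ _ L12(2)] by blast
    have "real t \<le> real (steps * (10 * L\<^sup>2))" using t(2) by (simp only: of_nat_le_iff)
    also have "\<dots> \<le> (20 * c1 + 1500) * (real L + 3) ^ 5 * real T * Y"
      unfolding steps_def using c1(1) T1 Y1 by (intro cost_total_le[OF Nle]) auto
    also have "\<dots> \<le> (20 * c1 + 1500) * (K * x powr \<delta>) ^ 6 * (D' * x powr \<delta>) * Y"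
    proof (intro mult_mono)
      have "(real L + 3) ^ 5 \<le> (real L + 3) ^ 6" by (intro power_increasing) auto
      also have "\<dots> \<le> (K * x powr \<delta>) ^ 6" using Lle by (intro power_mono) auto
      finally show "(real L + 3) ^ 5 \<le> (K * x powr \<delta>) ^ 6" .
    qed (use Tle Y1 c1(1) D'0 K0 in auto)
    also have "\<dots> = C * x powr (7 / 15 + \<epsilon>)"
    proof -
      have "(x powr \<delta>) ^ 6 * x powr \<delta> = x powr \<epsilon>"
        using x by (simp add: powr_power powr_add[symmetric] \<delta>_def)
      then have "(K * x powr \<delta>) ^ 6 * (D' * x powr \<delta>) * x powr (7 / 15) = K ^ 6 * D' * (x powr \<epsilon> * x powr (7 / 15))"
        unfolding power_mult_distrib by (simp only: mult.assoc mult.left_commute)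
      moreover have "p * q * r * (2 * s) = p * 2 * (q * r * s)" for p q r s :: real by simp
      ultimately have "(20 * c1 + 1500) * (K * x powr \<delta>) ^ 6 * (D' * x powr \<delta>) * (2 * x powr (7 / 15)) =
          (20 * c1 + 1500) * 2 * (K ^ 6 * D' * (x powr \<epsilon> * x powr (7 / 15)))"
        by metis
      also have "\<dots> = C * (x powr (7 / 15) * x powr \<epsilon>)" unfolding C_def by (simp only: ac_simps)
      also have "\<dots> = C * x powr (7 / 15 + \<epsilon>)" by (simp only: powr_add)
      finally show ?thesis unfolding Y_def .
    qed
    also have "\<dots> \<le> C * x powr (max c (7 / 15) + \<epsilon>)"
      using x K0 D'0 c1(1) unfolding C_def by (intro mult_left_mono powr_mono) auto
    finally have "real t \<le> C * x powr (max c (7 / 15) + \<epsilon>)" .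
    moreover have "card {p :: nat. prime p \<and> real p \<in> {a..b}} mod 2 =
        (card {p. p \<le> u \<and> prime p} + card {p. p \<le> l - 1 \<and> prime p}) mod 2"
      unfolding l_def u_def using x ax(1) ab by (intro card_primes_interval_parity) auto
    ultimately show "\<exists>t. computes_in_time (compile 0 parity_com) (interval_input a b x)
                  (card {p :: nat. prime p \<and> real p \<in> {a..b}} mod 2) t \<and>
                real t \<le> C * x powr (max c (7 / 15) + \<epsilon>)"
      using t(1) by auto
  qed
qed

end
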